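(* Suppose $m(5)\ge 2$. Then for every bridgeless cubic graph $G$, every edge $e\in E(G)$ and every $i\in\{0,1,2\}$, there is an FR-triple $\mathcal T$ of $G$ with $\nu_{\mathcal T}(e)=i$.
   Context: Graphs are finite, may have parallel edges, but no loops. An $r$-graph is an $r$-regular graph in which every vertex set of odd cardinality is joined to its complement by at least $r$ edges; $r$-edge-connected means every nonempty proper vertex subset is joined to its complement by at least $r$ edges. $m(r)$ is the largest integer $t$ such that every $r$-edge-connected $r$-graph has $t$ pairwise disjoint perfect matchings. For a multiset $\mathcal F$ of edge sets and an edge $e$, $\nu_{\mathcal F}(e)$ is the number of members of $\mathcal F$ containing $e$. An FR-triple of a cubic graph $G$ is a multiset $\mathcal T$ of three perfect matchings of $G$ with $\nu_{\mathcal T}(e)\le 2$ for all $e\in E(G)$. *)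

theory Defs
  imports Main "HOL-Library.Multiset"
begin

text \<open>Finite loopless multigraphs. Edges are abstract objects, so distinct (parallel) edges
  may have the same set of ends.\<close>

record ('v, 'e) mgraph =
  verts :: "'v set"
  edges :: "'e set"
  ends :: "'e \<Rightarrow> 'v set"

definition wf_mgraph :: "('v, 'e) mgraph \<Rightarrow> bool" where
  "wf_mgraph G \<longleftrightarrow> finite (verts G) \<and> verts G \<noteq> {} \<and> finite (edges G) \<and>
     (\<forall>e\<in>edges G. ends G e \<subseteq> verts G \<and> card (ends G e) = 2)"

definition degree :: "('v, 'e) mgraph \<Rightarrow> 'v \<Rightarrow> nat" where
  "degree G v = card {e \<in> edges G. v \<in> ends G e}"

definition regular :: "nat \<Rightarrow> ('v, 'e) mgraph \<Rightarrow> bool" where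
  "regular r G \<longleftrightarrow> (\<forall>v\<in>verts G. degree G v = r)"

definition cubic :: "('v, 'e) mgraph \<Rightarrow> bool" where
  "cubic G \<longleftrightarrow> regular 3 G"

definition edge_cut :: "('v, 'e) mgraph \<Rightarrow> 'v set \<Rightarrow> 'e set" where
  "edge_cut G X = {e \<in> edges G. ends G e \<inter> X \<noteq> {} \<and> ends G e \<inter> (verts G - X) \<noteq> {}}"

definition r_graph :: "nat \<Rightarrow> ('v, 'e) mgraph \<Rightarrow> bool" where
  "r_graph r G \<longleftrightarrow> wf_mgraph G \<and> regular r G \<and>
     (\<forall>X. X \<subseteq> verts G \<and> odd (card X) \<longrightarrow> r \<le> card (edge_cut G X))"

definition edge_connected :: "nat \<Rightarrow> ('v, 'e) mgraph \<Rightarrow> bool" where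
  "edge_connected r G \<longleftrightarrow>
     (\<forall>X. X \<noteq> {} \<and> X \<subset> verts G \<longrightarrow> r \<le> card (edge_cut G X))"

definition adjacency :: "('v, 'e) mgraph \<Rightarrow> ('v \<times> 'v) set" where
  "adjacency G = {(u, v). \<exists>e\<in>edges G. ends G e = {u, v}}"

text \<open>Connected components, as vertex sets.\<close>

definition components :: "('v, 'e) mgraph \<Rightarrow> 'v set set" where
  "components G = verts G // {(u, v). u \<in> verts G \<and> v \<in> verts G \<and> (u, v) \<in> (adjacency G)\<^sup>*}"

definition delete_edge :: "('v, 'e) mgraph \<Rightarrow> 'e \<Rightarrow> ('v, 'e) mgraph" where
  "delete_edge G e = G\<lparr>edges := edges G - {e}\<rparr>"

definition bridge :: "('v, 'e) mgraph \<Rightarrow> 'e \<Rightarrow> bool" where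
  "bridge G e \<longleftrightarrow> e \<in> edges G \<and> card (components G) < card (components (delete_edge G e))"

definition bridgeless :: "('v, 'e) mgraph \<Rightarrow> bool" where
  "bridgeless G \<longleftrightarrow> \<not> (\<exists>e. bridge G e)"

definition perfect_matching :: "('v, 'e) mgraph \<Rightarrow> 'e set \<Rightarrow> bool" where
  "perfect_matching G M \<longleftrightarrow> M \<subseteq> edges G \<and> (\<forall>v\<in>verts G. \<exists>!e. e \<in> M \<and> v \<in> ends G e)"

definition has_disjoint_pms :: "('v, 'e) mgraph \<Rightarrow> nat \<Rightarrow> bool" where
  "has_disjoint_pms G t \<longleftrightarrow> (\<exists>F :: nat \<Rightarrow> 'e set.
     (\<forall>j<t. perfect_matching G (F j)) \<and> (\<forall>j<t. \<forall>k<t. j \<noteq> k \<longrightarrow> F j \<inter> F k = {}))"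

text \<open>Vertices and edges of type \<^typ>\<open>nat\<close> are no restriction: every finite multigraph is
  isomorphic to one of this kind. The maximum exists, since \<open>t = 0\<close> always qualifies and, by
  degree counting, \<open>t \<le> r\<close> whenever \<open>t\<close> qualifies (for \<open>r > 0\<close> consider two vertices joined by
  \<open>r\<close> parallel edges, for \<open>r = 0\<close> a single vertex).\<close>

definition m :: "nat \<Rightarrow> nat" where
  "m r = (GREATEST t. \<forall>G :: (nat, nat) mgraph.
     r_graph r G \<and> edge_connected r G \<longrightarrow> has_disjoint_pms G t)"

definition \<nu> :: "'e set multiset \<Rightarrow> 'e \<Rightarrow> nat" where
  "\<nu> F e = size {# M \<in># F. e \<in> M #}"

definition FR_triple :: "('v, 'e) mgraph \<Rightarrow> 'e set multiset \<Rightarrow> bool" where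
  "FR_triple G T \<longleftrightarrow> size T = 3 \<and> (\<forall>M \<in># T. perfect_matching G M) \<and>
     (\<forall>e\<in>edges G. \<nu> T e \<le> 2)"

end

theory Submission
  imports Defs
begin

text \<open>Let \<open>M\<close> be a perfect matching of a 3-edge-connected cubic graph \<open>G\<close>, and let \<open>H\<close> arise from \<open>G\<close> by
  doubling the edges outside \<open>M\<close>. Two disjoint perfect matchings of the 5-regular graph \<open>H\<close> form an FR-triple
  together with \<open>M\<close>, because the edges of \<open>M\<close> are not doubled. The graph \<open>H\<close> is 5-edge-connected iff \<open>M\<close>
  contains no 3- or 4-edge-cut; in the spirit of Kaiser and Skrekovski, such an \<open>M\<close> through a prescribed edge is
  found by induction over nontrivial 3- and 4-edge-cuts. When there are none, every perfect matching works:
  a first one comes from a Frink reduction, and one through the prescribed edge from the hypothesis applied to \<open>H\<close>.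

  To prescribe the edges of the two disjoint matchings at a vertex \<open>v\<close>, replace one side of \<open>K\<^bsub>5,5\<^esub>\<close> by five
  copies of \<open>H - v\<close>, attaching equally labelled edges to the same vertex of the other side. Each
  perfect matching leaves every copy through exactly one edge, and uses the five labels in five different copies.

  Finally, FR-triples are glued along 2-edge-cuts.\<close>

section \<open>Edge cuts and matchings\<close>

text \<open>A cut with \<open>d\<close> edges, \<open>k\<close> of them in \<open>M\<close>, has
  \<open>2 * d - k\<close> edges after doubling. As \<open>k\<close> and \<open>d\<close> have equal
  parity and \<open>d \<ge> 3\<close>, fewer than five remain only for \<open>k = d = 3\<close> or
  \<open>k = d = 4\<close>; hence exactly these cuts obstruct. Asking for a good matching through a
  given edge keeps the induction going: at a 3-edge-cut the second side must use the cut edge chosen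
  by the first, and at a 4-edge-cut the new edge of the gadget can be prescribed. The hard case is a
  4-edge-cut that the matching avoids altogether: the doubled cut then has eight edges and
  uncrossing alone gives no contradiction. It is settled by comparing how bad cuts pair the four
  edges. Five copies are just enough in the gluing: an edge at \<open>v\<close> lies in each of the
  two matchings in at most one copy, so two forbidden edges spoil at most four copies. Two edges
  have to be forbidden because \<open>\<nu> = 0\<close> means avoiding both copies of a doubled
  edge.\<close>

lemma wf_ends:
  assumes "wf_mgraph G" "f \<in> edges G"
  obtains u v where "u \<noteq> v" "ends G f = {u, v}" "u \<in> verts G" "v \<in> verts G"
proof -
  have "card (ends G f) = 2" "ends G f \<subseteq> verts G"
    using assms by (auto simp: wf_mgraph_def)
  then show thesis using that by (metis card_2_iff insert_subset)
qed

lemma wf_finite: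
  assumes "wf_mgraph G"
  shows "finite (verts G)" "finite (edges G)"
  using assms by (auto simp: wf_mgraph_def)

lemma finite_edge_cut: "wf_mgraph G \<Longrightarrow> finite (edge_cut G X)"
  by (auto simp: wf_mgraph_def edge_cut_def)

lemma edge_cut_subset: "edge_cut G X \<subseteq> edges G"
  by (auto simp: edge_cut_def)

lemma edge_cut_compl:
  assumes "X \<subseteq> verts G"
  shows "edge_cut G (verts G - X) = edge_cut G X"
proof -
  have "verts G - (verts G - X) = X" using assms by auto
  then show ?thesis by (auto simp: edge_cut_def)
qed

lemma card_filter_sum: "finite S \<Longrightarrow> card {x \<in> S. P x} = (\<Sum>x\<in>S. of_bool (P x))"
  by (simp add: Int_def)

text \<open>Double counting of incidences: an edge is counted twice if it lies inside
  \<open>X\<close> and once if it crosses the boundary. With \<open>S = edges G\<close> this is the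
  degree sum; with \<open>S\<close> a matching it counts the covered vertices.\<close>

lemma sum_incident:
  assumes wf: "wf_mgraph G" and X: "X \<subseteq> verts G" and S: "S \<subseteq> edges G"
  shows "(\<Sum>v\<in>X. card {f \<in> S. v \<in> ends G f})
    = 2 * card {f \<in> S. ends G f \<subseteq> X} + card (S \<inter> edge_cut G X)"
proof -
  have fS: "finite S" and fX: "finite X"
    using wf_finite[OF wf] S X finite_subset by auto
  have "(\<Sum>v\<in>X. card {f \<in> S. v \<in> ends G f}) = (\<Sum>v\<in>X. \<Sum>f\<in>S. of_bool (v \<in> ends G f))"
    unfolding card_filter_sum[OF fS] ..
  also have "\<dots> = (\<Sum>f\<in>S. \<Sum>v\<in>X. of_bool (v \<in> ends G f))"
    by (rule sum.swap)
  also have "\<dots> = (\<Sum>f\<in>S. 2 * of_bool (ends G f \<subseteq> X) + of_bool (f \<in> edge_cut G X))"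
  proof (rule sum.cong[OF refl])
    fix f assume f: "f \<in> S"
    then obtain u v where uv: "u \<noteq> v" "ends G f = {u, v}" "u \<in> verts G" "v \<in> verts G"
      using wf_ends[OF wf] S by (metis subsetD)
    have "(\<Sum>v\<in>X. of_bool (v \<in> ends G f)) = card (X \<inter> {u, v})"
      unfolding Int_def card_filter_sum[OF fX] uv(2) by simp
    also have "\<dots> = 2 * of_bool (ends G f \<subseteq> X) + of_bool (f \<in> edge_cut G X)"
      using uv f S by (cases "u \<in> X"; cases "v \<in> X") (auto simp: edge_cut_def)
    finally show "(\<Sum>v\<in>X. of_bool (v \<in> ends G f))
      = (2 * of_bool (ends G f \<subseteq> X) + of_bool (f \<in> edge_cut G X) :: nat)" .
  qed
  also have "\<dots> = 2 * card {f \<in> S. ends G f \<subseteq> X} + card (S \<inter> edge_cut G X)"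
    unfolding Int_def card_filter_sum[OF fS] by (simp add: sum.distrib sum_distrib_left)
  finally show ?thesis .
qed

lemma regular_sum:
  assumes "wf_mgraph G" "regular r G" "X \<subseteq> verts G"
  shows "r * card X = 2 * card {f \<in> edges G. ends G f \<subseteq> X} + card (edge_cut G X)"
proof -
  have "(\<Sum>v\<in>X. card {f \<in> edges G. v \<in> ends G f}) = (\<Sum>v\<in>X. r)"
    using assms by (intro sum.cong) (auto simp: regular_def degree_def)
  moreover have "edges G \<inter> edge_cut G X = edge_cut G X"
    by (rule Int_absorb1[OF edge_cut_subset])
  ultimately show ?thesis
    using sum_incident[OF assms(1,3), of "edges G"] by (simp add: mult.commute)
qed

text \<open>The matching condition is localised to a vertex set because on one side of a cut only
  the vertices of that side are known to be covered.\<close>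

definition covers_once :: "('v, 'e) mgraph \<Rightarrow> 'v set \<Rightarrow> 'e set \<Rightarrow> bool" where
  "covers_once G X M \<longleftrightarrow> (\<forall>v\<in>X. \<exists>!e. e \<in> M \<and> v \<in> ends G e)"

lemma perfect_matching_iff:
  "perfect_matching G M \<longleftrightarrow> M \<subseteq> edges G \<and> covers_once G (verts G) M"
  by (simp add: perfect_matching_def covers_once_def)

lemma covers_once_card:
  assumes "covers_once G X M" "v \<in> X"
  shows "card {f \<in> M. v \<in> ends G f} = 1"
proof -
  have "\<exists>!e. e \<in> M \<and> v \<in> ends G e"
    using assms by (simp add: covers_once_def)
  then obtain e where "e \<in> M \<and> v \<in> ends G e" "\<forall>f. f \<in> M \<and> v \<in> ends G f \<longrightarrow> f = e"
    by (rule ex1E)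
  then have "{f \<in> M. v \<in> ends G f} = {e}" by blast
  then show ?thesis by simp
qed

lemma covers_once_sum:
  assumes "wf_mgraph G" "M \<subseteq> edges G" "covers_once G X M" "X \<subseteq> verts G"
  shows "card X = 2 * card {f \<in> M. ends G f \<subseteq> X} + card (M \<inter> edge_cut G X)"
proof -
  have "(\<Sum>v\<in>X. card {f \<in> M. v \<in> ends G f}) = card X"
    using covers_once_card[OF assms(3)] by simp
  then show ?thesis using sum_incident[OF assms(1,4,2)] by simp
qed

lemma covers_once_subset: "covers_once G X M \<Longrightarrow> Y \<subseteq> X \<Longrightarrow> covers_once G Y M"
  by (auto simp: covers_once_def)

lemma cut_parity:
  assumes "wf_mgraph G" "regular r G" "odd r" "X \<subseteq> verts G"
  shows "even (card (edge_cut G X)) = even (card X)"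
proof -
  have "even (r * card X) = even (card (edge_cut G X))"
    unfolding regular_sum[OF assms(1,2,4)] by simp
  then show ?thesis using assms(3) by simp
qed

text \<open>Together with \<open>cut_parity\<close>, this shows that in a regular graph of odd
  degree a cut and its part in a perfect matching have sizes of the same parity.\<close>

lemma matching_cut_parity:
  assumes "wf_mgraph G" "M \<subseteq> edges G" "covers_once G X M" "X \<subseteq> verts G"
  shows "even (card (M \<inter> edge_cut G X)) = even (card X)"
  unfolding covers_once_sum[OF assms] by simp

section \<open>Edge counts between the quadrants of two crossing sets\<close>

definition between :: "('v, 'e) mgraph \<Rightarrow> 'e set \<Rightarrow> 'v set \<Rightarrow> 'v set \<Rightarrow> nat" where
  "between G S P Q = card {f \<in> S. ends G f \<inter> P \<noteq> {} \<and> ends G f \<inter> Q \<noteq> {}}"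

lemma between_mono: "finite T \<Longrightarrow> S \<subseteq> T \<Longrightarrow> between G S P Q \<le> between G T P Q"
  unfolding between_def by (rule card_mono) auto

text \<open>Each edge joins two quadrants or stays inside one, so every cut is the sum over the
  pairs of quadrants that it separates. The edge set \<open>S\<close> is a parameter so that the
  same identities serve the whole graph and a matching.\<close>

lemma quadrants:
  assumes wf: "wf_mgraph G" and S: "S \<subseteq> edges G"
    and V: "verts G = A \<union> B \<union> C \<union> D"
    and disj: "A \<inter> B = {}" "A \<inter> C = {}" "A \<inter> D = {}" "B \<inter> C = {}" "B \<inter> D = {}" "C \<inter> D = {}"
  shows "card (S \<inter> edge_cut G A) = between G S A B + between G S A C + between G S A D" (is ?A)
    and "card (S \<inter> edge_cut G B) = between G S A B + between G S B C + between G S B D" (is ?B)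
    and "card (S \<inter> edge_cut G C) = between G S A C + between G S B C + between G S C D" (is ?C)
    and "card (S \<inter> edge_cut G D) = between G S A D + between G S B D + between G S C D" (is ?D)
    and "card (S \<inter> edge_cut G (A \<union> B)) =
      between G S A C + between G S A D + between G S B C + between G S B D" (is ?AB)
    and "card (S \<inter> edge_cut G (A \<union> C)) =
      between G S A B + between G S A D + between G S B C + between G S C D" (is ?AC)
proof -
  have fS: "finite S" using wf_finite[OF wf] S finite_subset by auto
  have cut: "card (S \<inter> edge_cut G Z) = (\<Sum>f\<in>S. of_bool (f \<in> edge_cut G Z))" for Z
    unfolding Int_def card_filter_sum[OF fS] ..
  have btw: "between G S P Q = (\<Sum>f\<in>S. of_bool (ends G f \<inter> P \<noteq> {} \<and> ends G f \<inter> Q \<noteq> {}))" for P Q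
    unfolding between_def card_filter_sum[OF fS] ..
  \<comment> \<open>Written as an exclusive alternative, so that the location of both ends is
    settled by sixteen cases, in each of which the identities are numerical.\<close>
  define in_one where "in_one x \<longleftrightarrow>
    x \<in> A \<and> x \<notin> B \<and> x \<notin> C \<and> x \<notin> D \<or> x \<in> B \<and> x \<notin> A \<and> x \<notin> C \<and> x \<notin> D \<or>
    x \<in> C \<and> x \<notin> A \<and> x \<notin> B \<and> x \<notin> D \<or> x \<in> D \<and> x \<notin> A \<and> x \<notin> B \<and> x \<notin> C" for x
  have in_one: "in_one x" if "x \<in> verts G" for x
    using that disj V by (auto simp: in_one_def)
  have ends: thesis
    if f: "f \<in> S"
      and *: "\<And>u v. \<lbrakk>\<And>Z. f \<in> edge_cut G Z \<longleftrightarrow> (u \<in> Z) \<noteq> (v \<in> Z);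
        \<And>P Q. ends G f \<inter> P \<noteq> {} \<and> ends G f \<inter> Q \<noteq> {} \<longleftrightarrow> (u \<in> P \<or> v \<in> P) \<and> (u \<in> Q \<or> v \<in> Q);
        in_one u; in_one v\<rbrakk> \<Longrightarrow> thesis" for f thesis
  proof -
    have fE: "f \<in> edges G" using f S by auto
    then obtain u v where uv: "u \<noteq> v" "ends G f = {u, v}" "u \<in> verts G" "v \<in> verts G"
      by (rule wf_ends[OF wf])
    show thesis
    proof (rule *[of u v])
      show "f \<in> edge_cut G Z \<longleftrightarrow> (u \<in> Z) \<noteq> (v \<in> Z)" for Z
        using uv fE by (auto simp: edge_cut_def)
    qed (use uv in_one in auto)
  qed
  note eqs = cut btw sum.distrib[symmetric]
  show ?A ?B ?C ?D ?AB ?AC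
    unfolding eqs
    by - (rule sum.cong[OF refl], erule ends, unfold in_one_def, elim disjE; simp)+
qed

section \<open>Two disjoint perfect matchings of 5-edge-connected 5-graphs\<close>

text \<open>\<open>m\<close> quantifies over graphs whose vertices and edges are natural numbers;
  relabelling transports its property to the product types that the constructions produce.\<close>

definition relabel :: "('v \<Rightarrow> 'w) \<Rightarrow> ('e \<Rightarrow> 'f) \<Rightarrow> ('v, 'e) mgraph \<Rightarrow> ('w, 'f) mgraph" where
  "relabel \<phi> \<psi> G = \<lparr>verts = \<phi> ` verts G, edges = \<psi> ` edges G,
     ends = (\<lambda>k. \<phi> ` ends G (inv_into (edges G) \<psi> k))\<rparr>"

lemma relabel_sel [simp]:
  "verts (relabel \<phi> \<psi> G) = \<phi> ` verts G" "edges (relabel \<phi> \<psi> G) = \<psi> ` edges G"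
  by (simp_all add: relabel_def)

context
  fixes G :: "('v, 'e) mgraph" and \<phi> :: "'v \<Rightarrow> 'w" and \<psi> :: "'e \<Rightarrow> 'f"
  assumes wf: "wf_mgraph G" and inj_v: "inj_on \<phi> (verts G)" and inj_e: "inj_on \<psi> (edges G)"
begin

lemma relabel_ends: "f \<in> edges G \<Longrightarrow> ends (relabel \<phi> \<psi> G) (\<psi> f) = \<phi> ` ends G f"
  using inj_e by (simp add: relabel_def)

lemma relabel_in_ends:
  assumes "f \<in> edges G" "v \<in> verts G"
  shows "\<phi> v \<in> \<phi> ` ends G f \<longleftrightarrow> v \<in> ends G f"
proof -
  have "ends G f \<subseteq> verts G" using wf assms by (auto simp: wf_mgraph_def)
  then show ?thesis using inj_v assms by (auto dest: inj_onD)
qed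

lemma wf_relabel: "wf_mgraph (relabel \<phi> \<psi> G)"
proof -
  have "card (\<phi> ` ends G f) = 2" if "f \<in> edges G" for f
  proof -
    have "ends G f \<subseteq> verts G" "card (ends G f) = 2"
      using wf that by (auto simp: wf_mgraph_def)
    then show ?thesis using card_image inj_on_subset[OF inj_v] by metis
  qed
  then show ?thesis
    using wf inj_e by (auto simp: wf_mgraph_def relabel_def)
qed

lemma degree_relabel:
  assumes v: "v \<in> verts G"
  shows "degree (relabel \<phi> \<psi> G) (\<phi> v) = degree G v"
proof -
  have "{k \<in> edges (relabel \<phi> \<psi> G). \<phi> v \<in> ends (relabel \<phi> \<psi> G) k}
      = \<psi> ` {f \<in> edges G. v \<in> ends G f}"
    using relabel_ends relabel_in_ends[OF _ v] by auto
  moreover have "inj_on \<psi> {f \<in> edges G. v \<in> ends G f}"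
    by (rule inj_on_subset[OF inj_e]) auto
  ultimately show ?thesis by (simp add: degree_def card_image)
qed

lemma card_cut_relabel:
  assumes X: "X \<subseteq> verts G"
  shows "card (edge_cut (relabel \<phi> \<psi> G) (\<phi> ` X)) = card (edge_cut G X)"
proof -
  let ?R = "relabel \<phi> \<psi> G"
  have touch: "ends ?R (\<psi> f) \<inter> \<phi> ` Y \<noteq> {} \<longleftrightarrow> ends G f \<inter> Y \<noteq> {}"
    if "f \<in> edges G" "Y \<subseteq> verts G" for f Y
    using relabel_ends[OF that(1)] relabel_in_ends[OF that(1)] that(2) by blast
  have compl: "\<phi> ` verts G - \<phi> ` X = \<phi> ` (verts G - X)"
    using inj_on_image_set_diff[OF inj_v, of "verts G" X] X by auto
  have image_filter: "{k \<in> \<psi> ` A. Q k} = \<psi> ` {f \<in> A. Q (\<psi> f)}" for A Q by auto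
  have "edge_cut ?R (\<phi> ` X) = \<psi> ` {f \<in> edges G. ends ?R (\<psi> f) \<inter> \<phi> ` X \<noteq> {} \<and>
      ends ?R (\<psi> f) \<inter> \<phi> ` (verts G - X) \<noteq> {}}"
    unfolding edge_cut_def relabel_sel compl by (rule image_filter)
  also have "{f \<in> edges G. ends ?R (\<psi> f) \<inter> \<phi> ` X \<noteq> {} \<and>
      ends ?R (\<psi> f) \<inter> \<phi> ` (verts G - X) \<noteq> {}} = edge_cut G X"
    unfolding edge_cut_def using touch[OF _ X] touch[of _ "verts G - X"] by auto
  finally have "edge_cut ?R (\<phi> ` X) = \<psi> ` edge_cut G X" .
  moreover have "inj_on \<psi> (edge_cut G X)"
    by (rule inj_on_subset[OF inj_e edge_cut_subset])
  ultimately show ?thesis by (simp add: card_image)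
qed

lemma perfect_matching_relabel:
  assumes N: "perfect_matching (relabel \<phi> \<psi> G) N"
  shows "perfect_matching G {f \<in> edges G. \<psi> f \<in> N}"
  unfolding perfect_matching_def
proof (intro conjI ballI)
  fix v assume v: "v \<in> verts G"
  then have "\<phi> v \<in> verts (relabel \<phi> \<psi> G)" by (simp add: relabel_def)
  then obtain k where k: "k \<in> N" "\<phi> v \<in> ends (relabel \<phi> \<psi> G) k"
    and uniq: "\<And>k'. k' \<in> N \<Longrightarrow> \<phi> v \<in> ends (relabel \<phi> \<psi> G) k' \<Longrightarrow> k' = k"
    using N unfolding perfect_matching_def Ex1_def by blast
  have "k \<in> \<psi> ` edges G" using k N by (auto simp: perfect_matching_def relabel_def)
  then obtain f where f: "f \<in> edges G" "k = \<psi> f" by blast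
  show "\<exists>!e. e \<in> {f \<in> edges G. \<psi> f \<in> N} \<and> v \<in> ends G e"
  proof (rule ex1I[of _ f])
    show "f \<in> {f \<in> edges G. \<psi> f \<in> N} \<and> v \<in> ends G f"
      using f k relabel_ends relabel_in_ends v by auto
  next
    fix g assume g: "g \<in> {f \<in> edges G. \<psi> f \<in> N} \<and> v \<in> ends G g"
    then have "\<psi> g = k" using uniq relabel_ends by auto
    then show "g = f" using f g inj_e by (auto dest: inj_onD)
  qed
qed auto

end

text \<open>\<open>GREATEST\<close> is meaningful only for a bounded property. Boundedness comes
  from one concrete 5-graph; then \<open>m 5\<close> itself has the property, and dropping members
  of the family leaves two disjoint matchings.\<close>

lemma two_disjoint_pms:
  fixes G :: "('v, 'e) mgraph"
  assumes m5: "m 5 \<ge> 2" and G: "r_graph 5 G" "edge_connected 5 G"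
  obtains M N where "perfect_matching G M" "perfect_matching G N" "M \<inter> N = {}"
proof -
  define P where "P t \<longleftrightarrow> (\<forall>G :: (nat, nat) mgraph.
     r_graph 5 G \<and> edge_connected 5 G \<longrightarrow> has_disjoint_pms G t)" for t
  \<comment> \<open>Two vertices joined by five parallel edges: disjoint perfect matchings are
    non-empty disjoint subsets of the five edges, so \<open>t \<le> 5\<close>.\<close>
  define D :: "(nat, nat) mgraph" where "D = \<lparr>verts = {0, 1}, edges = {..<5}, ends = (\<lambda>_. {0, 1})\<rparr>"
  have cutD: "edge_cut D X = {..<5}" if "X \<noteq> {}" "X \<subset> {0, 1}" for X
  proof -
    have "X = {0} \<or> X = {1}" using that by auto
    then show ?thesis by (auto simp: edge_cut_def D_def)
  qed
  have oddX: "X \<noteq> {} \<and> X \<subset> {0, 1}" if "X \<subseteq> {0, 1}" "odd (card X)" for X :: "nat set"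
  proof -
    have "card {0, 1 :: nat} = 2" by simp
    then show ?thesis using that by (metis card.empty even_numeral even_zero psubsetI)
  qed
  have "r_graph 5 D" "edge_connected 5 D"
  proof -
    have "wf_mgraph D" "regular 5 D"
      by (auto simp: wf_mgraph_def regular_def degree_def D_def)
    then show "r_graph 5 D"
      using cutD oddX by (auto simp: r_graph_def D_def)
    show "edge_connected 5 D" using cutD by (auto simp: edge_connected_def D_def)
  qed
  then have bound: "t \<le> 5" if Pt: "P t" for t
  proof -
    obtain F where F: "\<And>j. j < t \<Longrightarrow> perfect_matching D (F j)"
      "\<And>j k. j < t \<Longrightarrow> k < t \<Longrightarrow> j \<noteq> k \<Longrightarrow> F j \<inter> F k = {}"
      using Pt \<open>r_graph 5 D\<close> \<open>edge_connected 5 D\<close>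
      unfolding P_def has_disjoint_pms_def by meson
    have sub: "F j \<subseteq> {..<5} \<and> F j \<noteq> {}" if "j < t" for j
    proof -
      have "0 \<in> verts D" by (simp add: D_def)
      then have ex: "\<exists>e. e \<in> F j" and sub: "F j \<subseteq> edges D"
        using F(1)[OF that] unfolding perfect_matching_def by blast+
      have "edges D = {..<5}" by (simp add: D_def)
      then show ?thesis using ex sub by blast
    qed
    have "t = (\<Sum>j<t. 1)" by simp
    also have "\<dots> \<le> (\<Sum>j<t. card (F j))"
    proof (rule sum_mono)
      fix j assume "j \<in> {..<t}"
      then have "F j \<noteq> {}" "finite (F j)" using sub finite_subset[of "F j" "{..<5}"] by auto
      then show "1 \<le> card (F j)" by (simp add: Suc_le_eq card_gt_0_iff)
    qed
    also have "\<dots> = card (\<Union>j<t. F j)"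
      using F(2) sub finite_subset[of _ "{..<5::nat}"] by (intro card_UN_disjoint[symmetric]) auto
    also have "\<dots> \<le> card {..<5::nat}" using sub by (intro card_mono) auto
    finally show ?thesis by simp
  qed
  have "P 0" by (simp add: P_def has_disjoint_pms_def)
  then have "P (Greatest P)" using bound GreatestI_nat[of P 0 5] by blast
  moreover have "Greatest P = m 5" unfolding m_def P_def by simp
  ultimately have "P (m 5)" by simp
  have P2: "P 2"
    unfolding P_def has_disjoint_pms_def
  proof (intro allI impI)
    fix H :: "(nat, nat) mgraph" assume "r_graph 5 H \<and> edge_connected 5 H"
    then obtain F where "\<forall>j<m 5. perfect_matching H (F j)"
      "\<forall>j<m 5. \<forall>k<m 5. j \<noteq> k \<longrightarrow> F j \<inter> F k = {}"
      using \<open>P (m 5)\<close> unfolding P_def has_disjoint_pms_def by blast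
    then show "\<exists>F. (\<forall>j<2::nat. perfect_matching H (F j)) \<and> (\<forall>j<2. \<forall>k<2. j \<noteq> k \<longrightarrow> F j \<inter> F k = {})"
      using m5 by (intro exI[of _ F]) auto
  qed
  have wf: "wf_mgraph G" and reg: "regular 5 G" using G by (auto simp: r_graph_def)
  obtain \<phi> :: "'v \<Rightarrow> nat" where \<phi>: "inj_on \<phi> (verts G)"
    using wf_finite(1)[OF wf] finite_imp_inj_to_nat_seg by blast
  obtain \<psi> :: "'e \<Rightarrow> nat" where \<psi>: "inj_on \<psi> (edges G)"
    using wf_finite(2)[OF wf] finite_imp_inj_to_nat_seg by blast
  let ?H = "relabel \<phi> \<psi> G"
  have sets: "\<exists>Y. Y \<subseteq> verts G \<and> X = \<phi> ` Y \<and> card X = card Y" if X: "X \<subseteq> verts ?H" for X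
  proof -
    have "X \<subseteq> \<phi> ` verts G" using X by (simp add: relabel_def)
    then obtain Y where "Y \<subseteq> verts G" "X = \<phi> ` Y" by (metis subset_imageE)
    then show ?thesis using card_image inj_on_subset[OF \<phi>] by metis
  qed
  have conn: "edge_connected 5 ?H"
    unfolding edge_connected_def
  proof (intro allI impI, elim conjE)
    fix X assume X: "X \<noteq> {}" "X \<subset> verts ?H"
    obtain Y where Y: "Y \<subseteq> verts G" "X = \<phi> ` Y"
      using sets[OF psubset_imp_subset[OF X(2)]] by (elim exE conjE)
    have "Y \<noteq> {}" "Y \<noteq> verts G" using X Y by auto
    then have "Y \<noteq> {}" "Y \<subset> verts G" using Y by auto
    then show "5 \<le> card (edge_cut ?H X)"
      using G(2) card_cut_relabel[OF wf \<phi> \<psi> Y(1)] Y(2) by (simp add: edge_connected_def)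
  qed
  have "r_graph 5 ?H"
    unfolding r_graph_def
  proof (intro conjI allI impI)
    show "wf_mgraph ?H" by (rule wf_relabel[OF wf \<phi> \<psi>])
    show "regular 5 ?H"
      using reg degree_relabel[OF wf \<phi> \<psi>] by (auto simp: regular_def relabel_def)
    fix X assume X: "X \<subseteq> verts ?H \<and> odd (card X)"
    obtain Y where Y: "Y \<subseteq> verts G" "X = \<phi> ` Y" "card X = card Y"
      using sets[OF conjunct1[OF X]] by (elim exE conjE)
    then show "5 \<le> card (edge_cut ?H X)"
      using G(1) X card_cut_relabel[OF wf \<phi> \<psi> Y(1)] Y unfolding r_graph_def by simp
  qed
  with conn have "has_disjoint_pms ?H 2" using P2 unfolding P_def by blast
  then obtain F where F: "\<forall>j<2. perfect_matching ?H (F j)"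
    "\<forall>j<2::nat. \<forall>k<2. j \<noteq> k \<longrightarrow> F j \<inter> F k = {}"
    unfolding has_disjoint_pms_def by blast
  have pm: "perfect_matching ?H (F 0)" "perfect_matching ?H (F 1)" using F(1) by auto
  have dis: "F 0 \<inter> F 1 = {}" using F(2) by simp
  show thesis
    by (rule that[OF perfect_matching_relabel[OF wf \<phi> \<psi> pm(1)]
          perfect_matching_relabel[OF wf \<phi> \<psi> pm(2)]])
      (use dis in auto)
qed

text \<open>For odd \<open>r\<close> the order is even, since the whole vertex set has an empty cut.
  An odd set is therefore non-empty and proper, and edge-connectivity applies to it.\<close>

lemma edge_connected_r_graph:
  assumes "wf_mgraph G" "regular r G" "odd r" "edge_connected r G"
  shows "r_graph r G"
  unfolding r_graph_def
proof (intro conjI allI impI assms(1,2))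
  fix X assume X: "X \<subseteq> verts G \<and> odd (card X)"
  have "edge_cut G (verts G) = {}" by (auto simp: edge_cut_def)
  then have "even (card (verts G))"
    using cut_parity[OF assms(1,2,3), of "verts G"] by simp
  then have "X \<noteq> {}" "X \<subset> verts G" using X by auto
  then show "r \<le> card (edge_cut G X)" using assms(4) by (simp add: edge_connected_def)
qed

section \<open>Prescribing and avoiding edges by gluing copies\<close>

text \<open>In terms of the four quadrants, the slack is twice the number of edges between
  \<open>X - Z\<close> and \<open>Z - X\<close> in the first inequality, and twice the number
  between \<open>X \<inter> Z\<close> and the outside of both sets in the second.\<close>

lemma cut_submodular:
  assumes wf: "wf_mgraph G" and S: "S \<subseteq> edges G" and X: "X \<subseteq> verts G" and Z: "Z \<subseteq> verts G"
  shows "card (S \<inter> edge_cut G (X \<inter> Z)) + card (S \<inter> edge_cut G (X \<union> Z))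
      \<le> card (S \<inter> edge_cut G X) + card (S \<inter> edge_cut G Z)" (is ?union)
    and "card (S \<inter> edge_cut G (X - Z)) + card (S \<inter> edge_cut G (Z - X))
      \<le> card (S \<inter> edge_cut G X) + card (S \<inter> edge_cut G Z)" (is ?diff)
proof -
  let ?A = "X \<inter> Z" and ?B = "X - Z" and ?C = "Z - X" and ?D = "verts G - (X \<union> Z)"
  have V: "verts G = ?A \<union> ?B \<union> ?C \<union> ?D" using X Z by auto
  have eqs: "?A \<union> ?B = X" "?A \<union> ?C = Z" by auto
  have D: "edge_cut G ?D = edge_cut G (X \<union> Z)"
    using X Z by (intro edge_cut_compl) auto
  have "?A \<inter> ?B = {}" "?A \<inter> ?C = {}" "?A \<inter> ?D = {}" "?B \<inter> ?C = {}" "?B \<inter> ?D = {}" "?C \<inter> ?D = {}"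
    by auto
  note q = quadrants[OF wf S V this, unfolded eqs D]
  show ?union ?diff
    using q by linarith+
qed

text \<open>Non-empty parts of \<open>X\<close> have cuts of at least \<open>r\<close> edges and
  \<open>X\<close> itself has at most \<open>r\<close>, so by submodularity replacing
  \<open>Z\<close> by \<open>X \<union> Z\<close> does not increase its cut. If that union is the
  whole vertex set, the second inequality gives \<open>Z - X\<close> instead.\<close>

lemma uncross:
  assumes wf: "wf_mgraph G" and X: "X \<subset> verts G" and tight: "card (edge_cut G X) \<le> r"
    and inner: "\<And>A. A \<subseteq> X \<Longrightarrow> A \<noteq> {} \<Longrightarrow> r \<le> card (edge_cut G A)"
    and Z: "Z \<noteq> {}" "Z \<subset> verts G"
  obtains Z' where "Z' \<noteq> {}" "Z' \<subset> verts G" "card (edge_cut G Z') \<le> card (edge_cut G Z)"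
    "Z' = X \<union> Z \<or> Z' = Z - X"
proof -
  have E: "edges G \<inter> edge_cut G Y = edge_cut G Y" for Y
    by (rule Int_absorb1[OF edge_cut_subset])
  note sub = cut_submodular[OF wf subset_refl psubset_imp_subset[OF X] psubset_imp_subset[OF Z(2)], unfolded E]
  show thesis
  proof (cases "X \<inter> Z = {} \<or> X \<subseteq> Z")
    case True
    then have "Z = X \<union> Z \<or> Z = Z - X" by auto
    then show thesis using that[of Z] Z by auto
  next
    case False
    show thesis
    proof (cases "X \<union> Z = verts G")
      case True
      have "r \<le> card (edge_cut G (X - Z))" using inner False by auto
      then have "card (edge_cut G (Z - X)) \<le> card (edge_cut G Z)" using sub(2) tight by linarith
      moreover have "Z - X \<noteq> {}" "Z - X \<subset> verts G" using True Z X by auto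
      ultimately show thesis using that[of "Z - X"] by blast
    next
      case F2: False
      have "r \<le> card (edge_cut G (X \<inter> Z))" using inner False by auto
      then have "card (edge_cut G (X \<union> Z)) \<le> card (edge_cut G Z)" using sub(1) tight by linarith
      then show thesis using that[of "X \<union> Z"] F2 Z X by auto
    qed
  qed
qed


text \<open>Five copies of \<open>H\<close> with the vertex \<open>v0\<close> removed; the edge at \<open>v0\<close> with label \<open>j\<close> of every
  copy is attached to the new vertex \<open>(j, v0)\<close>.\<close>

definition fivefold :: "('v, 'e) mgraph \<Rightarrow> 'v \<Rightarrow> ('e \<Rightarrow> nat) \<Rightarrow> (nat \<times> 'v, nat \<times> 'e) mgraph" where
  "fivefold H v0 lab = \<lparr>verts = {..<5} \<times> verts H, edges = {..<5} \<times> edges H,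
     ends = (\<lambda>(i, f). (\<lambda>w. (if w = v0 then lab f else i, w)) ` ends H f)\<rparr>"

text \<open>In \<open>K\<close>, a pair \<open>(i, w)\<close> with \<open>w \<noteq> v0\<close> is a
  vertex of copy \<open>i\<close>, whereas \<open>(j, v0)\<close> is the hub that receives the edge
  labelled \<open>j\<close> from every copy. As the labelling is bijective, contracting the copies
  gives a complete bipartite graph between five copies and five hubs.\<close>

locale fivefold_gluing =
  fixes H :: "('v, 'e) mgraph" and v0 :: 'v and lab :: "'e \<Rightarrow> nat"
  assumes wf: "wf_mgraph H" and reg: "regular 5 H" and conn: "edge_connected 5 H"
    and v0: "v0 \<in> verts H" and lab: "bij_betw lab {f \<in> edges H. v0 \<in> ends H f} {..<5}"
begin

abbreviation "K \<equiv> fivefold H v0 lab"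
abbreviation "R \<equiv> verts H - {v0}"
abbreviation "star \<equiv> {f \<in> edges H. v0 \<in> ends H f}"

lemma K_sel [simp]: "verts K = {..<5} \<times> verts H" "edges K = {..<5} \<times> edges H"
  by (simp_all add: fivefold_def)

lemma K_ends: "ends K (i, f) = (\<lambda>w. (if w = v0 then lab f else i, w)) ` ends H f"
  by (simp add: fivefold_def)

lemma copy_vertex_iff: "w \<noteq> v0 \<Longrightarrow> (j, w) \<in> ends K (i, f) \<longleftrightarrow> j = i \<and> w \<in> ends H f"
  by (auto simp: K_ends image_iff)

lemma hub_vertex_iff: "(j, v0) \<in> ends K (i, f) \<longleftrightarrow> j = lab f \<and> v0 \<in> ends H f"
  by (auto simp: K_ends image_iff)

lemma lab_less: "f \<in> star \<Longrightarrow> lab f < 5"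
  using lab by (auto dest: bij_betwE)

lemma lab_surj: "j < 5 \<Longrightarrow> j \<in> lab ` star"
  using bij_betw_imp_surj_on[OF lab] by simp

lemma lab_inj: "f \<in> star \<Longrightarrow> g \<in> star \<Longrightarrow> lab f = lab g \<Longrightarrow> f = g"
  using bij_betw_imp_inj_on[OF lab] by (rule inj_onD)

lemma card_star: "card star = 5"
  using bij_betw_same_card[OF lab] by simp

lemma wf_K: "wf_mgraph K"
proof -
  have ends: "ends H f \<subseteq> verts H" "card (ends H f) = 2" if "f \<in> edges H" for f
    using wf that by (auto simp: wf_mgraph_def)
  have "card (ends K (i, f)) = 2" if "f \<in> edges H" for i f
    unfolding K_ends by (subst card_image) (auto intro: inj_onI simp: ends[OF that])
  moreover have "ends K (i, f) \<subseteq> verts K" if "i < 5" "f \<in> edges H" for i f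
    using ends[OF that(2)] that lab_less by (auto simp: K_ends)
  moreover have "(0, v0) \<in> verts K" using v0 by simp
  then have "verts K \<noteq> {}" by blast
  moreover have "finite (verts K)" "finite (edges K)" using wf_finite[OF wf] by simp_all
  ultimately show ?thesis unfolding wf_mgraph_def by auto
qed

text \<open>A hub \<open>j\<close> meets exactly one edge of each copy, the one labelled
  \<open>j\<close>; all other vertices keep their edges.\<close>

lemma regular_K: "regular 5 K"
  unfolding regular_def
proof
  fix x assume "x \<in> verts K"
  then obtain j w where x: "x = (j, w)" "j < 5" "w \<in> verts H" by auto
  show "degree K x = 5"
  proof (cases "w = v0")
    case True
    obtain g where "j = lab g" "g \<in> star"
      by (rule imageE[OF lab_surj[OF x(2)]])
    then have g: "g \<in> star" "lab g = j" by simp_all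
    have "{e \<in> edges K. x \<in> ends K e} = {..<5} \<times> {g}"
    proof (rule set_eqI)
      fix e :: "nat \<times> 'e"
      obtain i f where e: "e = (i, f)" by (cases e)
      have "f \<in> star \<and> j = lab f \<longleftrightarrow> f = g"
        using g lab_inj[of f g] by metis
      then show "e \<in> {e \<in> edges K. x \<in> ends K e} \<longleftrightarrow> e \<in> {..<5} \<times> {g}"
        unfolding e x True by (auto simp: hub_vertex_iff)
    qed
    then show ?thesis by (simp add: degree_def card_cartesian_product)
  next
    case False
    have "{e \<in> edges K. x \<in> ends K e} = {j} \<times> {f \<in> edges H. w \<in> ends H f}"
      using x False by (auto simp: copy_vertex_iff)
    then show ?thesis
      using reg x(3) by (simp add: degree_def regular_def card_cartesian_product)
  qed
qed

text \<open>Only the end of an edge at \<open>v0\<close> is moved, and it is moved to a hub. A set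
  inside a copy contains neither \<open>v0\<close> nor a hub, so its boundary is unaffected.\<close>

lemma cut_copy:
  assumes A: "A \<subseteq> R" and i: "i < 5"
  shows "edge_cut K ({i} \<times> A) = {i} \<times> edge_cut H A"
proof (rule set_eqI)
  fix e :: "nat \<times> 'e"
  obtain j f where e: "e = (j, f)" by (cases e)
  show "e \<in> edge_cut K ({i} \<times> A) \<longleftrightarrow> e \<in> {i} \<times> edge_cut H A"
  proof (cases "f \<in> edges H \<and> j < 5")
    case True
    obtain u v where uv: "u \<noteq> v" "ends H f = {u, v}" "u \<in> verts H" "v \<in> verts H"
      using wf_ends[OF wf] True by blast
    have "v0 \<notin> A" using A by auto
    moreover have "v0 \<in> ends H f \<Longrightarrow> lab f < 5" using lab_less True by auto
    ultimately show ?thesis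
      using True uv i by (auto simp: edge_cut_def e K_ends)
  next
    case False
    then show ?thesis using i by (auto simp: edge_cut_def e)
  qed
qed

lemma cut_R: "edge_cut H R = star"
proof -
  have "edge_cut H R = edge_cut H {v0}" using edge_cut_compl[of "{v0}" H] v0 by simp
  also have "\<dots> = star"
  proof (rule set_eqI)
    fix f
    show "f \<in> edge_cut H {v0} \<longleftrightarrow> f \<in> star"
    proof (cases "f \<in> edges H")
      case True
      then obtain u v where "u \<noteq> v" "ends H f = {u, v}" "u \<in> verts H" "v \<in> verts H"
        using wf_ends[OF wf] by blast
      then show ?thesis using True by (auto simp: edge_cut_def)
    qed (simp add: edge_cut_def)
  qed
  finally show ?thesis .
qed

lemma R_nonempty: "R \<noteq> {}"
proof
  assume "R = {}"
  then have "edge_cut H R = edge_cut H {}" by (rule arg_cong)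
  moreover have "edge_cut H {} = {}" by (simp add: edge_cut_def)
  ultimately have "star = {}" unfolding cut_R by simp
  then have "card star = 0" by (simp only: card.empty)
  then show False using card_star by simp
qed

text \<open>The copies are uncrossed one after the other: the cut of a whole copy is the star of
  \<open>v0\<close> with five edges, and smaller parts have at least five by the connectivity of
  \<open>H\<close>. As the copies are disjoint, those already aligned stay aligned.\<close>

lemma align_copies:
  assumes Z: "Z \<noteq> {}" "Z \<subset> verts K" and n: "n \<le> 5"
  shows "\<exists>Z'. Z' \<noteq> {} \<and> Z' \<subset> verts K \<and> card (edge_cut K Z') \<le> card (edge_cut K Z) \<and>
    (\<forall>i<n. {i} \<times> R \<subseteq> Z' \<or> {i} \<times> R \<inter> Z' = {})"
  using n
proof (induction n)
  case 0
  show ?case by (rule exI[of _ Z]) (use Z in simp)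
next
  case (Suc n)
  obtain Y where Y: "Y \<noteq> {}" "Y \<subset> verts K" "card (edge_cut K Y) \<le> card (edge_cut K Z)"
    "\<forall>i<n. {i} \<times> R \<subseteq> Y \<or> {i} \<times> R \<inter> Y = {}"
    using Suc.IH[OF Suc_leD[OF Suc.prems]] by (elim exE conjE)
  have n5: "n < 5" using Suc by simp
  have sub: "{n} \<times> R \<subset> verts K" using v0 n5 by auto
  have tight: "card (edge_cut K ({n} \<times> R)) \<le> 5"
    using cut_copy[OF subset_refl n5] cut_R card_star by (simp add: card_cartesian_product)
  have inner: "5 \<le> card (edge_cut K B)" if B: "B \<subseteq> {n} \<times> R" "B \<noteq> {}" for B
  proof -
    define A where "A = snd ` B"
    have BA: "B = {n} \<times> A" "A \<subseteq> R" using B by (force simp: A_def)+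
    have "A \<noteq> {}" "A \<subset> verts H" using B BA v0 by auto
    then have "5 \<le> card (edge_cut H A)" using conn by (simp add: edge_connected_def)
    then show ?thesis
      unfolding BA(1) cut_copy[OF BA(2) n5] by (simp add: card_cartesian_product)
  qed
  obtain Y' where Y': "Y' \<noteq> {}" "Y' \<subset> verts K" "card (edge_cut K Y') \<le> card (edge_cut K Y)"
    "Y' = {n} \<times> R \<union> Y \<or> Y' = Y - {n} \<times> R"
    by (rule uncross[OF wf_K sub tight inner Y(1,2)])
  have "{i} \<times> R \<subseteq> Y' \<or> {i} \<times> R \<inter> Y' = {}" if "i < Suc n" for i
  proof (cases "i = n")
    case True
    then show ?thesis using Y'(4) by blast
  next
    case False
    then have disj: "{i} \<times> R \<inter> {n} \<times> R = {}" and "i < n" using that by auto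
    then have "{i} \<times> R \<subseteq> Y \<or> {i} \<times> R \<inter> Y = {}" using Y(4) by blast
    then show ?thesis using Y'(4) disj by blast
  qed
  then show ?case using Y(3) Y' by (intro exI[of _ Y'] conjI) simp_all
qed

lemma conn_K: "edge_connected 5 K"
  unfolding edge_connected_def
proof (intro allI impI, elim conjE)
  fix Z0 assume Z0: "Z0 \<noteq> {}" "Z0 \<subset> verts K"
  obtain Z where Z: "Z \<noteq> {}" "Z \<subset> verts K" "card (edge_cut K Z) \<le> card (edge_cut K Z0)"
    and split: "\<And>i. i < 5 \<Longrightarrow> {i} \<times> R \<subseteq> Z \<or> {i} \<times> R \<inter> Z = {}"
    using align_copies[OF Z0 le_refl] by blast
  define I where "I = {i. i < 5 \<and> {i} \<times> R \<subseteq> Z}"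
  define J where "J = {j. j < 5 \<and> (j, v0) \<in> Z}"
  obtain w0 where w0: "w0 \<in> R" using R_nonempty by blast
  have inI: "(i, w) \<in> Z \<longleftrightarrow> i \<in> I" if "i < 5" "w \<in> R" for i w
  proof -
    have "(i, w) \<in> {i} \<times> R" using that by simp
    then show ?thesis using split[OF that(1)] that(1) unfolding I_def by blast
  qed
  have IJ: "I \<subseteq> {..<5}" "J \<subseteq> {..<5}" by (auto simp: I_def J_def)
  then have fin: "finite I" "finite J" using finite_subset by auto
  have Zmem: "(i, w) \<in> Z \<longleftrightarrow> (if w = v0 then i \<in> J else i \<in> I)" if "i < 5" "w \<in> verts H" for i w
    using that inI by (auto simp: J_def)
  define g where "g = inv_into star lab"
  have g: "g j \<in> star" "lab (g j) = j" if "j < 5" for j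
    unfolding g_def by (rule inv_into_into[OF lab_surj[OF that]], rule f_inv_into_f[OF lab_surj[OF that]])
  \<comment> \<open>The pairs of a copy and a hub on different sides of \<open>Z\<close>. The edge
    \<open>(i, g j)\<close> joins copy \<open>i\<close> to hub \<open>j\<close>, so each pair
    contributes an edge of its own to the cut.\<close>
  let ?T = "I \<times> ({..<5} - J) \<union> ({..<5} - I) \<times> J"
  have "(i, g j) \<in> edge_cut K Z" if ij: "(i, j) \<in> ?T" for i j
  proof -
    have lt: "i < 5" "j < 5" using ij IJ by auto
    have gj: "g j \<in> edges H" "v0 \<in> ends H (g j)" using g lt by auto
    obtain u v where uv: "u \<noteq> v" "ends H (g j) = {u, v}" "u \<in> verts H" "v \<in> verts H"
      using wf_ends[OF wf gj(1)] by blast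
    then obtain w where w: "ends H (g j) = {v0, w}" "w \<noteq> v0" "w \<in> verts H"
      using gj(2) by auto
    then have "ends K (i, g j) = {(j, v0), (i, w)}"
      using g lt by (auto simp: K_ends)
    moreover have "(j, v0) \<in> Z \<longleftrightarrow> j \<in> J" "(i, w) \<in> Z \<longleftrightarrow> i \<in> I"
      using Zmem[OF lt(2) v0] Zmem[OF lt(1) w(3)] w(2) by auto
    ultimately show ?thesis
      using ij lt gj v0 w by (auto simp: edge_cut_def)
  qed
  then have "(\<lambda>(i, j). (i, g j)) ` ?T \<subseteq> edge_cut K Z" by auto
  moreover have "inj_on (\<lambda>(i, j). (i, g j)) ?T"
  proof (rule inj_onI)
    fix p q assume pq: "p \<in> ?T" "q \<in> ?T" "(\<lambda>(i, j). (i, g j)) p = (\<lambda>(i, j). (i, g j)) q"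
    obtain i j i' j' where e: "p = (i, j)" "q = (i', j')" by (cases p, cases q)
    have j: "j < 5" "j' < 5" using pq(1,2) IJ unfolding e by auto
    have "i = i'" "lab (g j) = lab (g j')" using pq(3) unfolding e by simp_all
    then show "p = q" unfolding e g(2)[OF j(1)] g(2)[OF j(2)] by simp
  qed
  ultimately have "card ?T \<le> card (edge_cut K Z)"
    by (intro card_inj_on_le[OF _ _ finite_edge_cut[OF wf_K]])
  moreover have "card ?T = card I * (5 - card J) + (5 - card I) * card J"
    using IJ fin by (subst card_Un_disjoint) (auto simp: card_cartesian_product card_Diff_subset)
  \<comment> \<open>The size of a cut in the complete bipartite graph. It is at least five unless
    \<open>I\<close> and \<open>J\<close> are both empty or both full, which would contradict that
    \<open>Z\<close> is non-empty and proper.\<close>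
  moreover have "5 \<le> card I * (5 - card J) + (5 - card I) * card J"
  proof -
    have le: "card I \<le> 5" "card J \<le> 5" using card_mono[of "{..<5::nat}"] IJ by auto
    have "\<not> (card I = 0 \<and> card J = 0)"
    proof
      assume "card I = 0 \<and> card J = 0"
      then have "I = {}" "J = {}" using fin by auto
      obtain i w where iw: "(i, w) \<in> Z" using Z(1) by auto
      then have "(i, w) \<in> verts K" using Z(2) by blast
      then show False using Zmem[of i w] iw \<open>I = {}\<close> \<open>J = {}\<close>
        by (simp split: if_splits)
    qed
    moreover have "\<not> (card I = 5 \<and> card J = 5)"
    proof
      assume "card I = 5 \<and> card J = 5"
      then have "I = {..<5}" "J = {..<5}" using IJ card_subset_eq[of "{..<5::nat}"] by auto
      then have "p \<in> Z" if "p \<in> verts K" for p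
        using Zmem[of "fst p" "snd p"] that by (cases p) (simp split: if_splits)
      then show False using Z(2) by blast
    qed
    moreover have "card I \<in> {0,1,2,3,4,5}" "card J \<in> {0,1,2,3,4,5}" using le by auto
    ultimately show ?thesis by auto
  qed
  ultimately show "5 \<le> card (edge_cut K Z0)" using Z(3) by linarith
qed

abbreviation slice :: "(nat \<times> 'e) set \<Rightarrow> nat \<Rightarrow> 'e set" where
  "slice N i \<equiv> {f \<in> edges H. (i, f) \<in> N}"

text \<open>\<open>H\<close> has even order, so a copy without \<open>v0\<close> has an odd number
  of vertices and the matching leaves it through an odd number of edges, hence at least one. The
  five hubs, no two of which are adjacent, absorb exactly five edges in total, so each copy sends
  out exactly one.\<close>

lemma slice_star:
  assumes N: "perfect_matching K N" and i: "i < 5"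
  shows "card (slice N i \<inter> star) = 1"
proof -
  have NE: "N \<subseteq> edges K" and cov: "covers_once K (verts K) N"
    using N by (auto simp: perfect_matching_iff)
  have slice: "card (N \<inter> edge_cut K ({k} \<times> R)) = card (slice N k \<inter> star)" if "k < 5" for k
  proof -
    have "N \<inter> edge_cut K ({k} \<times> R) = {k} \<times> (slice N k \<inter> star)"
      unfolding cut_copy[OF subset_refl that] cut_R by auto
    then show ?thesis by (simp add: card_cartesian_product)
  qed
  have "even (card (verts H))"
  proof -
    have "edge_cut H (verts H) = {}" by (auto simp: edge_cut_def)
    then show ?thesis using cut_parity[OF wf reg, of "verts H"] by simp
  qed
  moreover have "card (verts H) = Suc (card R)"
    using wf_finite(1)[OF wf] v0 by (metis card.remove)
  ultimately have "odd (card R)" by simp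
  have pos: "1 \<le> card (slice N k \<inter> star)" if k: "k < 5" for k
  proof -
    have sub: "{k} \<times> R \<subseteq> verts K" using k by auto
    have "even (card (N \<inter> edge_cut K ({k} \<times> R))) = even (card ({k} \<times> R))"
      by (rule matching_cut_parity[OF wf_K NE covers_once_subset[OF cov sub] sub])
    then have "odd (card (slice N k \<inter> star))"
      using slice[OF k] \<open>odd (card R)\<close> by (simp add: card_cartesian_product)
    then show ?thesis by (cases "card (slice N k \<inter> star)") auto
  qed
  let ?hubs = "{..<5} \<times> {v0}"
  have sub: "?hubs \<subseteq> verts K" using v0 by auto
  have not_in: "\<not> ends K e \<subseteq> ?hubs" if "e \<in> edges K" for e
  proof -
    obtain k f where e: "e = (k, f)" "k < 5" "f \<in> edges H" using \<open>e \<in> edges K\<close> by (cases e) auto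
    obtain u v where "u \<noteq> v" "ends H f = {u, v}" using wf_ends[OF wf e(3)] by blast
    then show ?thesis by (auto simp: e K_ends)
  qed
  have none: "{e \<in> N. ends K e \<subseteq> ?hubs} = {}" using not_in NE by auto
  have "N \<inter> edge_cut K ?hubs = Sigma {..<5} (\<lambda>k. slice N k \<inter> star)"
  proof (rule set_eqI)
    fix e :: "nat \<times> 'e"
    obtain k f where e: "e = (k, f)" by (cases e)
    show "e \<in> N \<inter> edge_cut K ?hubs \<longleftrightarrow> e \<in> Sigma {..<5} (\<lambda>k. slice N k \<inter> star)"
    proof (cases "e \<in> N")
      case True
      then have kf: "k < 5" "f \<in> edges H" using NE e by auto
      obtain u v where uv: "u \<noteq> v" "ends H f = {u, v}" "u \<in> verts H" "v \<in> verts H"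
        using wf_ends[OF wf kf(2)] by blast
      have "lab f < 5" if "v0 \<in> ends H f" using that lab_less kf by auto
      then show ?thesis using True kf uv by (auto simp: e edge_cut_def K_ends)
    qed (simp add: e)
  qed
  moreover have "card (Sigma {..<5} (\<lambda>k. slice N k \<inter> star)) = (\<Sum>k<5. card (slice N k \<inter> star))"
    using wf_finite(2)[OF wf] by (intro card_SigmaI) auto
  ultimately have "(\<Sum>k<5. card (slice N k \<inter> star)) = 5"
    using covers_once_sum[OF wf_K NE covers_once_subset[OF cov sub] sub] none
    by (simp add: card_cartesian_product)
  moreover have "(\<Sum>k<5. card (slice N k \<inter> star)) = card (slice N i \<inter> star) +
      (\<Sum>k\<in>{..<5} - {i}. card (slice N k \<inter> star))"
    using i by (intro sum.remove) auto
  moreover have "(\<Sum>k\<in>{..<5} - {i}. 1) \<le> (\<Sum>k\<in>{..<5} - {i}. card (slice N k \<inter> star))"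
    by (rule sum_mono) (use pos in auto)
  ultimately show ?thesis using pos[OF i] i by simp
qed

text \<open>At \<open>v0\<close> this is \<open>slice_star\<close>; every other vertex has in its
  copy the same edges as in \<open>H\<close>.\<close>

lemma slice_perfect:
  assumes N: "perfect_matching K N" and i: "i < 5"
  shows "perfect_matching H (slice N i)"
  unfolding perfect_matching_def
proof (intro conjI ballI)
  fix w assume w: "w \<in> verts H"
  show "\<exists>!e. e \<in> slice N i \<and> w \<in> ends H e"
  proof (cases "w = v0")
    case True
    obtain f where "slice N i \<inter> star = {f}" using slice_star[OF N i] by (metis card_1_singletonE)
    then show ?thesis unfolding True by (intro ex1I[of _ f]) blast+
  next
    case False
    have "(i, w) \<in> verts K" using w i by simp
    then obtain e where e: "e \<in> N" "(i, w) \<in> ends K e"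
      and uniq: "\<And>e'. e' \<in> N \<Longrightarrow> (i, w) \<in> ends K e' \<Longrightarrow> e' = e"
      using N unfolding perfect_matching_def Ex1_def by blast
    obtain k f where kf: "e = (k, f)" by (cases e)
    have f: "k = i" "w \<in> ends H f" using e(2) False by (auto simp: kf copy_vertex_iff)
    have "f \<in> edges H" using e(1) N by (auto simp: kf perfect_matching_def)
    show ?thesis
    proof (rule ex1I[of _ f])
      show "f \<in> slice N i \<and> w \<in> ends H f" using f e(1) \<open>f \<in> edges H\<close> by (simp add: kf)
    next
      fix f' assume "f' \<in> slice N i \<and> w \<in> ends H f'"
      then have "(i, f') = e" using False by (intro uniq) (auto simp: copy_vertex_iff)
      then show "f' = f" by (simp add: kf)
    qed
  qed
qed auto

text \<open>Otherwise two edges of \<open>N\<close> would cover the hub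
  \<open>lab f\<close>.\<close>

lemma slice_distinct:
  assumes N: "perfect_matching K N" and "i < 5" "i' < 5" "f \<in> star" "f \<in> slice N i" "f \<in> slice N i'"
  shows "i = i'"
proof -
  have "(lab f, v0) \<in> verts K" using assms(4) v0 lab_less by auto
  then have "\<exists>!e. e \<in> N \<and> (lab f, v0) \<in> ends K e" using N by (simp add: perfect_matching_def)
  moreover have "(i, f) \<in> N \<and> (lab f, v0) \<in> ends K (i, f)" "(i', f) \<in> N \<and> (lab f, v0) \<in> ends K (i', f)"
    using assms(4-6) by (auto simp: hub_vertex_iff)
  ultimately have "(i, f) = (i', f)" by (metis (no_types, lifting))
  then show ?thesis by simp
qed

lemma exists_disjoint_slices:
  assumes m5: "m 5 \<ge> 2"
  obtains N1 N2 :: "nat \<Rightarrow> 'e set" where "\<And>i. i < 5 \<Longrightarrow> perfect_matching H (N1 i)"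
    "\<And>i. i < 5 \<Longrightarrow> perfect_matching H (N2 i)" "\<And>i. i < 5 \<Longrightarrow> N1 i \<inter> N2 i = {}"
    "\<And>i j f. i < 5 \<Longrightarrow> j < 5 \<Longrightarrow> f \<in> star \<Longrightarrow> f \<in> N1 i \<Longrightarrow> f \<in> N1 j \<Longrightarrow> i = j"
    "\<And>i j f. i < 5 \<Longrightarrow> j < 5 \<Longrightarrow> f \<in> star \<Longrightarrow> f \<in> N2 i \<Longrightarrow> f \<in> N2 j \<Longrightarrow> i = j"
proof -
  obtain M N where MN: "perfect_matching K M" "perfect_matching K N" "M \<inter> N = {}"
    using two_disjoint_pms[OF m5 edge_connected_r_graph[OF wf_K regular_K _ conn_K] conn_K] by auto
  show thesis
  proof (rule that[of "slice M" "slice N"])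
    show "slice M i \<inter> slice N i = {}" for i using MN(3) by auto
  qed (use slice_perfect slice_distinct MN in blast)+
qed

end

lemma ex_labelling:
  assumes "wf_mgraph H" "regular r H" "v \<in> verts H"
  obtains lab where "bij_betw lab {f \<in> edges H. v \<in> ends H f} {..<r::nat}"
proof -
  have "finite {f \<in> edges H. v \<in> ends H f}" using wf_finite[OF assms(1)] by simp
  then obtain lab where "bij_betw lab {f \<in> edges H. v \<in> ends H f} {0..<card {f \<in> edges H. v \<in> ends H f}}"
    using ex_bij_betw_finite_nat by blast
  moreover have "card {f \<in> edges H. v \<in> ends H f} = r"
    using assms(2,3) by (simp add: regular_def degree_def)
  ultimately show thesis using that by (simp add: atLeast0LessThan)
qed

text \<open>The five slices of the first matching use five different edges at \<open>v\<close>,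
  hence all of them, so one of the slices contains \<open>e\<close>.\<close>

lemma disjoint_pms_through_edge:
  fixes H :: "('v, 'e) mgraph"
  assumes m5: "m 5 \<ge> 2" and wf: "wf_mgraph H" and reg: "regular 5 H" and conn: "edge_connected 5 H"
    and e: "e \<in> edges H"
  obtains M N where "perfect_matching H M" "perfect_matching H N" "M \<inter> N = {}" "e \<in> M"
proof -
  obtain v where v: "v \<in> verts H" "v \<in> ends H e" using wf_ends[OF wf e] by blast
  obtain lab where lab: "bij_betw lab {f \<in> edges H. v \<in> ends H f} {..<5::nat}"
    by (rule ex_labelling[OF wf reg v(1)])
  interpret fivefold_gluing H v lab by unfold_locales (fact wf reg conn v(1) lab)+
  obtain N1 N2 :: "nat \<Rightarrow> 'e set" where N: "\<And>i. i < 5 \<Longrightarrow> perfect_matching H (N1 i)"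
    "\<And>i. i < 5 \<Longrightarrow> perfect_matching H (N2 i)" "\<And>i. i < 5 \<Longrightarrow> N1 i \<inter> N2 i = {}"
    "\<And>i j f. i < 5 \<Longrightarrow> j < 5 \<Longrightarrow> f \<in> star \<Longrightarrow> f \<in> N1 i \<Longrightarrow> f \<in> N1 j \<Longrightarrow> i = j"
    by (rule exists_disjoint_slices[OF m5]) blast
  have "\<exists>f. f \<in> star \<and> f \<in> N1 i" if "i < 5" for i
    using N(1)[OF that] v(1) unfolding perfect_matching_def Ex1_def by blast
  then obtain s where s: "\<And>i. i < 5 \<Longrightarrow> s i \<in> star" "\<And>i. i < 5 \<Longrightarrow> s i \<in> N1 i" by metis
  have "inj_on s {..<5}"
  proof (rule inj_onI)
    fix i j assume "i \<in> {..<5}" "j \<in> {..<5}" and eq: "s i = s j"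
    then have lt: "i < 5" "j < 5" by auto
    show "i = j" by (rule N(4)[OF lt s(1)[OF lt(1)] s(2)[OF lt(1)]]) (use s(2)[OF lt(2)] eq in simp)
  qed
  then have "card (s ` {..<5}) = card star" using card_star by (simp add: card_image)
  moreover have "s ` {..<5} \<subseteq> star" using s(1) by blast
  moreover have "finite star" using wf_finite[OF wf] by simp
  ultimately have "s ` {..<5} = star" by (intro card_subset_eq)
  moreover have "e \<in> star" using e v by simp
  ultimately have "e \<in> s ` {..<5}" by simp
  then obtain i where i: "i < 5" "e = s i" by auto
  show thesis
    by (rule that[OF N(1-3)[OF i(1)]]) (use s(2)[OF i(1)] i(2) in simp)
qed

lemma disjoint_pms_avoiding:
  fixes H :: "('v, 'e) mgraph"
  assumes m5: "m 5 \<ge> 2" and wf: "wf_mgraph H" and reg: "regular 5 H" and conn: "edge_connected 5 H"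
    and v: "v \<in> verts H" and S: "S \<subseteq> {f \<in> edges H. v \<in> ends H f}" "card S \<le> 2"
  obtains M N where "perfect_matching H M" "perfect_matching H N" "M \<inter> N = {}"
    "S \<inter> M = {}" "S \<inter> N = {}"
proof -
  obtain lab where lab: "bij_betw lab {f \<in> edges H. v \<in> ends H f} {..<5::nat}"
    by (rule ex_labelling[OF wf reg v])
  interpret fivefold_gluing H v lab by unfold_locales (fact wf reg conn v lab)+
  obtain N1 N2 :: "nat \<Rightarrow> 'e set" where N: "\<And>i. i < 5 \<Longrightarrow> perfect_matching H (N1 i)"
    "\<And>i. i < 5 \<Longrightarrow> perfect_matching H (N2 i)" "\<And>i. i < 5 \<Longrightarrow> N1 i \<inter> N2 i = {}"
    and inj: "\<And>i j f. i < 5 \<Longrightarrow> j < 5 \<Longrightarrow> f \<in> star \<Longrightarrow> f \<in> N1 i \<Longrightarrow> f \<in> N1 j \<Longrightarrow> i = j"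
    "\<And>i j f. i < 5 \<Longrightarrow> j < 5 \<Longrightarrow> f \<in> star \<Longrightarrow> f \<in> N2 i \<Longrightarrow> f \<in> N2 j \<Longrightarrow> i = j"
    by (rule exists_disjoint_slices[OF m5]) blast
  have finS: "finite S" using wf_finite[OF wf] S(1) finite_subset by fastforce
  \<comment> \<open>The copies spoiled by \<open>f\<close>: at most one for each of the two
    matchings.\<close>
  define T where "T f = {i. i < 5 \<and> f \<in> N1 i} \<union> {i. i < 5 \<and> f \<in> N2 i}" for f
  have small: "card A \<le> 1" if "\<And>i j. i \<in> A \<Longrightarrow> j \<in> A \<Longrightarrow> i = j" for A :: "nat set"
  proof (cases "A = {}")
    case False
    then obtain a where "a \<in> A" by blast
    then have "A = {a}" using that by blast
    then show ?thesis by simp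
  qed simp
  have T: "card (T f) \<le> 2" if "f \<in> S" for f
  proof -
    have f: "f \<in> star" using that S(1) by blast
    have "card {i. i < 5 \<and> f \<in> N1 i} \<le> 1" "card {i. i < 5 \<and> f \<in> N2 i} \<le> 1"
      by (rule small; use inj f in blast)+
    then show ?thesis unfolding T_def by (intro order_trans[OF card_Un_le]) simp
  qed
  have "card (\<Union>f\<in>S. T f) \<le> (\<Sum>f\<in>S. card (T f))" by (rule card_UN_le[OF finS])
  also have "\<dots> \<le> (\<Sum>f\<in>S. 2)" by (rule sum_mono[OF T])
  also have "\<dots> \<le> 4" using S(2) by simp
  finally have "card (\<Union>f\<in>S. T f) < card {..<5::nat}" by simp
  then have "\<not> {..<5} \<subseteq> (\<Union>f\<in>S. T f)"
    using card_mono[of "\<Union>f\<in>S. T f" "{..<5}"] finS by (auto simp: T_def)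
  then obtain i where i: "i < 5" "\<forall>f\<in>S. i \<notin> T f" by blast
  then have "S \<inter> N1 i = {}" "S \<inter> N2 i = {}" unfolding T_def by blast+
  then show thesis by (rule that[OF N(1-3)[OF i(1)]])
qed

section \<open>Good matchings\<close>

text \<open>The inequality says that a cut has at least five edges once the edges outside \<open>M\<close> are doubled.\<close>

definition good :: "('v, 'e) mgraph \<Rightarrow> 'e set \<Rightarrow> bool" where
  "good G M \<longleftrightarrow> perfect_matching G M \<and> (\<forall>X. X \<noteq> {} \<and> X \<subset> verts G \<longrightarrow>
     5 + card (M \<inter> edge_cut G X) \<le> 2 * card (edge_cut G X))"

definition doubled :: "('v, 'e) mgraph \<Rightarrow> 'e set \<Rightarrow> ('v, 'e \<times> bool) mgraph" where
  "doubled G M = \<lparr>verts = verts G, edges = edges G \<times> {False} \<union> (edges G - M) \<times> {True},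
     ends = (\<lambda>f. ends G (fst f))\<rparr>"

lemma doubled_sel [simp]:
  "verts (doubled G M) = verts G"
  "edges (doubled G M) = edges G \<times> {False} \<union> (edges G - M) \<times> {True}"
  "ends (doubled G M) f = ends G (fst f)"
  by (simp_all add: doubled_def)

lemma wf_doubled: "wf_mgraph G \<Longrightarrow> wf_mgraph (doubled G M)"
  unfolding wf_mgraph_def doubled_sel by auto

text \<open>Applied to the three edges at a vertex, one of which is in \<open>M\<close>, this gives
  degree five; applied to a cut, it turns the inequality in \<open>good\<close> into
  5-edge-connectivity.\<close>

lemma card_doubled:
  assumes "finite S"
  shows "card (S \<times> {False} \<union> (S - M) \<times> {True}) + card (M \<inter> S) = 2 * card S"
proof -
  have "card (S \<times> {False} \<union> (S - M) \<times> {True}) = card S + card (S - M)"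
    using assms by (subst card_Un_disjoint) (auto simp: card_cartesian_product)
  moreover have "card (S - M) + card (M \<inter> S) = card S"
    using card_Diff_subset_Int[of S M] assms card_mono[OF assms, of "S \<inter> M"] by (simp add: Int_commute)
  ultimately show ?thesis by simp
qed

lemma regular_doubled:
  assumes wf: "wf_mgraph G" and reg: "regular 3 G" and M: "perfect_matching G M"
  shows "regular 5 (doubled G M)"
  unfolding regular_def
proof
  fix v assume "v \<in> verts (doubled G M)"
  then have v: "v \<in> verts G" by simp
  let ?S = "{f \<in> edges G. v \<in> ends G f}"
  have ME: "M \<subseteq> edges G" and cov: "covers_once G (verts G) M"
    using M by (auto simp: perfect_matching_iff)
  have "{f \<in> edges (doubled G M). v \<in> ends (doubled G M) f} = ?S \<times> {False} \<union> (?S - M) \<times> {True}"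
    by auto
  moreover have "finite ?S" "card ?S = 3"
    using wf_finite[OF wf] reg v by (auto simp: regular_def degree_def)
  moreover have "M \<inter> ?S = {f \<in> M. v \<in> ends G f}" using ME by auto
  then have "card (M \<inter> ?S) = 1" using covers_once_card[OF cov v] by simp
  ultimately show "degree (doubled G M) v = 5"
    using card_doubled[of ?S M] unfolding degree_def by simp
qed

lemma edge_connected_doubled:
  assumes wf: "wf_mgraph G" and M: "good G M"
  shows "edge_connected 5 (doubled G M)"
  unfolding edge_connected_def
proof (intro allI impI)
  fix X assume X: "X \<noteq> {} \<and> X \<subset> verts (doubled G M)"
  have "edge_cut (doubled G M) X = edge_cut G X \<times> {False} \<union> (edge_cut G X - M) \<times> {True}"
    unfolding edge_cut_def doubled_sel by auto
  then have "card (edge_cut (doubled G M) X) + card (M \<inter> edge_cut G X) = 2 * card (edge_cut G X)"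
    using card_doubled[OF finite_edge_cut[OF wf]] by simp
  moreover have "5 + card (M \<inter> edge_cut G X) \<le> 2 * card (edge_cut G X)"
    using M X by (simp add: good_def)
  ultimately show "5 \<le> card (edge_cut (doubled G M) X)" by linarith
qed

lemma perfect_matching_doubled:
  assumes N: "perfect_matching (doubled G M) N"
  shows "perfect_matching G (fst ` N)"
  unfolding perfect_matching_def
proof (intro conjI ballI)
  show "fst ` N \<subseteq> edges G" using N unfolding perfect_matching_def doubled_sel by auto
  fix v assume "v \<in> verts G"
  then have "\<exists>!e. e \<in> N \<and> v \<in> ends (doubled G M) e" using N by (simp add: perfect_matching_def)
  then obtain e where e: "e \<in> N \<and> v \<in> ends G (fst e)"
    "\<forall>e'. e' \<in> N \<and> v \<in> ends G (fst e') \<longrightarrow> e' = e" unfolding doubled_sel by (rule ex1E)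
  show "\<exists>!f. f \<in> fst ` N \<and> v \<in> ends G f"
  proof (rule ex1I[of _ "fst e"])
    show "fst e \<in> fst ` N \<and> v \<in> ends G (fst e)" using e(1) by blast
  next
    fix f assume "f \<in> fst ` N \<and> v \<in> ends G f"
    then obtain e' where "e' \<in> N" "f = fst e'" "v \<in> ends G (fst e')" by blast
    then show "f = fst e" using e(2) by blast
  qed
qed

section \<open>Gluing good matchings across a cut\<close>

definition half :: "('v, 'e) mgraph \<Rightarrow> 'v set \<Rightarrow> 'e set \<Rightarrow> bool" where
  "half G X M \<longleftrightarrow> M \<subseteq> {f \<in> edges G. ends G f \<inter> X \<noteq> {}} \<and> covers_once G X M \<and>
     (\<forall>A. A \<subseteq> X \<and> A \<noteq> {} \<longrightarrow> 5 + card (M \<inter> edge_cut G A) \<le> 2 * card (edge_cut G A))"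

text \<open>The situation after two halves are joined along the cut of \<open>X\<close>: the
  inequality of \<open>good\<close> is known for the sets on either side and has to be shown for the
  sets that cross \<open>X\<close>. \<open>d\<close> and \<open>\<mu>\<close> count the cut edges
  and those in \<open>M\<close>, so \<open>2 * d Z - \<mu> Z\<close> is the size of the cut after
  doubling.\<close>

locale glued_matching =
  fixes G :: "('v, 'e) mgraph" and X :: "'v set" and M :: "'e set"
  assumes wf: "wf_mgraph G" and reg: "regular 3 G" and conn: "edge_connected 3 G"
    and pm: "perfect_matching G M" and X: "X \<noteq> {}" "X \<subset> verts G"
    and inside: "\<And>A. A \<subseteq> X \<Longrightarrow> A \<noteq> {} \<Longrightarrow> 5 + card (M \<inter> edge_cut G A) \<le> 2 * card (edge_cut G A)"
    and outside: "\<And>A. A \<subseteq> verts G - X \<Longrightarrow> A \<noteq> {} \<Longrightarrow>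
      5 + card (M \<inter> edge_cut G A) \<le> 2 * card (edge_cut G A)"
begin

abbreviation "d Z \<equiv> card (edge_cut G Z)"
abbreviation "\<mu> Z \<equiv> card (M \<inter> edge_cut G Z)"
abbreviation "\<delta> P Q \<equiv> between G (edges G) P Q"
abbreviation "\<delta>' P Q \<equiv> between G M P Q"

lemma ME: "M \<subseteq> edges G" and cov: "covers_once G (verts G) M"
  using pm by (auto simp: perfect_matching_iff)

lemma \<mu>_le: "\<mu> Z \<le> d Z"
  by (rule card_mono[OF finite_edge_cut[OF wf]]) auto

lemma \<delta>'_le: "\<delta>' P Q \<le> \<delta> P Q"
  by (rule between_mono[OF wf_finite(2)[OF wf] ME])

lemma parity: "Z \<subseteq> verts G \<Longrightarrow> even (\<mu> Z) = even (d Z)"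
  using matching_cut_parity[OF wf ME covers_once_subset[OF cov]] cut_parity[OF wf reg] by simp

lemma d_ge: "Z \<noteq> {} \<Longrightarrow> Z \<subset> verts G \<Longrightarrow> 3 \<le> d Z"
  using conn by (simp add: edge_connected_def)

lemma quadrant_counts:
  assumes Z: "Z \<subseteq> verts G"
  defines "A \<equiv> X \<inter> Z" and "B \<equiv> X - Z" and "C \<equiv> Z - X" and "D \<equiv> verts G - X - Z"
  shows "d A = \<delta> A B + \<delta> A C + \<delta> A D" (is ?a) "d B = \<delta> A B + \<delta> B C + \<delta> B D" (is ?b)
    "d C = \<delta> A C + \<delta> B C + \<delta> C D" (is ?c) "d D = \<delta> A D + \<delta> B D + \<delta> C D" (is ?d)
    "d X = \<delta> A C + \<delta> A D + \<delta> B C + \<delta> B D" (is ?x) "d Z = \<delta> A B + \<delta> A D + \<delta> B C + \<delta> C D" (is ?z)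
    "\<mu> A = \<delta>' A B + \<delta>' A C + \<delta>' A D" (is ?a') "\<mu> B = \<delta>' A B + \<delta>' B C + \<delta>' B D" (is ?b')
    "\<mu> C = \<delta>' A C + \<delta>' B C + \<delta>' C D" (is ?c') "\<mu> D = \<delta>' A D + \<delta>' B D + \<delta>' C D" (is ?d')
    "\<mu> X = \<delta>' A C + \<delta>' A D + \<delta>' B C + \<delta>' B D" (is ?x') "\<mu> Z = \<delta>' A B + \<delta>' A D + \<delta>' B C + \<delta>' C D" (is ?z')
proof -
  have V: "verts G = A \<union> B \<union> C \<union> D" using X Z by (auto simp: A_def B_def C_def D_def)
  have disj: "A \<inter> B = {}" "A \<inter> C = {}" "A \<inter> D = {}" "B \<inter> C = {}" "B \<inter> D = {}" "C \<inter> D = {}"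
    by (auto simp: A_def B_def C_def D_def)
  have E: "edges G \<inter> edge_cut G Y = edge_cut G Y" for Y
    by (rule Int_absorb1[OF edge_cut_subset])
  have eqs: "A \<union> B = X" "A \<union> C = Z" using Z by (auto simp: A_def B_def C_def)
  show ?a ?b ?c ?d ?x ?z
    by (fact quadrants[OF wf subset_refl V disj, unfolded E eqs])+
  show ?a' ?b' ?c' ?d' ?x' ?z'
    by (fact quadrants[OF wf ME V disj, unfolded eqs])+
qed

text \<open>A set and its complement have the same cut. If one of the quadrants is empty, then
  \<open>Z\<close> or its complement lies on one side of \<open>X\<close>, where the inequality is
  known.\<close>

lemma good_if_crossing:
  assumes "\<And>Z. \<lbrakk>Z \<noteq> {}; Z \<subset> verts G; X \<inter> Z \<noteq> {}; X - Z \<noteq> {}; Z - X \<noteq> {}; verts G - X - Z \<noteq> {};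
    \<not> 5 + \<mu> Z \<le> 2 * d Z\<rbrakk> \<Longrightarrow> False"
  shows "good G M"
  unfolding good_def
proof (intro conjI allI impI pm)
  fix Z assume Z: "Z \<noteq> {} \<and> Z \<subset> verts G"
  have eq: "edge_cut G (verts G - Z) = edge_cut G Z" using Z by (intro edge_cut_compl) auto
  show "5 + \<mu> Z \<le> 2 * d Z"
  proof (rule ccontr)
    assume bad: "\<not> 5 + \<mu> Z \<le> 2 * d Z"
    then have "\<not> 5 + \<mu> (verts G - Z) \<le> 2 * d (verts G - Z)" unfolding eq .
    then have "\<not> Z \<subseteq> X" "\<not> Z \<subseteq> verts G - X" "\<not> verts G - Z \<subseteq> X" "\<not> verts G - Z \<subseteq> verts G - X"
      using bad inside outside Z by blast+
    then show False using assms[of Z] Z bad X by blast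
  qed
qed

lemma bad_cut:
  assumes Z: "Z \<noteq> {}" "Z \<subset> verts G" and bad: "\<not> 5 + \<mu> Z \<le> 2 * d Z"
  shows "\<mu> Z = d Z" "d Z = 3 \<or> d Z = 4"
proof -
  have "3 \<le> d Z" "\<mu> Z \<le> d Z" "even (\<mu> Z) = even (d Z)"
    using d_ge[OF Z] \<mu>_le parity Z by auto
  moreover from this bad have "d Z = 3 \<or> d Z = 4" by linarith
  moreover have "\<mu> Z = 2 \<or> \<mu> Z = 3 \<or> \<mu> Z = 4" using bad calculation(1,2,4) by linarith
  ultimately show "\<mu> Z = d Z" "d Z = 3 \<or> d Z = 4" using bad
    by (elim disjE; simp)+
qed

text \<open>Uncrossing in the doubled graph: there the cut of \<open>X\<close> has at most five
  edges and a violating \<open>Z\<close> at most four, whereas \<open>X \<inter> Z\<close> and the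
  complement of \<open>X \<union> Z\<close> have at least five each.\<close>

lemma good_if_tight:
  assumes "2 * d X \<le> 5 + \<mu> X"
  shows "good G M"
proof (rule good_if_crossing)
  fix Z assume Z: "Z \<noteq> {}" "Z \<subset> verts G" "X \<inter> Z \<noteq> {}" "X - Z \<noteq> {}" "Z - X \<noteq> {}"
    "verts G - X - Z \<noteq> {}" and bad: "\<not> 5 + \<mu> Z \<le> 2 * d Z"
  note q = quadrant_counts[OF psubset_imp_subset[OF Z(2)]]
  have "5 + \<mu> (X \<inter> Z) \<le> 2 * d (X \<inter> Z)" using inside Z by auto
  moreover have "5 + \<mu> (verts G - X - Z) \<le> 2 * d (verts G - X - Z)" using outside Z by auto
  moreover note \<delta>'_le[of "X - Z" "Z - X"]
  ultimately show False using assms bad q by linarith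
qed

text \<open>Here the doubled cut of \<open>X\<close> has six edges, one too many for plain
  uncrossing. A violating \<open>Z\<close> forces equality throughout, and parity excludes the
  equality case.\<close>

lemma good_if_pair:
  assumes "d X = 4" "\<mu> X = 2"
  shows "good G M"
proof (rule good_if_crossing)
  fix Z assume Z: "Z \<noteq> {}" "Z \<subset> verts G" "X \<inter> Z \<noteq> {}" "X - Z \<noteq> {}" "Z - X \<noteq> {}"
    "verts G - X - Z \<noteq> {}" and bad: "\<not> 5 + \<mu> Z \<le> 2 * d Z"
  define A B C D where "A = X \<inter> Z" and "B = X - Z" and "C = Z - X" and "D = verts G - X - Z"
  note q = quadrant_counts[OF psubset_imp_subset[OF Z(2)], folded A_def B_def C_def D_def]
  note le = \<delta>'_le[of A B] \<delta>'_le[of A C] \<delta>'_le[of A D] \<delta>'_le[of B C] \<delta>'_le[of B D] \<delta>'_le[of C D]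
  have w: "5 + \<mu> A \<le> 2 * d A" "5 + \<mu> B \<le> 2 * d B" "5 + \<mu> C \<le> 2 * d C" "5 + \<mu> D \<le> 2 * d D"
    by (rule inside outside; use Z in \<open>auto simp: A_def B_def C_def D_def\<close>)+
  note bz = bad_cut[OF Z(1,2) bad]
  have eq: "\<delta>' A B = \<delta> A B" "\<delta>' A D = \<delta> A D" "\<delta>' B C = \<delta> B C" "\<delta>' C D = \<delta> C D"
    using bz(1) q(6,12) le by linarith+
  \<comment> \<open>Six plus at most four against five plus five: both uncrossing inequalities are
    tight, so no edge joins opposite quadrants.\<close>
  have diag: "\<delta> B C = 0" "\<delta> A D = 0" "d Z = 4"
    using w q assms eq bz(2) by linarith+
  have "\<delta> A B = 2" "2 * \<delta> A C = 3 + \<delta>' A C" "2 * \<delta> B D = 3 + \<delta>' B D" "\<delta> A C + \<delta> B D = 4"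
    using w q assms eq diag by linarith+
  moreover have "even (\<mu> A) = even (d A)" by (rule parity) (use Z in \<open>auto simp: A_def\<close>)
  then have "even (\<delta>' A C) = even (\<delta> A C)" using q(1,7) eq diag by auto
  \<comment> \<open>With \<open>x' \<le> x\<close> of equal parity, \<open>2 * x = 3 + x'\<close>
    leaves only \<open>x = x' = 3\<close>; then \<open>y = 1\<close>, and
    \<open>2 * y = 3 + y'\<close> fails.\<close>
  moreover have False if "2 * x = 3 + x'" "2 * y = 3 + y'" "x + y = 4" "x' \<le> x" "y' \<le> y"
    "even x' = even x" for x x' y y' :: nat
    using that by presburger
  ultimately show False using le(2,5) by blast
qed

text \<open>The cut of \<open>X\<close> avoids \<open>M\<close> while a violating cut lies in
  \<open>M\<close>, so the two cuts are disjoint and no edge joins opposite quadrants. The counts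
  then force two edges between any two adjacent quadrants: both sides split the four cut edges into
  the same two pairs, which \<open>sep\<close> excludes.\<close>

lemma good_if_avoided:
  assumes dX: "d X = 4" and \<mu>X: "M \<inter> edge_cut G X = {}"
    and in3: "\<And>A. A \<subseteq> X \<Longrightarrow> A \<noteq> {} \<Longrightarrow> A \<noteq> X \<Longrightarrow> \<not> (d A = 3 \<and> d (X - A) = 3)"
    and out3: "\<And>A. A \<subseteq> verts G - X \<Longrightarrow> A \<noteq> {} \<Longrightarrow> A \<noteq> verts G - X \<Longrightarrow>
      \<not> (d A = 3 \<and> d (verts G - X - A) = 3)"
    and sep: "\<And>A C. \<lbrakk>A \<subseteq> X; C \<subseteq> verts G - X; edge_cut G A \<inter> edge_cut G X = edge_cut G C \<inter> edge_cut G X;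
      card (edge_cut G A \<inter> edge_cut G X) = 2; card (edge_cut G A - edge_cut G X) = 2;
      card (edge_cut G C - edge_cut G X) = 2; edge_cut G A - edge_cut G X \<subseteq> M;
      edge_cut G C - edge_cut G X \<subseteq> M\<rbrakk> \<Longrightarrow> False"
  shows "good G M"
proof (rule good_if_crossing)
  fix Z assume Z: "Z \<noteq> {}" "Z \<subset> verts G" "X \<inter> Z \<noteq> {}" "X - Z \<noteq> {}" "Z - X \<noteq> {}"
    "verts G - X - Z \<noteq> {}" and bad: "\<not> 5 + \<mu> Z \<le> 2 * d Z"
  define A B C D where "A = X \<inter> Z" and "B = X - Z" and "C = Z - X" and "D = verts G - X - Z"
  note q = quadrant_counts[OF psubset_imp_subset[OF Z(2)], folded A_def B_def C_def D_def]
  note le = \<delta>'_le[of A B] \<delta>'_le[of A C] \<delta>'_le[of A D] \<delta>'_le[of B C] \<delta>'_le[of B D] \<delta>'_le[of C D]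
  have \<mu>0: "\<mu> X = 0" unfolding \<mu>X by simp
  note bz = bad_cut[OF Z(1,2) bad]
  have eq: "\<delta>' A B = \<delta> A B" "\<delta>' A D = \<delta> A D" "\<delta>' B C = \<delta> B C" "\<delta>' C D = \<delta> C D"
    using bz(1) q(6,12) le by linarith+
  have zero: "\<delta>' A C = 0" "\<delta>' B D = 0" "\<delta> A D = 0" "\<delta> B C = 0"
    using q(11) \<mu>0 eq by linarith+
  have ge: "3 \<le> d A" "3 \<le> d B" "3 \<le> d C" "3 \<le> d D"
    by (rule d_ge; use Z X in \<open>auto simp: A_def B_def C_def D_def\<close>)+
  have "even (\<mu> A) = even (d A)" by (rule parity) (use Z in \<open>auto simp: A_def\<close>)
  then have ev: "even (\<delta> A C)" using q(1,7) eq zero by auto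
  \<comment> \<open>The number is even by the parity of \<open>A\<close>. If it were zero,
    \<open>A\<close> and \<open>C\<close> would each send at least three edges into the cut of
    \<open>Z\<close>, which has at most four; if it were four, \<open>B\<close> and \<open>D\<close>
    would do so.\<close>
  have AC: "\<delta> A C = 2"
  proof -
    have "\<delta> A C \<noteq> 0" "\<delta> A C \<noteq> 4" "\<delta> A C \<le> 4"
      using ge q dX zero bz(2) by linarith+
    moreover have "x = 2" if "x \<noteq> 0" "x \<noteq> 4" "x \<le> 4" "even x" for x :: nat
      using that by presburger
    ultimately show ?thesis using ev by blast
  qed
  \<comment> \<open>With a single edge between them, both parts of \<open>X\<close> would have cuts
    of three edges, against \<open>in3\<close>.\<close>
  have AB: "\<delta> A B \<noteq> 1"
  proof
    assume "\<delta> A B = 1"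
    then have "d A = 3" "d B = 3" using q dX zero AC by linarith+
    moreover have "B = X - A" "A \<subseteq> X" "A \<noteq> {}" "A \<noteq> X" using Z by (auto simp: A_def B_def)
    ultimately show False using in3 by metis
  qed
  have CD: "\<delta> C D \<noteq> 1"
  proof
    assume "\<delta> C D = 1"
    then have "d C = 3" "d D = 3" using q dX zero AC by linarith+
    moreover have "D = verts G - X - C" "C \<subseteq> verts G - X" "C \<noteq> {}" "C \<noteq> verts G - X"
      using Z by (auto simp: C_def D_def)
    ultimately show False using out3 by metis
  qed
  have two: "\<delta> A B = 2" "\<delta> C D = 2"
    using AB CD q zero AC dX ge bz(2) by linarith+
  have sub: "X \<subseteq> verts G" "Z \<subseteq> verts G" using X Z by auto
  have fin: "finite {f \<in> edges G. P f}" for P using wf_finite[OF wf] by simp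
  have no: "\<not> (ends G f \<inter> P \<noteq> {} \<and> ends G f \<inter> Q \<noteq> {})"
    if "\<delta> P Q = 0" "f \<in> edges G" for f P Q
  proof -
    have "{f \<in> edges G. ends G f \<inter> P \<noteq> {} \<and> ends G f \<inter> Q \<noteq> {}} = {}"
      by (rule iffD1[OF card_0_eq[OF fin] that(1)[unfolded between_def]])
    then show ?thesis using that(2) by blast
  qed
  \<comment> \<open>Since no edge joins opposite quadrants, an edge leaving \<open>A\<close> goes to
    \<open>B\<close> inside \<open>X\<close> or to \<open>C\<close> across the cut of
    \<open>X\<close>, and similarly for \<open>C\<close>. This turns the counts into the edge sets
    that \<open>sep\<close> speaks about.\<close>
  have mem: "(f \<in> edge_cut G A - edge_cut G X \<longleftrightarrow> ends G f \<inter> A \<noteq> {} \<and> ends G f \<inter> B \<noteq> {}) \<and>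
     (f \<in> edge_cut G C - edge_cut G X \<longleftrightarrow> ends G f \<inter> C \<noteq> {} \<and> ends G f \<inter> D \<noteq> {}) \<and>
     (f \<in> edge_cut G A \<inter> edge_cut G X \<longleftrightarrow> ends G f \<inter> A \<noteq> {} \<and> ends G f \<inter> C \<noteq> {}) \<and>
     (f \<in> edge_cut G C \<inter> edge_cut G X \<longleftrightarrow> ends G f \<inter> A \<noteq> {} \<and> ends G f \<inter> C \<noteq> {}) \<and>
     (ends G f \<inter> A \<noteq> {} \<and> ends G f \<inter> B \<noteq> {} \<longrightarrow> f \<in> edge_cut G Z) \<and>
     (ends G f \<inter> C \<noteq> {} \<and> ends G f \<inter> D \<noteq> {} \<longrightarrow> f \<in> edge_cut G Z)" if f: "f \<in> edges G" for f
  proof -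
    obtain u v where uv: "u \<noteq> v" "ends G f = {u, v}" "u \<in> verts G" "v \<in> verts G"
      by (rule wf_ends[OF wf f])
    have cut: "f \<in> edge_cut G Y \<longleftrightarrow> (u \<in> Y) \<noteq> (v \<in> Y)" for Y
      using uv f by (auto simp: edge_cut_def)
    have touch: "ends G f \<inter> Y \<noteq> {} \<longleftrightarrow> u \<in> Y \<or> v \<in> Y" for Y
      using uv by auto
    have "\<not> ((u \<in> A \<or> v \<in> A) \<and> (u \<in> D \<or> v \<in> D))" "\<not> ((u \<in> B \<or> v \<in> B) \<and> (u \<in> C \<or> v \<in> C))"
      using no[OF zero(3) f] no[OF zero(4) f] unfolding touch by blast+
    then show ?thesis
      using uv(3,4) unfolding cut touch Diff_iff Int_iff unfolding A_def B_def C_def D_def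
      by simp blast
  qed
  have coll: "S = {f \<in> edges G. P f}" if "S \<subseteq> edges G" "\<And>f. f \<in> edges G \<Longrightarrow> f \<in> S \<longleftrightarrow> P f" for S P
    using that by blast
  have inA: "edge_cut G A - edge_cut G X = {f \<in> edges G. ends G f \<inter> A \<noteq> {} \<and> ends G f \<inter> B \<noteq> {}}"
    by (rule coll[OF _ mem[THEN conjunct1]]) (use edge_cut_subset[of G A] in blast)
  have inC: "edge_cut G C - edge_cut G X = {f \<in> edges G. ends G f \<inter> C \<noteq> {} \<and> ends G f \<inter> D \<noteq> {}}"
    by (rule coll[OF _ mem[THEN conjunct2, THEN conjunct1]]) (use edge_cut_subset[of G C] in blast)
  have crossA: "edge_cut G A \<inter> edge_cut G X = {f \<in> edges G. ends G f \<inter> A \<noteq> {} \<and> ends G f \<inter> C \<noteq> {}}"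
    by (rule coll[OF _ mem[THEN conjunct2, THEN conjunct2, THEN conjunct1]])
      (use edge_cut_subset[of G A] in blast)
  have crossC: "edge_cut G C \<inter> edge_cut G X = {f \<in> edges G. ends G f \<inter> A \<noteq> {} \<and> ends G f \<inter> C \<noteq> {}}"
    by (rule coll[OF _ mem[THEN conjunct2, THEN conjunct2, THEN conjunct2, THEN conjunct1]])
      (use edge_cut_subset[of G C] in blast)
  have inZ: "edge_cut G A - edge_cut G X \<subseteq> edge_cut G Z" "edge_cut G C - edge_cut G X \<subseteq> edge_cut G Z"
    unfolding inA inC using mem[THEN conjunct2, THEN conjunct2, THEN conjunct2, THEN conjunct2]
    by (simp_all only: subset_iff mem_Collect_eq) meson+
  have "M \<inter> edge_cut G Z = edge_cut G Z"
    using bz(1) by (intro card_subset_eq[OF finite_edge_cut[OF wf]]) auto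
  then have inM: "edge_cut G Z \<subseteq> M" by blast
  have "card (edge_cut G A \<inter> edge_cut G X) = 2" "card (edge_cut G A - edge_cut G X) = 2"
      "card (edge_cut G C - edge_cut G X) = 2"
    unfolding inA inC crossA using AC two unfolding between_def by simp_all
  moreover have "A \<subseteq> X" "C \<subseteq> verts G - X" using sub by (auto simp: A_def C_def)
  moreover have "edge_cut G A \<inter> edge_cut G X = edge_cut G C \<inter> edge_cut G X"
    unfolding crossA crossC ..
  moreover have "edge_cut G A - edge_cut G X \<subseteq> M" "edge_cut G C - edge_cut G X \<subseteq> M"
    by (rule subset_trans[OF inZ(1) inM], rule subset_trans[OF inZ(2) inM])
  ultimately show False by (intro sep[of A C])
qed

end

section \<open>Reductions along small edge cuts\<close>

definition cubic3 :: "('v, 'e) mgraph \<Rightarrow> bool" where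
  "cubic3 G \<longleftrightarrow> wf_mgraph G \<and> regular 3 G \<and> edge_connected 3 G"

lemma cubic3D:
  assumes "cubic3 G"
  shows "wf_mgraph G" "regular 3 G" "edge_connected 3 G"
  using assms by (simp_all add: cubic3_def)

text \<open>An edge of \<open>N\<close> with an end in \<open>X\<close> belongs to the cut, hence to
  \<open>M\<close> as well, and conversely. So on each side the union looks like the half given
  there.\<close>

lemma glue_halves:
  assumes G: "cubic3 G" and X: "X \<noteq> {}" "X \<subset> verts G"
    and M: "half G X M" and N: "half G (verts G - X) N"
    and eq: "M \<inter> edge_cut G X = N \<inter> edge_cut G X"
  shows "glued_matching G X (M \<union> N)"
    and "A \<subseteq> X \<Longrightarrow> (M \<union> N) \<inter> edge_cut G A = M \<inter> edge_cut G A"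
    and "A \<subseteq> verts G - X \<Longrightarrow> (M \<union> N) \<inter> edge_cut G A = N \<inter> edge_cut G A"
proof -
  note wf = cubic3D(1)[OF G]
  have endsV: "ends G f \<subseteq> verts G" if "f \<in> edges G" for f
    using wf that by (simp add: wf_mgraph_def)
  have ME: "M \<subseteq> {f \<in> edges G. ends G f \<inter> X \<noteq> {}}" and covM: "covers_once G X M"
    and wM: "\<And>A. A \<subseteq> X \<Longrightarrow> A \<noteq> {} \<Longrightarrow> 5 + card (M \<inter> edge_cut G A) \<le> 2 * card (edge_cut G A)"
    using M by (simp_all add: half_def)
  have NE: "N \<subseteq> {f \<in> edges G. ends G f \<inter> (verts G - X) \<noteq> {}}"
    and covN: "covers_once G (verts G - X) N"
    and wN: "\<And>A. A \<subseteq> verts G - X \<Longrightarrow> A \<noteq> {} \<Longrightarrow> 5 + card (N \<inter> edge_cut G A) \<le> 2 * card (edge_cut G A)"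
    using N by (simp_all add: half_def)
  have NM: "f \<in> M" if "f \<in> N" "v \<in> ends G f" "v \<in> X" for f v
  proof -
    have "f \<in> edge_cut G X" using that NE by (auto simp: edge_cut_def)
    then show ?thesis using that eq by blast
  qed
  have MN: "f \<in> N" if "f \<in> M" "v \<in> ends G f" "v \<in> verts G - X" for f v
  proof -
    have "f \<in> edge_cut G X" using that ME by (auto simp: edge_cut_def)
    then show ?thesis using that eq by blast
  qed
  have cov: "covers_once G (verts G) (M \<union> N)"
    unfolding covers_once_def
  proof
    fix v assume v: "v \<in> verts G"
    show "\<exists>!e. e \<in> M \<union> N \<and> v \<in> ends G e"
    proof (cases "v \<in> X")
      case True
      have "(e \<in> M \<union> N \<and> v \<in> ends G e) = (e \<in> M \<and> v \<in> ends G e)" for e using NM True by blast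
      then show ?thesis using covM True by (simp add: covers_once_def)
    next
      case False
      have "(e \<in> M \<union> N \<and> v \<in> ends G e) = (e \<in> N \<and> v \<in> ends G e)" for e using MN False v by blast
      then show ?thesis using covN False v by (simp add: covers_once_def)
    qed
  qed
  show inX: "(M \<union> N) \<inter> edge_cut G A = M \<inter> edge_cut G A" if "A \<subseteq> X" for A
  proof -
    have "f \<in> M" if "f \<in> N" "f \<in> edge_cut G A" for f
      using that NM \<open>A \<subseteq> X\<close> unfolding edge_cut_def by blast
    then show ?thesis by blast
  qed
  show inY: "(M \<union> N) \<inter> edge_cut G A = N \<inter> edge_cut G A" if "A \<subseteq> verts G - X" for A
  proof -
    have "f \<in> N" if "f \<in> M" "f \<in> edge_cut G A" for f
      using that MN \<open>A \<subseteq> verts G - X\<close> unfolding edge_cut_def by blast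
    then show ?thesis by blast
  qed
  have "M \<union> N \<subseteq> edges G" using ME NE by blast
  then have "perfect_matching G (M \<union> N)" using cov by (simp add: perfect_matching_iff)
  then show "glued_matching G X (M \<union> N)"
    using cubic3D[OF G] X wM wN unfolding glued_matching_def by (simp add: inX inY)
qed

text \<open>The ends outside \<open>X\<close> are left open, since a reduction redirects them to new
  vertices. The edge names are kept, so that a matching of the reduced graph can be read in
  \<open>G\<close>.\<close>

definition agrees_on :: "'v set \<Rightarrow> ('v, 'e) mgraph \<Rightarrow> ('v, 'e) mgraph \<Rightarrow> bool" where
  "agrees_on X G G' \<longleftrightarrow> X \<subseteq> verts G \<and> X \<subseteq> verts G' \<and>
     {f \<in> edges G'. ends G' f \<inter> X \<noteq> {}} = {f \<in> edges G. ends G f \<inter> X \<noteq> {}} \<and>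
     (\<forall>f\<in>edges G. ends G f \<inter> X \<noteq> {} \<longrightarrow> ends G' f \<inter> X = ends G f \<inter> X)"

lemma edge_cut_iff:
  assumes "wf_mgraph G" "f \<in> edges G"
  shows "f \<in> edge_cut G A \<longleftrightarrow> ends G f \<inter> A \<noteq> {} \<and> \<not> ends G f \<subseteq> A"
proof -
  have "ends G f \<subseteq> verts G" using assms by (simp add: wf_mgraph_def)
  then show ?thesis using assms(2) by (auto simp: edge_cut_def)
qed

lemma subset_iff_card_Int:
  assumes "card E = 2"
  shows "E \<subseteq> X \<longleftrightarrow> card (E \<inter> X) = 2"
proof -
  have "finite E" using assms by (simp add: card_ge_0_finite)
  then have "card (E \<inter> X) = card E \<Longrightarrow> E \<inter> X = E" by (intro card_subset_eq) auto
  then show ?thesis using assms by (auto simp: Int_absorb2)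
qed

text \<open>Edges have two ends in either graph, so their trace on \<open>X\<close> shows whether
  they leave \<open>X\<close>. Cuts of subsets of \<open>X\<close> depend on nothing else.\<close>

lemma agrees_cut:
  assumes wf: "wf_mgraph G" "wf_mgraph G'" and agr: "agrees_on X G G'" and A: "A \<subseteq> X"
  shows "edge_cut G' A = edge_cut G A"
proof (rule set_eqI)
  fix f
  have same: "f \<in> edges G' \<and> ends G' f \<inter> X \<noteq> {} \<longleftrightarrow> f \<in> edges G \<and> ends G f \<inter> X \<noteq> {}"
    using agr unfolding agrees_on_def by (simp add: set_eq_iff)
  show "f \<in> edge_cut G' A \<longleftrightarrow> f \<in> edge_cut G A"
  proof (cases "f \<in> edges G \<and> ends G f \<inter> X \<noteq> {}")
    case True
    then have f: "f \<in> edges G" "f \<in> edges G'" and eq: "ends G' f \<inter> X = ends G f \<inter> X"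
      using same agr by (auto simp: agrees_on_def)
    have two: "card (ends G f) = 2" "card (ends G' f) = 2"
      using wf f by (auto simp: wf_mgraph_def)
    have "ends G f \<subseteq> X \<longleftrightarrow> ends G' f \<subseteq> X"
      unfolding subset_iff_card_Int[OF two(1)] subset_iff_card_Int[OF two(2)] eq ..
    then have "ends G f \<subseteq> A \<longleftrightarrow> ends G' f \<subseteq> A" "ends G f \<inter> A \<noteq> {} \<longleftrightarrow> ends G' f \<inter> A \<noteq> {}"
      using eq A by blast+
    then show ?thesis using edge_cut_iff wf f by metis
  next
    case False
    then show ?thesis using same A unfolding edge_cut_def by blast
  qed
qed

lemma agrees_degree:
  assumes "agrees_on X G G'" "v \<in> X"
  shows "degree G' v = degree G v"
proof -
  have "{f \<in> edges G'. v \<in> ends G' f} = {f \<in> {f \<in> edges G'. ends G' f \<inter> X \<noteq> {}}. v \<in> ends G' f \<inter> X}"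
    using assms(2) by blast
  also have "\<dots> = {f \<in> {f \<in> edges G. ends G f \<inter> X \<noteq> {}}. v \<in> ends G f \<inter> X}"
    using assms(1) unfolding agrees_on_def by auto
  also have "\<dots> = {f \<in> edges G. v \<in> ends G f}" using assms(2) by blast
  finally show ?thesis by (simp add: degree_def)
qed

text \<open>Discarding the edges that do not meet \<open>X\<close> turns a good matching of a
  reduced graph into a half for \<open>G\<close>. Only the cuts of subsets of \<open>X\<close> are
  the same in both graphs, which is why \<open>half\<close> asks for the inequality on these
  alone.\<close>

lemma agrees_half:
  assumes wf: "wf_mgraph G" "wf_mgraph G'" and agr: "agrees_on X G G'" and X: "X \<subset> verts G'"
    and M: "good G' M"
  defines "N \<equiv> {f \<in> M. ends G' f \<inter> X \<noteq> {}}"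
  shows "half G X N" "A \<subseteq> X \<Longrightarrow> N \<inter> edge_cut G A = M \<inter> edge_cut G A"
proof -
  have same: "{f \<in> edges G'. ends G' f \<inter> X \<noteq> {}} = {f \<in> edges G. ends G f \<inter> X \<noteq> {}}"
    using agr by (simp add: agrees_on_def)
  have eq: "ends G' f \<inter> X = ends G f \<inter> X" if "f \<in> {f \<in> edges G. ends G f \<inter> X \<noteq> {}}" for f
    using agr that by (simp add: agrees_on_def)
  have ME: "M \<subseteq> edges G'" and cov: "\<And>v. v \<in> verts G' \<Longrightarrow> \<exists>!e. e \<in> M \<and> v \<in> ends G' e"
    and w: "\<And>A. A \<noteq> {} \<Longrightarrow> A \<subset> verts G' \<Longrightarrow> 5 + card (M \<inter> edge_cut G' A) \<le> 2 * card (edge_cut G' A)"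
    using M by (simp_all add: good_def perfect_matching_def)
  have NE: "N \<subseteq> {f \<in> edges G. ends G f \<inter> X \<noteq> {}}"
    unfolding same[symmetric] N_def using ME by blast
  show cut: "N \<inter> edge_cut G A = M \<inter> edge_cut G A" if "A \<subseteq> X" for A
  proof -
    have "edge_cut G' A \<subseteq> {f. ends G' f \<inter> X \<noteq> {}}" using that by (auto simp: edge_cut_def)
    then show ?thesis
      unfolding agrees_cut[OF wf agr that] N_def by blast
  qed
  have "covers_once G X N"
    unfolding covers_once_def
  proof
    fix v assume v: "v \<in> X"
    have "(e \<in> N \<and> v \<in> ends G e) = (e \<in> M \<and> v \<in> ends G' e)" for e
    proof (cases "e \<in> {f \<in> edges G. ends G f \<inter> X \<noteq> {}}")
      case True
      then show ?thesis using eq[OF True] same v unfolding N_def by blast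
    next
      case False
      then show ?thesis using NE same ME v by blast
    qed
    then show "\<exists>!e. e \<in> N \<and> v \<in> ends G e" using cov[of v] v X by auto
  qed
  moreover have "5 + card (N \<inter> edge_cut G A) \<le> 2 * card (edge_cut G A)" if "A \<subseteq> X" "A \<noteq> {}" for A
    unfolding cut[OF that(1)] using w[of A] agrees_cut[OF wf agr that(1)] that X by auto
  ultimately show "half G X N" using NE by (simp add: half_def)
qed

text \<open>A set and its complement have the same cut. With a new vertex of a reduced graph as the
  root, the sets left to check lie in \<open>X\<close>, apart from the second vertex of the
  gadget.\<close>

lemma edge_connected_rooted:
  assumes "y \<in> verts G" "\<And>Z. Z \<noteq> {} \<Longrightarrow> Z \<subseteq> verts G - {y} \<Longrightarrow> k \<le> card (edge_cut G Z)"
  shows "edge_connected k G"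
  unfolding edge_connected_def
proof (intro allI impI, elim conjE)
  fix Z assume Z: "Z \<noteq> {}" "Z \<subset> verts G"
  show "k \<le> card (edge_cut G Z)"
  proof (cases "y \<in> Z")
    case True
    have "k \<le> card (edge_cut G (verts G - Z))" using Z True by (intro assms(2)) auto
    then show ?thesis using Z by (simp add: edge_cut_compl)
  next
    case False
    then show ?thesis using Z by (intro assms(2)) auto
  qed
qed

text \<open>The outside of \<open>X\<close> shrinks to one vertex. This vertex \<open>y\<close> is
  recycled from the outside so that the result has the same type as \<open>G\<close>, as the
  induction hypothesis requires.\<close>

definition contract :: "('v, 'e) mgraph \<Rightarrow> 'v set \<Rightarrow> 'v \<Rightarrow> ('v, 'e) mgraph" where
  "contract G X y = \<lparr>verts = insert y X, edges = {f \<in> edges G. ends G f \<inter> X \<noteq> {}},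
     ends = (\<lambda>f. if ends G f \<subseteq> X then ends G f else insert y (ends G f \<inter> X))\<rparr>"

lemma contract_sel [simp]:
  "verts (contract G X y) = insert y X"
  "edges (contract G X y) = {f \<in> edges G. ends G f \<inter> X \<noteq> {}}"
  "ends (contract G X y) f = (if ends G f \<subseteq> X then ends G f else insert y (ends G f \<inter> X))"
  by (simp_all add: contract_def)

lemma cubic3_contract:
  assumes G: "cubic3 G" and X: "X \<noteq> {}" "X \<subset> verts G" and y: "y \<in> verts G - X"
    and three: "card (edge_cut G X) = 3"
  shows "cubic3 (contract G X y)" "agrees_on X G (contract G X y)"
    "{f \<in> edges (contract G X y). y \<in> ends (contract G X y) f} = edge_cut G X"
proof -
  let ?C = "contract G X y"
  note wf = cubic3D(1)[OF G]
  have fin: "finite X" using X wf_finite(1)[OF wf] finite_subset by blast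
  have ends: "\<exists>x\<in>X. \<exists>z. ends G f = {x, z} \<and> x \<noteq> z \<and> z \<in> verts G" if "f \<in> edges ?C" for f
  proof -
    have f: "f \<in> edges G" using that by simp
    obtain u v where uv: "u \<noteq> v" "ends G f = {u, v}" "u \<in> verts G" "v \<in> verts G"
      by (rule wf_ends[OF wf f])
    then have "u \<in> X \<or> v \<in> X" using that by auto
    then show ?thesis using uv by (metis insert_commute)
  qed
  have "ends ?C f \<subseteq> verts ?C \<and> card (ends ?C f) = 2" if "f \<in> edges ?C" for f
  proof -
    obtain x z where xz: "x \<in> X" "ends G f = {x, z}" "x \<noteq> z" using ends[OF \<open>f \<in> edges ?C\<close>] by blast
    have "y \<noteq> x" using xz(1) y by auto
    then show ?thesis using xz by (cases "z \<in> X") (auto simp: card_insert_if)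
  qed
  then have wfC: "wf_mgraph ?C" using fin wf_finite(2)[OF wf] unfolding wf_mgraph_def by simp
  show agr: "agrees_on X G ?C"
    using X(2) y by (auto simp: agrees_on_def)
  show at_y: "{f \<in> edges ?C. y \<in> ends ?C f} = edge_cut G X"
  proof (rule set_eqI)
    fix f
    have "y \<in> (if ends G f \<subseteq> X then ends G f else insert y (ends G f \<inter> X)) \<longleftrightarrow> \<not> ends G f \<subseteq> X"
      using y by auto
    then show "f \<in> {f \<in> edges ?C. y \<in> ends ?C f} \<longleftrightarrow> f \<in> edge_cut G X"
      using edge_cut_iff[OF wf, of f X] edge_cut_subset[of G X] by auto
  qed
  have "degree ?C v = 3" if "v \<in> verts ?C" for v
  proof (cases "v = y")
    case True
    then show ?thesis using at_y three by (simp add: degree_def)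
  next
    case False
    then have "v \<in> X" using that by simp
    then show ?thesis using agrees_degree[OF agr] X(2) cubic3D(2)[OF G] by (auto simp: regular_def)
  qed
  moreover have "3 \<le> card (edge_cut ?C Z)" if "Z \<noteq> {}" "Z \<subseteq> verts ?C - {y}" for Z
  proof -
    have "Z \<subseteq> X" using that y by auto
    then have "edge_cut ?C Z = edge_cut G Z" by (rule agrees_cut[OF wf wfC agr])
    then show ?thesis using cubic3D(3)[OF G] that(1) \<open>Z \<subseteq> X\<close> X(2) by (auto simp: edge_connected_def)
  qed
  then have "edge_connected 3 ?C" by (rule edge_connected_rooted[rotated]) auto
  ultimately show "cubic3 ?C" using wfC by (simp add: cubic3_def regular_def)
qed

text \<open>The complement of \<open>X\<close> is replaced by the edge \<open>h = uv\<close>; \<open>u\<close> takes the cut edges in \<open>S\<close> and \<open>v\<close> the others.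
  The names \<open>u\<close>, \<open>v\<close>, \<open>h\<close> are taken from the deleted part.\<close>

definition gadget :: "('v, 'e) mgraph \<Rightarrow> 'v set \<Rightarrow> 'v \<Rightarrow> 'v \<Rightarrow> 'e \<Rightarrow> 'e set \<Rightarrow> ('v, 'e) mgraph" where
  "gadget G X u v h S = \<lparr>verts = insert u (insert v X), edges = insert h {f \<in> edges G. ends G f \<inter> X \<noteq> {}},
     ends = (\<lambda>f. if f = h then {u, v} else if ends G f \<subseteq> X then ends G f
       else insert (if f \<in> S then u else v) (ends G f \<inter> X))\<rparr>"

lemma gadget_sel [simp]:
  "verts (gadget G X u v h S) = insert u (insert v X)"
  "edges (gadget G X u v h S) = insert h {f \<in> edges G. ends G f \<inter> X \<noteq> {}}"
  "ends (gadget G X u v h S) f = (if f = h then {u, v} else if ends G f \<subseteq> X then ends G f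
       else insert (if f \<in> S then u else v) (ends G f \<inter> X))"
  by (simp_all add: gadget_def)

text \<open>Three vertices on each side rule out the unavoidable 4-edge-cuts around the two ends of
  an edge. Nontrivial 3-edge-cuts are excluded by \<open>no3\<close>, so that the gadget graph is
  3-edge-connected.\<close>

locale four_cut =
  fixes G :: "('v, 'e) mgraph" and X :: "'v set"
  assumes G: "cubic3 G" and X: "X \<subseteq> verts G"
    and cX: "3 \<le> card X" and cY: "3 \<le> card (verts G - X)"
    and four: "card (edge_cut G X) = 4"
    and no3: "\<And>A. A \<subseteq> verts G \<Longrightarrow> card (edge_cut G A) = 3 \<Longrightarrow> card A \<le> 1 \<or> card (verts G - A) \<le> 1"
begin

abbreviation "cuts \<equiv> edge_cut G"

lemmas wf = cubic3D(1)[OF G]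
lemmas finV = wf_finite(1)[OF wf]
lemmas finE = wf_finite(2)[OF wf]
lemmas fin_cut = finite_edge_cut[OF wf]

lemma d_ge: "Z \<noteq> {} \<Longrightarrow> Z \<subset> verts G \<Longrightarrow> 3 \<le> card (cuts Z)"
  using cubic3D(3)[OF G] by (simp add: edge_connected_def)

lemma swap: "four_cut G (verts G - X)"
proof -
  have "verts G - (verts G - X) = X" using X by auto
  then show ?thesis
    using G X cX cY four no3 by unfold_locales (simp_all add: edge_cut_compl)
qed

lemma inner_compl:
  assumes A: "A \<subseteq> X"
  shows "cuts (X - A) - cuts X = cuts A - cuts X"
    "cuts (X - A) \<inter> cuts X = cuts X - cuts A"
proof -
  have mem: "(f \<in> cuts (X - A) - cuts X \<longleftrightarrow> f \<in> cuts A - cuts X) \<and>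
    (f \<in> cuts (X - A) \<inter> cuts X \<longleftrightarrow> f \<in> cuts X - cuts A)" if "f \<in> edges G" for f
  proof -
    obtain u v where uv: "u \<noteq> v" "ends G f = {u, v}" "u \<in> verts G" "v \<in> verts G"
      by (rule wf_ends[OF wf \<open>f \<in> edges G\<close>])
    have cut: "f \<in> cuts Y \<longleftrightarrow> (u \<in> Y) \<noteq> (v \<in> Y)" for Y
      using uv that by (auto simp: edge_cut_def)
    show ?thesis using A unfolding cut Diff_iff Int_iff by blast
  qed
  have eq: "S = T"
    if "S \<subseteq> cuts Y" "T \<subseteq> cuts Z" "\<And>f. f \<in> edges G \<Longrightarrow> f \<in> S \<longleftrightarrow> f \<in> T" for S T Y Z
    using that edge_cut_subset[of G Y] edge_cut_subset[of G Z] by blast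
  show "cuts (X - A) - cuts X = cuts A - cuts X"
    by (rule eq[OF Diff_subset Diff_subset mem[THEN conjunct1]])
  show "cuts (X - A) \<inter> cuts X = cuts X - cuts A"
    by (rule eq[OF Int_lower1 Diff_subset mem[THEN conjunct2]])
qed

lemma inner_cut_counts:
  assumes A: "A \<subseteq> X"
  shows "card (cuts A) = card (cuts A - cuts X) + card (cuts A \<inter> cuts X)"
    "card (cuts (X - A)) = card (cuts A - cuts X) + card (cuts (X - A) \<inter> cuts X)"
    "card (cuts A \<inter> cuts X) + card (cuts (X - A) \<inter> cuts X) = 4"
proof -
  have split: "card (cuts Z) = card (cuts Z - S) + card (cuts Z \<inter> S)" for Z S
    using card_Int_Diff[OF fin_cut] by (simp add: add.commute)
  show "card (cuts A) = card (cuts A - cuts X) + card (cuts A \<inter> cuts X)"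
    by (rule split)
  show "card (cuts (X - A)) = card (cuts A - cuts X) + card (cuts (X - A) \<inter> cuts X)"
    using split[of "X - A" "cuts X"] unfolding inner_compl(1)[OF A] .
  have "cuts X \<inter> cuts A = cuts A \<inter> cuts X" by (rule Int_commute)
  then show "card (cuts A \<inter> cuts X) + card (cuts (X - A) \<inter> cuts X) = 4"
    using split[of X "cuts A"] four unfolding inner_compl(2)[OF A] by simp
qed

text \<open>Both parts would have at most one vertex by \<open>no3\<close>, but \<open>X\<close> has
  at least three.\<close>

lemma not_both_three:
  assumes A: "A \<subseteq> X"
  shows "\<not> (card (cuts A) = 3 \<and> card (cuts (X - A)) = 3)"
proof
  assume three: "card (cuts A) = 3 \<and> card (cuts (X - A)) = 3"
  have large: "3 \<le> card (verts G - B)" if "B \<subseteq> X" for B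
  proof -
    have "card (verts G - X) \<le> card (verts G - B)"
      by (rule card_mono) (use that finV in auto)
    then show ?thesis using cY by linarith
  qed
  have "card A \<le> 1" using no3[of A] three A X large[of A] by auto
  moreover have "card (X - A) \<le> 1" using no3[of "X - A"] three A X large[of "X - A"] by auto
  moreover have "card X = card A + card (X - A)"
    using A X finV finite_subset by (metis card_Diff_subset card_mono le_add_diff_inverse)
  ultimately show False using cX by simp
qed

text \<open>Both parts have cuts of at least three edges and share the four edges leaving
  \<open>X\<close>. A single edge between them would leave both with exactly three.\<close>

lemma two_inner:
  assumes A: "A \<subseteq> X" "A \<noteq> {}" "A \<noteq> X"
  shows "2 \<le> card (cuts A - cuts X)"
proof -
  have "3 \<le> card (cuts A)" "3 \<le> card (cuts (X - A))"
    using A X by (auto intro!: d_ge)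
  then show ?thesis using inner_cut_counts[OF A(1)] not_both_three[OF A(1)] by linarith
qed

end

lemma goodD:
  "good G M \<Longrightarrow> Z \<noteq> {} \<Longrightarrow> Z \<subset> verts G \<Longrightarrow>
    5 + card (M \<inter> edge_cut G Z) \<le> 2 * card (edge_cut G Z)"
  by (simp add: good_def)

abbreviation good_below :: "('v, 'e) mgraph \<Rightarrow> bool" where
  "good_below G \<equiv> \<forall>G' :: ('v, 'e) mgraph. cubic3 G' \<and> card (verts G') < card (verts G) \<longrightarrow>
    (\<forall>f\<in>edges G'. \<exists>M. good G' M \<and> f \<in> M)"

text \<open>The side that \<open>e\<close> meets fixes the cut edge \<open>f\<close> of the
  matching; the induction hypothesis for the other side is then asked for a matching through
  \<open>f\<close>. With one matching edge the doubled cut has \<open>2 * 3 - 1 = 5\<close> edges,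
  which is tight.\<close>

lemma three_cut_step:
  fixes G :: "('v, 'e) mgraph"
  assumes G: "cubic3 G" and X: "X \<noteq> {}" "X \<subset> verts G" and three: "card (edge_cut G X) = 3"
    and big: "2 \<le> card X" "2 \<le> card (verts G - X)"
    and IH: "good_below G"
    and e: "e \<in> edges G" "ends G e \<inter> X \<noteq> {}"
  shows "\<exists>M. good G M \<and> e \<in> M"
proof -
  note wf = cubic3D(1)[OF G]
  let ?Y = "verts G - X"
  have Y: "?Y \<noteq> {}" "?Y \<subset> verts G" using X by auto
  have cutY: "edge_cut G ?Y = edge_cut G X" using X by (intro edge_cut_compl) auto
  have step: "\<exists>N. half G W N \<and> f \<in> N \<and> card (N \<inter> edge_cut G W) = 1"
    if W: "W \<noteq> {}" "W \<subset> verts G" "card (edge_cut G W) = 3" "2 \<le> card (verts G - W)"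
      and f: "f \<in> edges G" "ends G f \<inter> W \<noteq> {}" for W f
  proof -
    obtain y where y: "y \<in> verts G - W" using W(2) by blast
    let ?C = "contract G W y"
    note C = cubic3_contract[OF G W(1,2) y W(3)]
    have finW: "finite W" using W(2) wf_finite(1)[OF wf] finite_subset by blast
    have "card (verts ?C) = card W + 1" using y finW by simp
    also have "\<dots> < card W + card (verts G - W)" using W(4) by simp
    also have "\<dots> = card (verts G)"
      using W(2) wf_finite(1)[OF wf] finW by (simp add: card_Diff_subset card_mono psubset_imp_subset)
    finally have "card (verts ?C) < card (verts G)" .
    moreover have "f \<in> edges ?C" using f by simp
    ultimately obtain M where M: "good ?C M" "f \<in> M" using IH C(1) by blast
    have sub: "W \<subset> verts ?C" using y by auto
    note h = agrees_half[OF wf cubic3D(1)[OF C(1)] C(2) sub M(1)]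
    have pm: "M \<subseteq> edges ?C" "covers_once ?C (verts ?C) M"
      using M(1) by (simp_all add: good_def perfect_matching_iff)
    have "M \<inter> edge_cut G W = {f \<in> M. y \<in> ends ?C f}"
      unfolding C(3)[symmetric] using pm(1) by blast
    then have one: "card (M \<inter> edge_cut G W) = 1" using covers_once_card[OF pm(2), of y] by simp
    have "f \<in> edges ?C" "ends ?C f \<inter> W \<noteq> {}"
      using f C(2) unfolding agrees_on_def by auto
    then show ?thesis
      using h(1) h(2)[OF subset_refl] one M(2) by (intro exI[of _ "{f \<in> M. ends ?C f \<inter> W \<noteq> {}}"]) simp
  qed
  obtain M where M: "half G X M" "e \<in> M" "card (M \<inter> edge_cut G X) = 1"
    using step[OF X three big(2) e] by blast
  obtain f where f: "M \<inter> edge_cut G X = {f}" using M(3) by (metis card_1_singletonE)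
  then have "f \<in> edges G" "ends G f \<inter> ?Y \<noteq> {}" by (auto simp: edge_cut_def)
  moreover have "verts G - ?Y = X" using X by auto
  ultimately obtain N where N: "half G ?Y N" "f \<in> N" "card (N \<inter> edge_cut G ?Y) = 1"
    using step[OF Y, of f] three big(1) cutY by auto
  have "f \<in> N \<inter> edge_cut G X" using N(2) f by blast
  then have eq: "M \<inter> edge_cut G X = N \<inter> edge_cut G X"
    using N(3) unfolding f cutY by (metis card_1_singletonE singletonD)
  interpret glued_matching G X "M \<union> N" by (rule glue_halves[OF G X M(1) N(1) eq])
  have "\<mu> X = 1" using glue_halves(2)[OF G X M(1) N(1) eq subset_refl] M(3) by simp
  then have "good G (M \<union> N)" using three by (intro good_if_tight) simp
  then show ?thesis using M(2) by blast
qed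

context four_cut
begin

lemma X_proper: "X \<noteq> {}" "X \<subset> verts G"
  using cX cY X by auto

text \<open>Each of \<open>u\<close> and \<open>v\<close> gets two cut edges and \<open>h\<close>.
  The critical sets consist of \<open>u\<close> and a proper non-empty part of \<open>X\<close>:
  their cut contains \<open>h\<close> and the two edges inside \<open>X\<close> from
  \<open>two_inner\<close>.\<close>

lemma gadget_graph:
  assumes S: "S \<subseteq> cuts X" "card S = 2"
  obtains u v h where "u \<in> verts G - X" "v \<in> verts G - X" "u \<noteq> v" "h \<in> edges G" "ends G h \<inter> X = {}"
    "cubic3 (gadget G X u v h S)" "agrees_on X G (gadget G X u v h S)"
    "card (verts (gadget G X u v h S)) < card (verts G)"
    "{f \<in> edges (gadget G X u v h S). u \<in> ends (gadget G X u v h S) f} = insert h S"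
    "{f \<in> edges (gadget G X u v h S). v \<in> ends (gadget G X u v h S) f} = insert h (cuts X - S)"
proof -
  have finX: "finite X" using X finV finite_subset by blast
  let ?Y = "verts G - X"
  obtain u v where uv: "u \<in> ?Y" "v \<in> ?Y" "u \<noteq> v"
  proof -
    have "\<not> card ?Y \<le> 1" using cY by simp
    then show thesis using that finV by (metis card_le_Suc0_iff_eq finite_Diff One_nat_def)
  qed
  \<comment> \<open>This supplies a name for the new edge: with no edge inside \<open>?Y\<close>,
    its at least three vertices of degree three would send out more than four edges.\<close>
  have "{f \<in> edges G. ends G f \<subseteq> ?Y} \<noteq> {}"
  proof
    assume none: "{f \<in> edges G. ends G f \<subseteq> ?Y} = {}"
    have "3 * card ?Y = 2 * card {f \<in> edges G. ends G f \<subseteq> ?Y} + card (cuts ?Y)"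
      by (rule regular_sum[OF wf cubic3D(2)[OF G]]) auto
    then have "3 * card ?Y = 4" unfolding none using four edge_cut_compl[OF X] by simp
    then show False using cY by simp
  qed
  then obtain h where h: "h \<in> edges G" "ends G h \<inter> X = {}" by blast
  let ?H = "gadget G X u v h S"
  have "card (verts ?H) = card X + 2" using uv finX by simp
  also have "\<dots> < card X + card ?Y" using cY by simp
  also have "\<dots> = card (verts G)" using X finV finX by (simp add: card_Diff_subset card_mono)
  finally have smaller: "card (verts ?H) < card (verts G)" .
  have cut_iff: "f \<in> cuts X \<longleftrightarrow> f \<in> edges G \<and> ends G f \<inter> X \<noteq> {} \<and> \<not> ends G f \<subseteq> X" for f
    using edge_cut_iff[OF wf, of f X] edge_cut_subset[of G X] by blast
  have "ends ?H f \<subseteq> verts ?H \<and> card (ends ?H f) = 2" if f: "f \<in> edges ?H" for f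
  proof (cases "f = h")
    case False
    then have fE: "f \<in> edges G" "ends G f \<inter> X \<noteq> {}" using f by auto
    obtain a b where ab: "a \<noteq> b" "ends G f = {a, b}" "a \<in> verts G" "b \<in> verts G"
      by (rule wf_ends[OF wf fE(1)])
    define w where "w = (if f \<in> S then u else v)"
    have "ends ?H f = (if ends G f \<subseteq> X then ends G f else insert w (ends G f \<inter> X))"
      using False by (simp add: w_def)
    moreover have "w \<notin> X" "w \<in> verts ?H" using uv by (auto simp: w_def)
    ultimately show ?thesis using ab fE(2)
      by (cases "a \<in> X"; cases "b \<in> X") (auto simp: card_insert_if)
  qed (use uv in auto)
  then have wfH: "wf_mgraph ?H" using finX finE unfolding wf_mgraph_def by simp
  have agr: "agrees_on X G ?H"
    using X uv h by (auto simp: agrees_on_def)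
  have S3: "card (insert h S) = 3" "card (insert h (cuts X - S)) = 3"
  proof -
    have "h \<notin> cuts X" using h(2) cut_iff by blast
    moreover have finS: "finite S" by (rule finite_subset[OF S(1) fin_cut])
    moreover have "card (cuts X - S) = 2"
      using S four finS by (simp add: card_Diff_subset)
    moreover have "h \<notin> S" using S(1) \<open>h \<notin> cuts X\<close> by blast
    ultimately show "card (insert h S) = 3" "card (insert h (cuts X - S)) = 3"
      using S(2) fin_cut[of X] by (simp_all add: card_insert_if)
  qed
  have in_u: "u \<in> ends ?H f \<longleftrightarrow> f \<in> insert h S" and in_v: "v \<in> ends ?H f \<longleftrightarrow> f \<in> insert h (cuts X - S)"
    if "f \<in> edges ?H" for f
    using that S(1) uv cut_iff[of f] by auto
  have SH: "insert h S \<subseteq> edges ?H" "insert h (cuts X - S) \<subseteq> edges ?H"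
    using S(1) cut_iff by auto
  have at_u: "{f \<in> edges ?H. u \<in> ends ?H f} = insert h S" using in_u SH(1) by blast
  have at_v: "{f \<in> edges ?H. v \<in> ends ?H f} = insert h (cuts X - S)" using in_v SH(2) by blast
  have "degree ?H w = 3" if "w \<in> verts ?H" for w
  proof -
    consider "w = u" | "w = v" | "w \<in> X" using \<open>w \<in> verts ?H\<close> by auto
    then show ?thesis
    proof cases
      case 3
      then show ?thesis using agrees_degree[OF agr 3] X cubic3D(2)[OF G] by (auto simp: regular_def)
    qed (use at_u at_v S3 in \<open>simp_all only: degree_def\<close>)
  qed
  then have regH: "regular 3 ?H" unfolding regular_def by blast
  have fin_cutH: "finite (edge_cut ?H Z)" for Z by (rule finite_edge_cut[OF wfH])
  have "3 \<le> card (edge_cut ?H Z)" if Z: "Z \<noteq> {}" "Z \<subseteq> verts ?H - {v}" for Z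
  proof (cases "u \<in> Z")
    case False
    then have "Z \<subseteq> X" using Z by auto
    then show ?thesis
      using agrees_cut[OF wf wfH agr] d_ge[of Z] Z(1) X_proper(2) by (metis subset_psubset_trans)
  next
    case True
    define A where "A = Z \<inter> X"
    have ZA: "Z = insert u A" using Z True by (auto simp: A_def)
    have AX: "A \<subseteq> X" by (simp add: A_def)
    consider "A = {}" | "A = X" | "A \<noteq> {}" "A \<noteq> X" by blast
    then show ?thesis
    proof cases
      case 1
      have "insert h S \<subseteq> edge_cut ?H Z"
      proof
        fix f assume f: "f \<in> insert h S"
        then have "f \<in> edges ?H" "u \<in> ends ?H f" using SH(1) in_u by blast+
        moreover have "\<not> ends ?H f \<subseteq> {u}"
          using wfH \<open>f \<in> edges ?H\<close> card_mono[of "{u}" "ends ?H f"] by (auto simp: wf_mgraph_def simp del: gadget_sel)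
        ultimately show "f \<in> edge_cut ?H Z"
          unfolding ZA 1 using edge_cut_iff[OF wfH] by blast
      qed
      from card_mono[OF fin_cutH this] show ?thesis using S3 by simp
    next
      case 2
      have "insert h (cuts X - S) \<subseteq> edge_cut ?H Z"
      proof
        fix f assume f: "f \<in> insert h (cuts X - S)"
        then have fH: "f \<in> edges ?H" "v \<in> ends ?H f" using SH(2) in_v by blast+
        have "v \<notin> Z" using Z by blast
        moreover have "ends ?H f \<inter> Z \<noteq> {}"
          using f cut_iff[of f] unfolding ZA 2 by auto
        ultimately show "f \<in> edge_cut ?H Z"
          using edge_cut_iff[OF wfH fH(1)] fH(2) by blast
      qed
      from card_mono[OF fin_cutH this] show ?thesis using S3 by simp
    next
      case 3
      have "h \<notin> cuts A" using h(2) AX by (auto simp: edge_cut_def)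
      then have "3 \<le> card (insert h (cuts A - cuts X))"
        using two_inner[OF AX 3] fin_cut by (simp add: card_insert_if)
      also have "insert h (cuts A - cuts X) \<subseteq> edge_cut ?H Z"
      proof
        fix f assume f: "f \<in> insert h (cuts A - cuts X)"
        show "f \<in> edge_cut ?H Z"
        proof (cases "f = h")
          case True
          then show ?thesis using edge_cut_iff[OF wfH, of h Z] Z \<open>u \<in> Z\<close> by auto
        next
          case False
          then have fA: "f \<in> cuts A" "f \<notin> cuts X" using f by auto
          then have fG: "f \<in> edges G" "ends G f \<inter> A \<noteq> {}" "\<not> ends G f \<subseteq> A"
            using edge_cut_iff[OF wf, of f A] edge_cut_subset[of G A] by blast+
          then have "ends G f \<subseteq> X" using fA(2) cut_iff[of f] AX by blast
          then show ?thesis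
            using edge_cut_iff[OF wfH, of f Z] fG AX False uv unfolding ZA by auto
        qed
      qed
      then have "card (insert h (cuts A - cuts X)) \<le> card (edge_cut ?H Z)"
        by (rule card_mono[OF fin_cutH])
      finally show ?thesis .
    qed
  qed
  then have "edge_connected 3 ?H" by (rule edge_connected_rooted[rotated]) auto
  then have "cubic3 ?H" using wfH regH by (simp add: cubic3_def)
  then show thesis using that[OF uv h _ agr smaller at_u at_v] by blast
qed

lemma unique_in_star:
  assumes M: "good H M" and w: "w \<in> verts H" and star: "{f \<in> edges H. w \<in> ends H f} = T"
  shows "\<exists>f. M \<inter> T = {f}"
proof -
  have "M \<subseteq> edges H" "covers_once H (verts H) M"
    using M by (simp_all add: good_def perfect_matching_iff)
  then have "card {f \<in> M. w \<in> ends H f} = 1" and "{f \<in> M. w \<in> ends H f} = M \<inter> T"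
    using covers_once_card[OF _ w] star by blast+
  then show ?thesis by (metis card_1_singletonE)
qed

lemma cross_iff:
  assumes "A \<subseteq> X" "f \<in> cuts X"
  shows "f \<in> cuts A \<longleftrightarrow> ends G f \<inter> A \<noteq> {}"
proof -
  have f: "f \<in> edges G" using assms(2) by (simp add: edge_cut_def)
  have "\<not> ends G f \<subseteq> A" using assms unfolding edge_cut_iff[OF wf f] by blast
  then show ?thesis unfolding edge_cut_iff[OF wf f] by simp
qed

text \<open>\<open>S\<close> and \<open>T\<close> stand for the cut edges at the two gadget
  vertices, each of which is covered once. Either \<open>h\<close> covers both and no cut edge is
  used, or each has a cut edge of its own.\<close>

lemma two_stars:
  assumes a: "M \<inter> insert h S = {a}" and b: "M \<inter> insert h T = {b}" and h: "h \<notin> S" "h \<notin> T"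
  shows "h \<in> M \<Longrightarrow> M \<inter> (S \<union> T) = {}"
    and "h \<notin> M \<Longrightarrow> a \<in> S \<and> b \<in> T \<and> M \<inter> (S \<union> T) = {a, b}"
proof -
  have aM: "f \<in> M \<Longrightarrow> f \<in> insert h S \<Longrightarrow> f = a" and bM: "f \<in> M \<Longrightarrow> f \<in> insert h T \<Longrightarrow> f = b" for f
    using a b by (metis IntI singletonD)+
  have ab: "a \<in> M" "a \<in> insert h S" "b \<in> M" "b \<in> insert h T" using a b by (metis IntD1 IntD2 singletonI)+
  show "M \<inter> (S \<union> T) = {}" if "h \<in> M"
  proof (rule equals0I)
    fix f assume f: "f \<in> M \<inter> (S \<union> T)"
    have ha: "a = h" and hb: "b = h" using aM[OF that insertI1] bM[OF that insertI1] by simp_all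
    have "f \<in> M" "f \<in> insert h S \<or> f \<in> insert h T" using f by blast+
    then have "f = h" using aM[of f] bM[of f] unfolding ha hb by (elim disjE)
    then show False using f h by simp
  qed
  show "a \<in> S \<and> b \<in> T \<and> M \<inter> (S \<union> T) = {a, b}" if "h \<notin> M"
  proof -
    have ST: "a \<in> S" "b \<in> T" using ab that by (metis insertE)+
    moreover have "f \<in> {a, b}" if "f \<in> M" "f \<in> S \<or> f \<in> T" for f
      using that(2) aM[OF that(1) insertI2] bM[OF that(1) insertI2] by (elim disjE) simp_all
    then have "M \<inter> (S \<union> T) \<subseteq> {a, b}" by blast
    moreover have "{a, b} \<subseteq> M \<inter> (S \<union> T)" using ab ST by simp
    ultimately show ?thesis by simp
  qed
qed

text \<open>The choice of \<open>S\<close> controls which pairs of cut edges can occur: a pair that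
  is used has one edge at \<open>u\<close>, hence in \<open>S\<close>, and one at
  \<open>v\<close>.\<close>

lemma half_through:
  assumes IH: "good_below G"
    and S: "S \<subseteq> cuts X" "card S = 2" and e: "e \<in> edges G" "ends G e \<inter> X \<noteq> {}"
  shows "\<exists>N. half G X N \<and> e \<in> N \<and>
    (N \<inter> cuts X = {} \<or> (\<exists>a\<in>S. \<exists>b\<in>cuts X - S. N \<inter> cuts X = {a, b}))"
proof -
  obtain u v h where uvh: "u \<in> verts G - X" "v \<in> verts G - X" "u \<noteq> v" "h \<in> edges G" "ends G h \<inter> X = {}"
    and H: "cubic3 (gadget G X u v h S)" "agrees_on X G (gadget G X u v h S)"
    "card (verts (gadget G X u v h S)) < card (verts G)"
    and at: "{f \<in> edges (gadget G X u v h S). u \<in> ends (gadget G X u v h S) f} = insert h S"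
    "{f \<in> edges (gadget G X u v h S). v \<in> ends (gadget G X u v h S) f} = insert h (cuts X - S)"
    by (rule gadget_graph[OF S])
  let ?H = "gadget G X u v h S"
  have eH: "e \<in> edges ?H" using e by simp
  obtain M where M: "good ?H M" "e \<in> M" using IH H(1,3) eH by blast
  have sub: "X \<subset> verts ?H" using uvh by auto
  note h = agrees_half[OF wf cubic3D(1)[OF H(1)] H(2) sub M(1)]
  let ?N = "{f \<in> M. ends ?H f \<inter> X \<noteq> {}}"
  have cut: "?N \<inter> cuts X = M \<inter> cuts X" by (rule h(2)) simp
  have "ends ?H e \<inter> X \<noteq> {}" using H(2) e by (simp add: agrees_on_def)
  then have eN: "e \<in> ?N" using M(2) by blast
  obtain a where a: "M \<inter> insert h S = {a}" using unique_in_star[OF M(1) _ at(1)] by auto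
  obtain b where b: "M \<inter> insert h (cuts X - S) = {b}" using unique_in_star[OF M(1) _ at(2)] by auto
  have hcut: "h \<notin> cuts X" using uvh(5) by (auto simp: edge_cut_def)
  have SK: "S \<union> (cuts X - S) = cuts X" "h \<notin> S" "h \<notin> cuts X - S"
    using S(1) hcut by blast+
  note stars = two_stars[OF a b SK(2,3), unfolded SK(1)]
  show ?thesis
  proof (cases "h \<in> M")
    case True
    then have "M \<inter> cuts X = {}" using stars(1) by simp
    then show ?thesis using h(1) eN cut by blast
  next
    case False
    then have "a \<in> S" "b \<in> cuts X - S" "M \<inter> cuts X = {a, b}" using stars(2) by simp_all
    then show ?thesis using h(1) eN cut by blast
  qed
qed

text \<open>Prescribing \<open>h\<close> keeps the cut edges out of the matching. If a set
  \<open>C\<close> that picks the pair \<open>S\<close> had both its inner boundary edges in the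
  matching, then \<open>C\<close> and \<open>u\<close> together would have a cut in the gadget graph
  consisting of these two edges and \<open>h\<close>, all matched, which is impossible for a good
  matching.\<close>

lemma half_avoiding:
  assumes IH: "good_below G"
    and S: "S \<subseteq> cuts X" "card S = 2"
  shows "\<exists>N. half G X N \<and> N \<inter> cuts X = {} \<and> (\<forall>C. C \<subseteq> X \<longrightarrow> cuts C \<inter> cuts X = S \<longrightarrow>
    card (cuts C - cuts X) = 2 \<longrightarrow> \<not> cuts C - cuts X \<subseteq> N)"
proof -
  obtain u v h where uvh: "u \<in> verts G - X" "v \<in> verts G - X" "u \<noteq> v" "h \<in> edges G" "ends G h \<inter> X = {}"
    and H: "cubic3 (gadget G X u v h S)" "agrees_on X G (gadget G X u v h S)"
    "card (verts (gadget G X u v h S)) < card (verts G)"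
    and at: "{f \<in> edges (gadget G X u v h S). u \<in> ends (gadget G X u v h S) f} = insert h S"
    "{f \<in> edges (gadget G X u v h S). v \<in> ends (gadget G X u v h S) f} = insert h (cuts X - S)"
    by (rule gadget_graph[OF S])
  let ?H = "gadget G X u v h S"
  note wfH = cubic3D(1)[OF H(1)]
  have hH: "h \<in> edges ?H" by simp
  obtain M where M: "good ?H M" "h \<in> M" using IH H(1,3) hH by blast
  have sub: "X \<subset> verts ?H" using uvh by auto
  note half = agrees_half[OF wf wfH H(2) sub M(1)]
  let ?N = "{f \<in> M. ends ?H f \<inter> X \<noteq> {}}"
  have cut: "?N \<inter> cuts X = M \<inter> cuts X" by (rule half(2)) simp
  obtain a where a: "M \<inter> insert h S = {a}" using unique_in_star[OF M(1) _ at(1)] by auto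
  obtain b where b: "M \<inter> insert h (cuts X - S) = {b}" using unique_in_star[OF M(1) _ at(2)] by auto
  have hcut: "h \<notin> cuts Y" if "Y \<subseteq> X" for Y using uvh(5) that by (auto simp: edge_cut_def)
  have SK: "S \<union> (cuts X - S) = cuts X" "h \<notin> S" "h \<notin> cuts X - S"
    using S(1) hcut[OF subset_refl] by blast+
  have none: "?N \<inter> cuts X = {}"
    unfolding cut by (rule two_stars(1)[OF a b SK(2,3) M(2), unfolded SK(1)])
  have "\<not> cuts C - cuts X \<subseteq> ?N"
    if C: "C \<subseteq> X" "cuts C \<inter> cuts X = S" "card (cuts C - cuts X) = 2" for C
  proof
    assume inN: "cuts C - cuts X \<subseteq> ?N"
    let ?Z = "insert u C"
    have mem: "f \<in> edge_cut ?H ?Z \<longleftrightarrow> f \<in> cuts C - cuts X"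
      if f: "f \<in> edges ?H" "f \<noteq> h" for f
    proof -
      have fG: "f \<in> edges G" "ends G f \<inter> X \<noteq> {}" using f by auto
      obtain x y where xy: "x \<noteq> y" "ends G f = {x, y}" "x \<in> X" "y \<in> verts G"
      proof -
        obtain x y where "x \<noteq> y" "ends G f = {x, y}" "x \<in> verts G" "y \<in> verts G"
          by (rule wf_ends[OF wf fG(1)])
        then show thesis using that[of x y] that[of y x] fG(2) by auto
      qed
      note iffH = edge_cut_iff[OF wfH f(1), of ?Z]
      note iffG = edge_cut_iff[OF wf fG(1)]
      have "f \<in> cuts X \<longleftrightarrow> y \<notin> X" using iffG[of X] xy by auto
      moreover have "f \<in> S \<longleftrightarrow> f \<in> cuts X \<and> x \<in> C"
        using C(2) cross_iff[OF C(1), of f] calculation xy C(1) by auto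
      ultimately show ?thesis
        using iffH iffG[of C] xy f(2) C(1) uvh(1-3) by (auto split: if_splits)
    qed
    have h_in: "h \<in> edge_cut ?H ?Z"
      using edge_cut_iff[OF wfH hH, of ?Z] uvh C(1) by auto
    have "cuts C - cuts X \<subseteq> edges ?H"
      using C(1) by (auto simp: edge_cut_def)
    then have eq: "edge_cut ?H ?Z = insert h (cuts C - cuts X)"
      using mem h_in hcut[OF C(1)] edge_cut_subset[of ?H ?Z] by blast
    have "M \<inter> edge_cut ?H ?Z = edge_cut ?H ?Z"
    proof (rule Int_absorb1)
      have "cuts C - cuts X \<subseteq> M" using inN by blast
      then show "edge_cut ?H ?Z \<subseteq> M" unfolding eq using M(2) by (rule insert_subsetI[rotated])
    qed
    moreover have "card (edge_cut ?H ?Z) = 3"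
      unfolding eq using C(3) hcut[OF C(1)] finite_edge_cut[OF wf, of C] by (simp add: card_insert_if)
    moreover have "?Z \<noteq> {}" "?Z \<subset> verts ?H" using C(1) uvh by auto
    then have "5 + card (M \<inter> edge_cut ?H ?Z) \<le> 2 * card (edge_cut ?H ?Z)"
      by (rule goodD[OF M(1)])
    ultimately show False by simp
  qed
  then show ?thesis using half(1) none by blast
qed

text \<open>The boundary of \<open>A \<inter> B\<close> inside \<open>X\<close> lies in
  \<open>N\<close>, and the rest of its boundary avoids \<open>N\<close>; by parity that rest is
  even. It consists of the common edges of the two pairs, so the pairs are equal or
  disjoint.\<close>

lemma pairing_unique:
  assumes N: "half G X N" "N \<inter> cuts X = {}"
    and A: "A \<subseteq> X" "cuts A - cuts X \<subseteq> N" "card (cuts A \<inter> cuts X) = 2"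
    and B: "B \<subseteq> X" "cuts B - cuts X \<subseteq> N" "card (cuts B \<inter> cuts X) = 2"
  shows "cuts B \<inter> cuts X = cuts A \<inter> cuts X \<or>
    cuts B \<inter> cuts X = cuts X - cuts A"
proof -
  let ?K = "cuts X" and ?Q = "A \<inter> B"
  have NE: "N \<subseteq> edges G" and cov: "covers_once G X N" using N(1) by (auto simp: half_def)
  have QV: "?Q \<subseteq> verts G" using A X by blast
  have QX: "?Q \<subseteq> X" using A by blast
  have "even (card (N \<inter> cuts ?Q)) = even (card (cuts ?Q))"
    using matching_cut_parity[OF wf NE covers_once_subset[OF cov QX] QV]
      cut_parity[OF wf cubic3D(2)[OF G] _ QV] by simp
  moreover have "cuts ?Q - ?K \<subseteq> N"
  proof
    fix f assume f: "f \<in> cuts ?Q - ?K"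
    then have fE: "f \<in> edges G" using edge_cut_subset[of G ?Q] by blast
    note iff = edge_cut_iff[OF wf fE]
    have "f \<in> cuts A - ?K \<or> f \<in> cuts B - ?K"
      using f iff[of ?Q] iff[of A] iff[of B] by blast
    then show "f \<in> N" using A(2) B(2) by blast
  qed
  then have "N \<inter> cuts ?Q = cuts ?Q - ?K" using N(2) by blast
  moreover have "card (cuts ?Q) = card (cuts ?Q - ?K) + card (cuts ?Q \<inter> ?K)"
    by (rule inner_cut_counts(1)[OF QX])
  ultimately have ev: "even (card (cuts ?Q \<inter> ?K))" by (metis even_add)
  have "f \<in> cuts ?Q \<longleftrightarrow> f \<in> cuts A \<and> f \<in> cuts B" if "f \<in> ?K" for f
  proof -
    have fE: "f \<in> edges G" using that edge_cut_subset[of G X] by blast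
    obtain x y where xy: "ends G f = {x, y}" "x \<in> X" "y \<notin> X"
    proof -
      obtain x y where "x \<noteq> y" "ends G f = {x, y}" "x \<in> verts G" "y \<in> verts G"
        by (rule wf_ends[OF wf fE])
      then show thesis using that[of x y] that[of y x] edge_cut_iff[OF wf fE, of X] \<open>f \<in> ?K\<close> by auto
    qed
    show ?thesis
      using cross_iff[OF QX that] cross_iff[OF A(1) that] cross_iff[OF B(1) that] xy A(1) B(1) by auto
  qed
  then have Q: "cuts ?Q \<inter> ?K = (cuts A \<inter> ?K) \<inter> (cuts B \<inter> ?K)" by blast
  define S T where "S = cuts A \<inter> ?K" and "T = cuts B \<inter> ?K"
  have fin: "finite S" "finite T" using fin_cut by (auto simp: S_def T_def)
  have c: "card S = 2" "card T = 2" using A(3) B(3) by (simp_all add: S_def T_def)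
  have "card (S \<inter> T) \<le> 2" using card_mono[of S "S \<inter> T"] fin c by simp
  moreover have "even (card (S \<inter> T))" using ev Q by (simp add: S_def T_def)
  ultimately have "card (S \<inter> T) = 0 \<or> card (S \<inter> T) = 2" by (auto elim!: evenE)
  then show ?thesis
  proof
    assume "card (S \<inter> T) = 2"
    then have "S \<inter> T = S" "S \<inter> T = T"
      using card_subset_eq[OF fin(1) Int_lower1] card_subset_eq[OF fin(2) Int_lower2] c by simp_all
    then show ?thesis unfolding S_def T_def by blast
  next
    assume "card (S \<inter> T) = 0"
    then have dis: "S \<inter> T = {}" using fin by simp
    have "card (?K - S) = 2" using four c fin by (simp add: card_Diff_subset S_def)
    moreover have "T \<subseteq> ?K - S" using dis by (auto simp: T_def)
    ultimately have "T = ?K - S" using c fin_cut[of X] by (intro card_subset_eq) auto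
    then show ?thesis unfolding S_def T_def by blast
  qed
qed

end

context four_cut
begin

lemma ex_pair:
  obtains S where "S \<subseteq> cuts X" "card S = 2"
proof -
  obtain S where "S \<subseteq> cuts X" "card S = 2"
    by (rule obtain_subset_with_card_n[of 2 "cuts X"]) (use four in auto)
  then show thesis by (rule that)
qed

text \<open>A bad cut of the union would split both sides of \<open>X\<close> so that the four cut edges are paired in the same way.
  By parity one side admits only one such pairing, and the gadget on the other side can be chosen to exclude it.\<close>

lemma glue_avoiding:
  assumes IH: "good_below G"
    and N: "half G X N" "N \<inter> cuts X = {}" "e \<in> N"
  shows "\<exists>M. good G M \<and> e \<in> M"
proof -
  let ?K = "cuts X" and ?Y = "verts G - X"
  interpret Y: four_cut G ?Y by (rule swap)
  have cutY: "cuts ?Y = ?K" by (rule edge_cut_compl[OF X])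
  define good_side where "good_side A \<longleftrightarrow> A \<subseteq> X \<and> cuts A - ?K \<subseteq> N \<and> card (cuts A \<inter> ?K) = 2" for A
  obtain S where S: "S \<subseteq> ?K" "card S = 2"
    and all: "\<And>A. good_side A \<Longrightarrow> cuts A \<inter> ?K = S \<or> cuts A \<inter> ?K = ?K - S"
  proof (cases "\<exists>A. good_side A")
    case True
    then obtain A where A: "good_side A" by blast
    show thesis
    proof (rule that[of "cuts A \<inter> ?K"])
      show "cuts B \<inter> ?K = cuts A \<inter> ?K \<or> cuts B \<inter> ?K = ?K - cuts A \<inter> ?K"
        if "good_side B" for B
      proof -
        have "?K - cuts A \<inter> ?K = ?K - cuts A" by blast
        then show ?thesis
          using pairing_unique[OF N(1,2), of A B] A that by (simp add: good_side_def)
      qed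
    qed (use A in \<open>auto simp: good_side_def\<close>)
  next
    case False
    \<comment> \<open>No pairing has to be excluded here, so any pair will do.\<close>
    obtain T where T: "T \<subseteq> ?K" "card T = 2" by (rule ex_pair)
    show thesis by (rule that[OF T]) (use False in blast)
  qed
  obtain N' where N': "half G ?Y N'" "N' \<inter> ?K = {}"
    and avoid: "\<And>C. C \<subseteq> ?Y \<Longrightarrow> cuts C \<inter> ?K = S \<Longrightarrow> card (cuts C - ?K) = 2 \<Longrightarrow>
      \<not> cuts C - ?K \<subseteq> N'"
    using Y.half_avoiding[unfolded cutY, OF IH S] by blast
  have eq: "N \<inter> ?K = N' \<inter> ?K" using N(2) N'(2) by simp
  note glue = glue_halves[OF G X_proper N(1) N'(1) eq]
  interpret glued_matching G X "N \<union> N'" by (rule glue(1))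
  have "good G (N \<union> N')"
  proof (rule good_if_avoided)
    show "d X = 4" by (rule four)
    show "(N \<union> N') \<inter> ?K = {}" using N(2) N'(2) by blast
    show "\<not> (d A = 3 \<and> d (X - A) = 3)" if "A \<subseteq> X" for A by (rule not_both_three[OF that])
    show "\<not> (d A = 3 \<and> d (?Y - A) = 3)" if "A \<subseteq> ?Y" for A by (rule Y.not_both_three[OF that])
    fix A C assume A: "A \<subseteq> X" and C: "C \<subseteq> ?Y" and AC: "cuts A \<inter> ?K = cuts C \<inter> ?K"
      and card: "card (cuts A \<inter> ?K) = 2" "card (cuts A - ?K) = 2" "card (cuts C - ?K) = 2"
      and sub: "cuts A - ?K \<subseteq> N \<union> N'" "cuts C - ?K \<subseteq> N \<union> N'"
    have "cuts A - ?K \<subseteq> N" "cuts C - ?K \<subseteq> N'"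
      using sub glue(2)[OF A] glue(3)[OF C] by blast+
    then have "good_side A" using A card(1) by (simp add: good_side_def)
    from all[OF this] show False
    proof
      assume "cuts A \<inter> ?K = S"
      then show False using avoid[OF C] AC card(3) \<open>cuts C - ?K \<subseteq> N'\<close> by simp
    next
      \<comment> \<open>\<open>C\<close> and \<open>?Y - C\<close> have the same boundary inside
        \<open>?Y\<close> but complementary pairs of cut edges, so excluding \<open>S\<close> also
        excludes the complementary pair.\<close>
      assume comp: "cuts A \<inter> ?K = ?K - S"
      note compl = Y.inner_compl[OF C, unfolded cutY]
      have "?K - cuts C = ?K - cuts C \<inter> ?K" by blast
      also have "\<dots> = S" unfolding AC[symmetric] comp using S(1) by blast
      finally have "cuts (?Y - C) \<inter> ?K = S" unfolding compl(2) .
      then show False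
        using avoid[of "?Y - C"] compl(1) card(3) \<open>cuts C - ?K \<subseteq> N'\<close> by simp
    qed
  qed
  then show ?thesis using N(3) by blast
qed

lemma glue_pair:
  assumes N: "half G X N" "half G (verts G - X) N'" "N \<inter> cuts X = {a, b}"
    "N' \<inter> cuts X = {a, b}" "a \<noteq> b"
  shows "good G (N \<union> N')"
proof -
  have eq: "N \<inter> cuts X = N' \<inter> cuts X" using N by simp
  note glue = glue_halves[OF G X_proper N(1,2) eq]
  interpret glued_matching G X "N \<union> N'" by (rule glue(1))
  show ?thesis
    by (rule good_if_pair[OF four]) (simp add: glue(2)[OF subset_refl] N(3,5))
qed

text \<open>If the half matchings through \<open>e\<close> all use two cut edges: on the other side, the pairs of cut edges that are
  not realised form a matching of \<open>K\<^sub>4\<close>, whereas the pairs realised with \<open>e\<close> do not lie in a perfect matching of it.\<close>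

lemma four_cut_step:
  assumes IH: "good_below G"
    and e: "e \<in> edges G" "ends G e \<inter> X \<noteq> {}"
  shows "\<exists>M. good G M \<and> e \<in> M"
proof (cases "\<exists>N. half G X N \<and> N \<inter> cuts X = {} \<and> e \<in> N")
  case True
  then show ?thesis using glue_avoiding[OF IH] by blast
next
  case False
  let ?K = "cuts X" and ?Y = "verts G - X"
  interpret Y: four_cut G ?Y by (rule swap)
  have cutY: "cuts ?Y = ?K" by (rule edge_cut_compl[OF X])
  define P where "P a b \<longleftrightarrow> (\<exists>N. half G X N \<and> e \<in> N \<and> N \<inter> ?K = {a, b})" for a b
  define Q where "Q a b \<longleftrightarrow> (\<exists>N. half G ?Y N \<and> N \<inter> ?K = {a, b})" for a b
  have Pex: "\<exists>a\<in>S. \<exists>b\<in>?K - S. P a b" if S: "S \<subseteq> ?K" "card S = 2" for S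
  proof -
    obtain N where "half G X N" "e \<in> N"
      "N \<inter> ?K = {} \<or> (\<exists>a\<in>S. \<exists>b\<in>?K - S. N \<inter> ?K = {a, b})"
      using half_through[OF IH S e] by blast
    then show ?thesis using False unfolding P_def by blast
  qed
  have Qex: "\<exists>a\<in>S. \<exists>b\<in>?K - S. Q a b \<and> c \<in> {a, b}" if S: "S \<subseteq> ?K" "card S = 2" and c: "c \<in> ?K" for S c
  proof -
    have cE: "c \<in> edges G" "ends G c \<inter> ?Y \<noteq> {}" using c by (auto simp: edge_cut_def)
    obtain N where N: "half G ?Y N" "c \<in> N"
      "N \<inter> ?K = {} \<or> (\<exists>a\<in>S. \<exists>b\<in>?K - S. N \<inter> ?K = {a, b})"
      using Y.half_through[unfolded cutY, OF IH S cE] by blast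
    have "c \<in> N \<inter> ?K" using N(2) c by blast
    then obtain a b where "a \<in> S" "b \<in> ?K - S" "N \<inter> ?K = {a, b}" using N(3) by blast
    then show ?thesis using N(1) \<open>c \<in> N \<inter> ?K\<close> unfolding Q_def by metis
  qed
  have common: ?thesis if PQ: "P a b" "Q a b" "a \<noteq> b" for a b
  proof -
    obtain N N' where "half G X N" "e \<in> N" "N \<inter> ?K = {a, b}" "half G ?Y N'" "N' \<inter> ?K = {a, b}"
      using PQ(1,2) unfolding P_def Q_def by blast
    then show ?thesis using glue_pair[of N N' a b] PQ(3) by blast
  qed
  have sym: "Q a b \<longleftrightarrow> Q b a" for a b unfolding Q_def by (simp add: insert_commute)
  obtain S where "S \<subseteq> ?K" "card S = 2" by (rule ex_pair)
  then obtain a b where ab: "a \<in> ?K" "b \<in> ?K" "a \<noteq> b" "P a b" using Pex by blast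
  \<comment> \<open>The choice \<open>S = {a, b}\<close> yields a second realised pair that shares
    exactly one edge with the first.\<close>
  then obtain c c' where c: "c \<in> {a, b}" "c' \<in> ?K - {a, b}" "P c c'"
    using Pex[of "{a, b}"] by auto
  define w where "w = (if c = a then b else a)"
  have w: "w \<in> ?K" "c \<in> ?K" "c \<noteq> w" "c' \<noteq> c" "c' \<noteq> w" "c' \<in> ?K" "{a, b} = {c, w}"
    using c ab by (auto simp: w_def)
  have "card (?K - {c, w, c'}) = 1" using w four fin_cut by (subst card_Diff_subset) auto
  then obtain z where z: "?K - {c, w, c'} = {z}" by (rule card_1_singletonE)
  then have zK: "z \<in> ?K" "z \<noteq> c" "z \<noteq> w" "z \<noteq> c'" using singletonI[of z] unfolding z[symmetric] by simp_all
  have "?K = (?K - {c, w, c'}) \<union> {c, w, c'}" using w(1,2,6) by blast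
  then have K: "?K = {c, w, c', z}" unfolding z by simp
  have zc: "{c, z} \<subseteq> ?K" "card {c, z} = 2" using zK(1,2) w(2) by simp_all
  have rest: "?K - {c, z} = {w, c'}" unfolding K using zK(2-4) w(3,4) by auto
  \<comment> \<open>Splitting the cut edges into \<open>{c, z}\<close> and \<open>{w, c'}\<close>
    forces the partner of \<open>c\<close> to be \<open>w\<close> or \<open>c'\<close>, and both
    pairs are realised on the side of \<open>e\<close>.\<close>
  obtain x y where xy: "x \<in> {c, z}" "y \<in> {w, c'}" "Q x y" "c \<in> {x, y}"
    using Qex[OF zc w(2)] unfolding rest by blast
  have "x = c" using xy w by auto
  then have "Q c w \<or> Q c c'" using xy by auto
  then show ?thesis
  proof
    assume "Q c w"
    then have "Q a b" using w(7) unfolding Q_def by simp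
    then show ?thesis using common ab by blast
  next
    assume "Q c c'"
    then show ?thesis using common[of c c'] c(3) w by simp
  qed
qed

end

section \<open>Cubic graphs without nontrivial small cuts\<close>

lemma perfect_matchingI:
  assumes "M \<subseteq> edges G" "\<And>v. v \<in> verts G \<Longrightarrow> \<exists>f\<in>M. v \<in> ends G f"
    "\<And>f g v. f \<in> M \<Longrightarrow> g \<in> M \<Longrightarrow> v \<in> ends G f \<Longrightarrow> v \<in> ends G g \<Longrightarrow> f = g"
  shows "perfect_matching G M"
  unfolding perfect_matching_def
proof (intro conjI ballI assms(1))
  fix v assume "v \<in> verts G"
  then obtain f where f: "f \<in> M" "v \<in> ends G f" using assms(2) by blast
  show "\<exists>!e. e \<in> M \<and> v \<in> ends G e"
    by (rule ex1I[of _ f]) (use f assms(3) in blast)+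
qed

locale internally_connected =
  fixes G :: "('v, 'e) mgraph"
  assumes G: "cubic3 G"
    and no3: "\<And>A. A \<subseteq> verts G \<Longrightarrow> card (edge_cut G A) = 3 \<Longrightarrow> card A \<le> 1 \<or> card (verts G - A) \<le> 1"
    and no4: "\<And>A. A \<subseteq> verts G \<Longrightarrow> card (edge_cut G A) = 4 \<Longrightarrow> card A \<le> 2 \<or> card (verts G - A) \<le> 2"
begin

abbreviation "cuts \<equiv> edge_cut G"

lemmas wf = cubic3D(1)[OF G]
lemmas reg = cubic3D(2)[OF G]
lemmas finV = wf_finite(1)[OF wf]
lemmas finE = wf_finite(2)[OF wf]

lemma d_ge: "Z \<noteq> {} \<Longrightarrow> Z \<subset> verts G \<Longrightarrow> 3 \<le> card (cuts Z)"
  using cubic3D(3)[OF G] by (simp add: edge_connected_def)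

lemma even_order: "even (card (verts G))"
proof -
  have "cuts (verts G) = {}" by (auto simp: edge_cut_def)
  then show ?thesis using cut_parity[OF wf reg _ subset_refl] by simp
qed

text \<open>A matching has at most as many edges in a cut as there are vertices on either side.
  Hence it contains at most one edge of a 3-edge-cut and at most two edges of a 4-edge-cut, since
  these have a side with so few vertices.\<close>

lemma perfect_matching_good:
  assumes M: "perfect_matching G M"
  shows "good G M"
  unfolding good_def
proof (intro conjI allI impI M)
  fix Z assume Z: "Z \<noteq> {} \<and> Z \<subset> verts G"
  have ME: "M \<subseteq> edges G" and cov: "covers_once G (verts G) M"
    using M by (auto simp: perfect_matching_iff)
  have \<mu>_le: "card (M \<inter> cuts Y) \<le> card Y" if "Y \<subseteq> verts G" for Y
    using covers_once_sum[OF wf ME covers_once_subset[OF cov that] that] by simp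
  have le: "card (M \<inter> cuts Z) \<le> card (cuts Z)"
    by (rule card_mono[OF finite_edge_cut[OF wf]]) auto
  have "card (M \<inter> cuts Z) \<le> card Z" using \<mu>_le Z by blast
  moreover have "card (M \<inter> cuts Z) \<le> card (verts G - Z)"
    using \<mu>_le[of "verts G - Z"] edge_cut_compl[of Z G] Z by auto
  moreover have "3 \<le> card (cuts Z)" using d_ge Z by blast
  moreover have "Z \<subseteq> verts G" using Z by blast
  ultimately show "5 + card (M \<inter> cuts Z) \<le> 2 * card (cuts Z)"
    using no3[of Z] no4[of Z] le
    by (cases "card (cuts Z) = 3"; cases "card (cuts Z) = 4") auto
qed

lemma few_inner_edges:
  assumes A: "A \<subset> verts G" "A \<noteq> {}" and F: "F \<subseteq> {f \<in> edges G. ends G f \<subseteq> A}"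
  shows "card (cuts A) + 2 * card F \<le> 3 * card A"
proof -
  have "card F \<le> card {f \<in> edges G. ends G f \<subseteq> A}" using finE by (intro card_mono F) auto
  then show ?thesis using regular_sum[OF wf reg, of A] A by auto
qed

text \<open>Two parallel edges leave at most two edges in the cut of their ends, against
  3-edge-connectivity unless these ends are all the vertices.\<close>

lemma simple:
  assumes f: "f \<in> edges G" "g \<in> edges G" "ends G f = ends G g" and V: "card (verts G) \<noteq> 2"
  shows "f = g"
proof (rule ccontr)
  assume ne: "f \<noteq> g"
  have two: "card (ends G f) = 2" "ends G f \<subseteq> verts G" using wf f(1) by (auto simp: wf_mgraph_def)
  then have A: "ends G f \<subset> verts G" "ends G f \<noteq> {}" using V by auto
  have "card (cuts (ends G f)) + 2 * card {f, g} \<le> 3 * card (ends G f)"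
    using f by (intro few_inner_edges[OF A]) auto
  then show False using d_ge[OF A(2,1)] two ne by simp
qed

text \<open>The cut of a triangle would have \<open>3 * 3 - 2 * 3 = 3\<close> edges, with at least
  five vertices outside.\<close>

lemma no_triangle:
  assumes V: "8 \<le> card (verts G)" and f: "f \<in> edges G" "g \<in> edges G" "h \<in> edges G"
    "ends G f = {x, y}" "ends G g = {x, z}" "ends G h = {y, z}" and ne: "x \<noteq> y" "x \<noteq> z" "y \<noteq> z"
  shows False
proof -
  have sub: "{x, y, z} \<subseteq> verts G" using wf f by (auto simp: wf_mgraph_def)
  have c3: "card {x, y, z} = 3" using ne by simp
  then have A: "{x, y, z} \<subset> verts G" "{x, y, z} \<noteq> {}" using sub V by auto
  have "card {f, g, h} = 3" using f ne by (auto simp: doubleton_eq_iff card_insert_if)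
  moreover have "card (cuts {x, y, z}) + 2 * card {f, g, h} \<le> 3 * card {x, y, z}"
    using f by (intro few_inner_edges[OF A]) auto
  ultimately have "card (cuts {x, y, z}) = 3" using d_ge[OF A(2,1)] c3 by linarith
  moreover have "card (verts G - {x, y, z}) = card (verts G) - 3"
    using sub c3 by (simp add: card_Diff_subset)
  ultimately show False using no3[OF sub] c3 V by linarith
qed

text \<open>At most \<open>3 * 4 - 2 * 4 = 4\<close> edges would leave the four vertices, with at
  least four vertices outside.\<close>

lemma no_square:
  assumes V: "8 \<le> card (verts G)" and f: "f \<in> edges G" "g \<in> edges G" "h \<in> edges G" "k \<in> edges G"
    "ends G f = {x, y}" "ends G g = {x, z}" "ends G h = {y, w}" "ends G k = {z, w}"
    and ne: "x \<noteq> y" "x \<noteq> z" "x \<noteq> w" "y \<noteq> z" "y \<noteq> w" "z \<noteq> w"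
  shows False
proof -
  let ?A = "{x, y, z, w}"
  have sub: "?A \<subseteq> verts G" using wf f by (auto simp: wf_mgraph_def)
  have c4: "card ?A = 4" using ne by simp
  then have A: "?A \<subset> verts G" "?A \<noteq> {}" using sub V by auto
  have "card {f, g, h, k} = 4" using f ne by (auto simp: doubleton_eq_iff card_insert_if)
  moreover have "card (cuts ?A) + 2 * card {f, g, h, k} \<le> 3 * card ?A"
    using f by (intro few_inner_edges[OF A]) auto
  ultimately have "card (cuts ?A) = 3 \<or> card (cuts ?A) = 4"
    using d_ge[OF A(2,1)] c4 by linarith
  moreover have "card (verts G - ?A) = card (verts G) - 4"
    using sub c4 by (simp add: card_Diff_subset)
  ultimately show False using no3[OF sub] no4[OF sub] c4 V by linarith
qed

text \<open>The ends of \<open>e\<close> span no other edge, so four edges leave them; the degree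
  sum of the remaining vertices gives the count.\<close>

lemma inner_edges_of_compl:
  assumes V: "card (verts G) \<noteq> 2" and e: "e \<in> edges G"
  shows "2 * card {f \<in> edges G. ends G f \<subseteq> verts G - ends G e} + 10 = 3 * card (verts G)"
proof -
  have two: "card (ends G e) = 2" "ends G e \<subseteq> verts G" using wf e by (auto simp: wf_mgraph_def)
  have "f = e" if "f \<in> edges G" "ends G f \<subseteq> ends G e" for f
  proof (rule simple[OF that(1) e _ V])
    have "card (ends G f) = 2" using wf that by (simp add: wf_mgraph_def)
    then show "ends G f = ends G e" using two that by (intro card_subset_eq) (auto simp: card_ge_0_finite)
  qed
  then have "{f \<in> edges G. ends G f \<subseteq> ends G e} = {e}" using e by blast
  then have "card (cuts (ends G e)) = 4"
    using regular_sum[OF wf reg two(2)] two(1) by simp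
  moreover have "card (verts G - ends G e) = card (verts G) - 2"
    using two finV by (simp add: card_Diff_subset finite_subset)
  moreover have "2 \<le> card (verts G)" using card_mono[OF finV two(2)] two(1) by simp
  moreover have "3 * card (verts G - ends G e) = 2 * card {f \<in> edges G. ends G f \<subseteq> verts G - ends G e} +
      card (cuts (verts G - ends G e))"
    by (rule regular_sum[OF wf reg]) simp
  ultimately show ?thesis using edge_cut_compl[OF two(2)] by simp
qed

text \<open>The order is even. For six vertices, four edges lie within the four vertices outside
  \<open>e\<close>; their four pairs of ends and the four complementary pairs cannot all differ
  among the six pairs, so two of these edges are disjoint.\<close>

lemma small_perfect_matching:
  assumes V: "card (verts G) \<le> 6" and e: "e \<in> edges G"
  shows "\<exists>M. perfect_matching G M"
proof -
  let ?R = "verts G - ends G e"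
  let ?I = "{f \<in> edges G. ends G f \<subseteq> ?R}"
  have two: "card (ends G f) = 2" "ends G f \<subseteq> verts G" "finite (ends G f)" if "f \<in> edges G" for f
    using wf that by (auto simp: wf_mgraph_def card_ge_0_finite)
  have cR: "card ?R = card (verts G) - 2"
    using two[OF e] finV by (simp add: card_Diff_subset)
  have "2 \<le> card (verts G)" using card_mono[OF finV two(2)[OF e]] two(1)[OF e] by simp
  then consider "card (verts G) = 2" | "card (verts G) = 4" | "card (verts G) = 6"
  proof -
    have "n = 2 \<or> n = 4 \<or> n = 6" if "even n" "2 \<le> n" "n \<le> 6" for n :: nat
      using that by presburger
    from this[OF even_order \<open>2 \<le> card (verts G)\<close> V] show thesis using that by blast
  qed
  then show ?thesis
  proof cases
    case 1
    then have "?R = {}" using cR finV by simp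
    then have "perfect_matching G {e}" using e by (intro perfect_matchingI) auto
    then show ?thesis by blast
  next
    case 2
    then have "card ?I = 1" using inner_edges_of_compl[OF _ e] by simp
    then obtain f where "?I = {f}" by (rule card_1_singletonE)
    then have f: "f \<in> edges G" "ends G f \<subseteq> ?R" by auto
    have "ends G f = ?R" using f two[OF f(1)] cR 2 finV by (intro card_subset_eq) auto
    then have "perfect_matching G {e, f}" using e f two[OF e] by (intro perfect_matchingI) auto
    then show ?thesis by blast
  next
    case 3
    then have cI: "card ?I = 4" using inner_edges_of_compl[OF _ e] by simp
    have cR4: "card ?R = 4" using cR 3 by simp
    have inj: "inj_on (ends G) ?I" using simple 3 by (auto intro!: inj_onI)
    let ?P = "{B. B \<subseteq> ?R \<and> card B = 2}"
    have finP: "finite ?P" using finV by (intro finite_subset[of ?P "Pow ?R"]) auto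
    have cP: "card ?P = 6" using n_subsets[of ?R 2] finV cR4 by (simp add: numeral_eq_Suc)
    have inj': "inj_on (\<lambda>f. ?R - ends G f) ?I"
    proof (rule inj_onI)
      fix f g assume f: "f \<in> ?I" "g \<in> ?I" "?R - ends G f = ?R - ends G g"
      then have "ends G f = ends G g" by blast
      then show "f = g" using inj f by (auto dest: inj_onD)
    qed
    have in1: "ends G ` ?I \<subseteq> ?P" using two by auto
    have in2: "(\<lambda>f. ?R - ends G f) ` ?I \<subseteq> ?P"
    proof (rule image_subsetI)
      fix f assume f: "f \<in> ?I"
      then have "card (?R - ends G f) = 4 - 2"
        using two[of f] cR4 by (subst card_Diff_subset) auto
      then show "?R - ends G f \<in> ?P" by auto
    qed
    have "ends G ` ?I \<inter> (\<lambda>f. ?R - ends G f) ` ?I \<noteq> {}"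
    proof
      assume disj: "ends G ` ?I \<inter> (\<lambda>f. ?R - ends G f) ` ?I = {}"
      have fin: "finite ?I" using finE by simp
      have "card (ends G ` ?I \<union> (\<lambda>f. ?R - ends G f) ` ?I) = 4 + 4"
        unfolding card_Un_disjoint[OF finite_imageI[OF fin] finite_imageI[OF fin] disj]
          card_image[OF inj] card_image[OF inj'] cI ..
      moreover have "card (ends G ` ?I \<union> (\<lambda>f. ?R - ends G f) ` ?I) \<le> 6"
        unfolding cP[symmetric] by (rule card_mono[OF finP Un_least[OF in1 in2]])
      ultimately show False by simp
    qed
    then obtain f g where fg: "f \<in> ?I" "g \<in> ?I" "ends G f = ?R - ends G g" by blast
    have "perfect_matching G {e, f, g}"
    proof (rule perfect_matchingI)
      show "{e, f, g} \<subseteq> edges G" using fg e by blast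
    qed (use fg in auto)
    then show ?thesis by blast
  qed
qed

end

section \<open>The Frink reduction\<close>

lemma card_cut_split_off:
  assumes "wf_mgraph G" "finite F"
  shows "card (edge_cut G Z) = card (edge_cut G Z - F) + (\<Sum>h\<in>F. of_bool (h \<in> edge_cut G Z))"
proof -
  have "edge_cut G Z \<inter> F = {h \<in> F. h \<in> edge_cut G Z}" by blast
  then show ?thesis
    using card_Int_Diff[OF finite_edge_cut[OF assms(1)], of Z F] card_filter_sum[OF assms(2)] by simp
qed

locale frink = internally_connected G for G :: "('v, 'e) mgraph" +
  fixes e0 fa fb fc fd :: 'e and x y a b c d :: 'v
  assumes large: "8 \<le> card (verts G)"
    and dist: "distinct [x, y, a, b, c, d]"
    and edges_in: "{e0, fa, fb, fc, fd} \<subseteq> edges G"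
    and ends_eq: "ends G e0 = {x, y}" "ends G fa = {x, a}" "ends G fb = {x, b}"
      "ends G fc = {y, c}" "ends G fd = {y, d}"
    and star_x: "{f \<in> edges G. x \<in> ends G f} = {e0, fa, fb}"
    and star_y: "{f \<in> edges G. y \<in> ends G f} = {e0, fc, fd}"
begin

text \<open>The vertices \<open>x\<close> and \<open>y\<close> are deleted, \<open>a\<close> is
  joined to \<open>c\<close> and \<open>b\<close> to \<open>d\<close>. The names \<open>fa\<close>
  and \<open>fb\<close> are kept for the two new edges, so that a matching of \<open>K\<close>
  containing \<open>fb\<close> can be read in \<open>G\<close>, where \<open>fb\<close> joins
  \<open>x\<close> to \<open>b\<close>.\<close>

definition K :: "('v, 'e) mgraph" where
  "K = \<lparr>verts = verts G - {x, y}, edges = edges G - {e0, fc, fd},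
     ends = (ends G)(fa := {a, c}, fb := {b, d})\<rparr>"

lemma K_sel [simp]:
  "verts K = verts G - {x, y}" "edges K = edges G - {e0, fc, fd}"
  "ends K = (ends G)(fa := {a, c}, fb := {b, d})"
  by (simp_all add: K_def)

lemma in_verts: "{x, y, a, b, c, d} \<subseteq> verts G"
proof -
  have "ends G f \<subseteq> verts G" if "f \<in> edges G" for f using wf that by (simp add: wf_mgraph_def)
  then show ?thesis using edges_in ends_eq by (metis insert_subset)
qed

lemma distinct_edges: "distinct [e0, fa, fb, fc, fd]"
  using ends_eq dist by (auto simp: doubleton_eq_iff)

lemma other_ends:
  assumes "f \<in> edges G" "f \<notin> {e0, fa, fb, fc, fd}"
  shows "x \<notin> ends G f" "y \<notin> ends G f"
  using assms star_x star_y by blast+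

lemma wf_K: "wf_mgraph K"
proof -
  have "ends K f \<subseteq> verts K \<and> card (ends K f) = 2" if f: "f \<in> edges K" for f
  proof (cases "f = fa \<or> f = fb")
    case True
    then show ?thesis using in_verts dist distinct_edges by auto
  next
    case False
    then have "f \<in> edges G" "f \<notin> {e0, fa, fb, fc, fd}" using f by auto
    from other_ends[OF this] show ?thesis
      using wf \<open>f \<in> edges G\<close> False by (auto simp: wf_mgraph_def)
  qed
  moreover have "a \<in> verts K" using in_verts dist by auto
  then have "verts K \<noteq> {}" by blast
  moreover have "finite (verts K)" "finite (edges K)" using finV finE by simp_all
  ultimately show ?thesis unfolding wf_mgraph_def by blast
qed

lemma degree_K:
  assumes w: "w \<in> verts K"
  shows "degree K w = 3"
proof -
  let ?D = "{f \<in> edges G. w \<in> ends G f}"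
  have cD: "card ?D = 3" using reg w by (auto simp: regular_def degree_def)
  have swap: "card (insert g (?D - {h})) = card ?D" if "h \<in> ?D" "g \<notin> ?D" for g h
  proof -
    have fin: "finite ?D" using finE by simp
    have "card (insert g (?D - {h})) = Suc (card (?D - {h}))"
      using that(2) fin by (intro card_insert_disjoint) blast+
    also have "\<dots> = card ?D" by (rule card_Suc_Diff1[OF fin that(1)])
    finally show ?thesis .
  qed
  have wxy: "w \<noteq> x" "w \<noteq> y" using w by auto
  have mem: "f \<in> edges K \<and> w \<in> ends K f \<longleftrightarrow>
      (f \<in> ?D \<and> f \<noteq> fc \<and> f \<noteq> fd) \<or> (w = c \<and> f = fa) \<or> (w = d \<and> f = fb)" for f
    using wxy edges_in ends_eq distinct_edges by auto
  consider "w = c" | "w = d" | "w \<noteq> c" "w \<noteq> d" by blast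
  then show ?thesis
  proof cases
    case 1
    have eq: "{f \<in> edges K. w \<in> ends K f} = insert fa (?D - {fc})"
      using 1 dist ends_eq unfolding mem by auto
    have "fc \<in> ?D" "fa \<notin> ?D" using 1 ends_eq edges_in dist by auto
    then show ?thesis unfolding degree_def eq using swap cD by simp
  next
    case 2
    have eq: "{f \<in> edges K. w \<in> ends K f} = insert fb (?D - {fd})"
      using 2 dist ends_eq unfolding mem by auto
    have "fd \<in> ?D" "fb \<notin> ?D" using 2 ends_eq edges_in dist by auto
    then show ?thesis unfolding degree_def eq using swap cD by simp
  next
    case 3
    have "{f \<in> edges K. w \<in> ends K f} = ?D"
      using 3 wxy ends_eq unfolding mem by auto
    then show ?thesis unfolding degree_def using cD by simp
  qed
qed

text \<open>The five edges at \<open>x\<close> and \<open>y\<close> are counted separately; the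
  remaining term is the same for every \<open>P\<close> and reappears in the cut of \<open>W\<close>
  in \<open>K\<close>.\<close>

lemma card_cut_split:
  assumes "W \<subseteq> verts K" "P \<subseteq> {x, y}"
  shows "card (cuts (W \<union> P)) = card (cuts W - {e0, fa, fb, fc, fd}) +
     (of_bool ((x \<in> P) \<noteq> (y \<in> P)) + of_bool ((x \<in> P) \<noteq> (a \<in> W)) + of_bool ((x \<in> P) \<noteq> (b \<in> W)) +
      of_bool ((y \<in> P) \<noteq> (c \<in> W)) + of_bool ((y \<in> P) \<noteq> (d \<in> W)))"
proof -
  let ?F = "{e0, fa, fb, fc, fd}" and ?Z = "W \<union> P"
  have Wxy: "x \<notin> W" "y \<notin> W" using assms(1) by auto
  have in_P: "u \<notin> P" if "u \<in> {a, b, c, d}" for u using that assms(2) dist by auto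
  have cut2: "f \<in> cuts ?Z \<longleftrightarrow> (u \<in> ?Z) \<noteq> (v \<in> ?Z)" if "f \<in> edges G" "ends G f = {u, v}" for f u v
    unfolding edge_cut_iff[OF wf that(1)] that(2) by auto
  have F: "e0 \<in> edges G" "fa \<in> edges G" "fb \<in> edges G" "fc \<in> edges G" "fd \<in> edges G"
    using edges_in by auto
  have vals: "e0 \<in> cuts ?Z \<longleftrightarrow> (x \<in> P) \<noteq> (y \<in> P)" "fa \<in> cuts ?Z \<longleftrightarrow> (x \<in> P) \<noteq> (a \<in> W)"
    "fb \<in> cuts ?Z \<longleftrightarrow> (x \<in> P) \<noteq> (b \<in> W)" "fc \<in> cuts ?Z \<longleftrightarrow> (y \<in> P) \<noteq> (c \<in> W)"
    "fd \<in> cuts ?Z \<longleftrightarrow> (y \<in> P) \<noteq> (d \<in> W)"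
    unfolding cut2[OF F(1) ends_eq(1)] cut2[OF F(2) ends_eq(2)] cut2[OF F(3) ends_eq(3)]
      cut2[OF F(4) ends_eq(4)] cut2[OF F(5) ends_eq(5)]
    using Wxy in_P by simp_all
  have "cuts ?Z - ?F = cuts W - ?F"
  proof -
    have "f \<in> cuts ?Z \<longleftrightarrow> f \<in> cuts W" if f: "f \<in> edges G" "f \<notin> ?F" for f
      unfolding edge_cut_iff[OF wf f(1)] using other_ends[OF f] assms(2) by blast
    then show ?thesis using edge_cut_subset[of G ?Z] edge_cut_subset[of G W] by blast
  qed
  moreover have "card (cuts ?Z) = card (cuts ?Z - ?F) + (\<Sum>f\<in>?F. of_bool (f \<in> cuts ?Z))"
    by (rule card_cut_split_off[OF wf]) simp
  ultimately show ?thesis using distinct_edges by (simp add: vals)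
qed

lemma card_cut_K:
  assumes W: "W \<subseteq> verts K"
  shows "card (edge_cut K W) = card (cuts W - {e0, fa, fb, fc, fd}) +
    (of_bool ((a \<in> W) \<noteq> (c \<in> W)) + of_bool ((b \<in> W) \<noteq> (d \<in> W)))"
proof -
  let ?F = "{e0, fa, fb, fc, fd}"
  have F: "fa \<in> edges K" "fb \<in> edges K" using edges_in distinct_edges by auto
  have vals: "fa \<in> edge_cut K W \<longleftrightarrow> (a \<in> W) \<noteq> (c \<in> W)" "fb \<in> edge_cut K W \<longleftrightarrow> (b \<in> W) \<noteq> (d \<in> W)"
    unfolding edge_cut_iff[OF wf_K F(1)] edge_cut_iff[OF wf_K F(2)] using distinct_edges by auto
  have "edge_cut K W - {fa, fb} = cuts W - ?F"
  proof -
    have "f \<in> edge_cut K W \<longleftrightarrow> f \<in> cuts W" if f: "f \<in> edges G" "f \<notin> ?F" for f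
    proof -
      have fK: "f \<in> edges K" "ends K f = ends G f" using f by auto
      show ?thesis unfolding edge_cut_iff[OF wf f(1)] edge_cut_iff[OF wf_K fK(1)] fK(2) ..
    qed
    moreover have "edge_cut K W \<subseteq> edges G - {e0, fc, fd}" using edge_cut_subset[of K W] by simp
    ultimately show ?thesis using edge_cut_subset[of G W] by blast
  qed
  moreover have "card (edge_cut K W) = card (edge_cut K W - {fa, fb}) + (\<Sum>f\<in>{fa, fb}. of_bool (f \<in> edge_cut K W))"
    by (rule card_cut_split_off[OF wf_K]) simp
  ultimately show ?thesis using distinct_edges by (simp add: vals)
qed

text \<open>At least four vertices lie outside \<open>W\<close>, so a smaller cut would leave only
  \<open>p\<close> and \<open>q\<close> in \<open>W\<close>, joined by an edge. That edge would
  close a 4-cycle through \<open>x\<close> and \<open>y\<close>.\<close>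

lemma five_cut:
  assumes W: "W \<subseteq> verts K" and p: "p \<in> W" "q \<in> W" "p' \<in> verts G - W" "q' \<in> verts G - W"
    and pq: "(p, q, p', q') = (a, c, b, d) \<or> (p, q, p', q') = (b, d, a, c)"
  shows "5 \<le> card (cuts W)"
proof (rule ccontr)
  assume "\<not> 5 \<le> card (cuts W)"
  have WV: "W \<subseteq> verts G" "W \<noteq> {}" "W \<subset> verts G" using W p by auto
  have out: "{x, y, p', q'} \<subseteq> verts G - W" using W p in_verts by auto
  have "card {x, y, p', q'} = 4" using dist pq by auto
  then have "4 \<le> card (verts G - W)" using card_mono[OF _ out] finV by simp
  moreover have "card (cuts W) = 3 \<or> card (cuts W) = 4"
    using d_ge[OF WV(2,3)] \<open>\<not> 5 \<le> card (cuts W)\<close> by linarith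
  ultimately have c4: "card W \<le> 2" "card (cuts W) = 4 \<or> card W \<le> 1"
    using no3[OF WV(1)] no4[OF WV(1)] by auto
  have pqW: "{p, q} \<subseteq> W" "card {p, q} = 2" using p dist pq by auto
  have "finite W" using WV(1) finV finite_subset by blast
  then have "{p, q} = W" using pqW c4(1) by (intro card_seteq) auto
  then have cW: "card W = 2" using pqW by simp
  then have "card {f \<in> edges G. ends G f \<subseteq> W} = 1"
    using regular_sum[OF wf reg WV(1)] c4(2) by simp
  then obtain f where "{f \<in> edges G. ends G f \<subseteq> W} = {f}" by (rule card_1_singletonE)
  then have f: "f \<in> edges G" "ends G f \<subseteq> W" by auto
  moreover have "card (ends G f) = 2" using wf f by (simp add: wf_mgraph_def)
  ultimately have "ends G f = W" using cW \<open>finite W\<close> by (intro card_subset_eq) auto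
  then have fe: "ends G f = {p, q}" using \<open>{p, q} = W\<close> by simp
  have F: "e0 \<in> edges G" "fa \<in> edges G" "fb \<in> edges G" "fc \<in> edges G" "fd \<in> edges G"
    using edges_in by auto
  show False
  proof (cases "(p, q, p', q') = (a, c, b, d)")
    case True
    then show False
      using no_square[OF large F(1) F(2) F(4) f(1) ends_eq(1,2,4)] fe dist by auto
  next
    case False
    then show False
      using pq no_square[OF large F(1) F(3) F(5) f(1) ends_eq(1,3,5)] fe dist by auto
  qed
qed

text \<open>A cut of \<open>K\<close> is compared with the four cuts of \<open>G\<close> obtained by
  adding a subset of \<open>{x, y}\<close> to \<open>W\<close>. This suffices unless
  \<open>W\<close> contains both ends of one new edge and neither end of the other; then
  \<open>five_cut\<close> leaves \<open>5 - 2 = 3\<close> edges.\<close>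

lemma cubic3_K: "cubic3 K"
proof -
  have "3 \<le> card (edge_cut K W)" if W: "W \<noteq> {}" "W \<subset> verts K" for W
  proof -
    let ?D = "card (cuts W - {e0, fa, fb, fc, fd})"
    have sub: "W \<subseteq> verts K" using W by blast
    have xW: "x \<notin> W" "y \<notin> W" using sub by auto
    have cut: "3 \<le> card (cuts (W \<union> P))" if P: "P \<subseteq> {x, y}" for P
    proof (rule d_ge)
      show "W \<union> P \<noteq> {}" using W by blast
      obtain w where w: "w \<in> verts K" "w \<notin> W" using W by blast
      then have "w \<in> verts G" "w \<notin> W \<union> P" using P by auto
      moreover have "W \<union> P \<subseteq> verts G" using sub P in_verts by auto
      ultimately show "W \<union> P \<subset> verts G" by blast
    qed
    have nxy: "x \<noteq> y" using dist by simp
    have c0: "3 \<le> ?D + (of_bool (a \<in> W) + of_bool (b \<in> W) + of_bool (c \<in> W) + of_bool (d \<in> W))"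
      using cut[of "{}"] unfolding card_cut_split[OF sub empty_subsetI] by simp
    have cx: "3 \<le> ?D + (1 + of_bool (a \<notin> W) + of_bool (b \<notin> W) + of_bool (c \<in> W) + of_bool (d \<in> W))"
      using cut[of "{x}"] card_cut_split[OF sub, of "{x}"] nxy by simp
    have cy: "3 \<le> ?D + (1 + of_bool (a \<in> W) + of_bool (b \<in> W) + of_bool (c \<notin> W) + of_bool (d \<notin> W))"
      using cut[of "{y}"] card_cut_split[OF sub, of "{y}"] nxy by simp
    have cxy: "3 \<le> ?D + (of_bool (a \<notin> W) + of_bool (b \<notin> W) + of_bool (c \<notin> W) + of_bool (d \<notin> W))"
      using cut[of "{x, y}"] card_cut_split[OF sub, of "{x, y}"] by simp
    have abcd: "a \<in> verts G" "b \<in> verts G" "c \<in> verts G" "d \<in> verts G" using in_verts by auto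
    have W0: "card (cuts W) = ?D + (of_bool (a \<in> W) + of_bool (b \<in> W) + of_bool (c \<in> W) + of_bool (d \<in> W))"
      using card_cut_split[OF sub empty_subsetI] by simp
    have ac: "3 \<le> ?D" if "a \<in> W" "c \<in> W" "b \<notin> W" "d \<notin> W"
      using five_cut[OF sub, of a c b d] W0 that abcd by simp
    have bd: "3 \<le> ?D" if "b \<in> W" "d \<in> W" "a \<notin> W" "c \<notin> W"
      using five_cut[OF sub, of b d a c] W0 that abcd by simp
    show ?thesis
      unfolding card_cut_K[OF sub] using c0 cx cy cxy ac bd
      by (cases "a \<in> W"; cases "b \<in> W"; cases "c \<in> W"; cases "d \<in> W") simp_all
  qed
  then show ?thesis using wf_K degree_K by (simp add: cubic3_def regular_def edge_connected_def)
qed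

lemma extend_matching:
  assumes M: "perfect_matching K M" and fa: "fa \<notin> M"
  shows "\<exists>M. perfect_matching G M"
proof -
  \<comment> \<open>If \<open>fb\<close> is used, it now covers \<open>x\<close> and
    \<open>b\<close>, and \<open>fd\<close> covers \<open>y\<close> and \<open>d\<close>; otherwise
    \<open>x\<close> and \<open>y\<close> are matched to each other. With both new edges in
    \<open>M\<close>, \<open>x\<close> would be covered twice, whence the assumption on
    \<open>fa\<close>.\<close>
  define g where "g = (if fb \<in> M then fd else e0)"
  have ME: "M \<subseteq> edges G - {e0, fc, fd}" and cov: "\<And>v. v \<in> verts K \<Longrightarrow> \<exists>!e. e \<in> M \<and> v \<in> ends K e"
    using M by (simp_all add: perfect_matching_def)
  have old: "ends K f = ends G f \<and> x \<notin> ends G f \<and> y \<notin> ends G f" if "f \<in> M" "f \<noteq> fb" for f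
  proof -
    have "f \<in> edges G" "f \<notin> {e0, fa, fb, fc, fd}" using that ME fa by auto
    then show ?thesis using other_ends[of f] by auto
  qed
  have fbK: "ends K fb = {b, d}" by simp
  have gE: "g \<in> edges G" "g \<notin> M" using edges_in ME by (auto simp: g_def)
  have "\<exists>!e. e \<in> insert g M \<and> v \<in> ends G e" if v: "v \<in> verts G" for v
  proof -
    consider "v \<in> {x, y}" | "v = d" "fb \<in> M" | "v \<in> verts K" "v \<noteq> d \<or> fb \<notin> M"
      using v by auto
    then show ?thesis
    proof cases
      case 1
      show ?thesis
      proof (cases "fb \<in> M \<and> v = x")
        case True
        show ?thesis
          by (rule ex1I[of _ fb]) (use True old ends_eq dist in \<open>auto simp: g_def\<close>)
      next
        case False
        show ?thesis
          by (rule ex1I[of _ g]) (use False 1 old ends_eq dist in \<open>auto simp: g_def\<close>)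
      qed
    next
      case 2
      have "v \<in> verts K" using 2 in_verts dist by auto
      then have uniq: "f = fb" if "f \<in> M" "v \<in> ends K f" for f
        using cov 2 that fbK by (metis insertCI)
      show ?thesis
      proof (rule ex1I[of _ g])
        show "g \<in> insert g M \<and> v \<in> ends G g" using 2 ends_eq by (simp add: g_def)
      next
        fix f assume f: "f \<in> insert g M \<and> v \<in> ends G f"
        show "f = g"
        proof (rule ccontr)
          assume "f \<noteq> g"
          then have fM: "f \<in> M" using f by simp
          have "f \<noteq> fb" using f 2 ends_eq dist by auto
          then have "v \<in> ends K f" using old[OF fM] f by simp
          then show False using uniq[OF fM] \<open>f \<noteq> fb\<close> by blast
        qed
      qed
    next
      case 3
      have vxy: "v \<noteq> x" "v \<noteq> y" using 3 by auto
      have "v \<notin> ends G g" using 3 vxy ends_eq by (auto simp: g_def)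
      moreover have "f \<in> M \<Longrightarrow> v \<in> ends G f \<longleftrightarrow> v \<in> ends K f" for f
        using old[of f] 3 vxy ends_eq(3) fbK by (cases "f = fb") auto
      ultimately have "(e \<in> insert g M \<and> v \<in> ends G e) = (e \<in> M \<and> v \<in> ends K e)" for e by blast
      then show ?thesis using cov[OF 3(1)] by simp
    qed
  qed
  moreover have "insert g M \<subseteq> edges G" using gE ME by blast
  ultimately have "perfect_matching G (insert g M)" by (simp add: perfect_matching_def)
  then show ?thesis by blast
qed

text \<open>The edge \<open>fa\<close> is kept out of the matching by prescribing another edge of
  \<open>K\<close> at \<open>a\<close>.\<close>

lemma ex_perfect_matching:
  assumes IH: "good_below G"
  shows "\<exists>M. perfect_matching G M"
proof -
  have aK: "a \<in> verts K" using in_verts dist by auto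
  define D where "D = {f \<in> edges K. a \<in> ends K f}"
  have "card D = 3" unfolding D_def using degree_K[OF aK] by (simp only: degree_def)
  moreover have "card D \<le> 1" if "D \<subseteq> {fa}" using card_mono[OF _ that] by simp
  ultimately obtain h where "h \<in> D" "h \<noteq> fa" by fastforce
  then have h: "h \<in> edges K" "a \<in> ends K h" "h \<noteq> fa" unfolding D_def by blast+
  have "card (verts K) < card (verts G)"
    using in_verts finV by (intro psubset_card_mono) auto
  then obtain M where M: "good K M" "h \<in> M" using IH cubic3_K h(1) by blast
  then have pm: "perfect_matching K M" by (simp add: good_def)
  have "fa \<notin> M"
  proof
    assume "fa \<in> M"
    moreover have "a \<in> ends K fa" using distinct_edges by simp
    ultimately have "h = fa" using pm aK h(2) M(2) unfolding perfect_matching_def by blast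
    then show False using h(3) by simp
  qed
  then show ?thesis by (rule extend_matching[OF pm])
qed

end

section \<open>Good matchings through a given edge\<close>

context internally_connected
begin

lemma ex_matching:
  assumes IH: "good_below G"
    and e: "e \<in> edges G"
  shows "\<exists>M. perfect_matching G M"
proof (cases "card (verts G) \<le> 6")
  case True
  then show ?thesis by (rule small_perfect_matching[OF _ e])
next
  case False
  have V8: "8 \<le> card (verts G)"
  proof -
    have "8 \<le> n" if "even n" "\<not> n \<le> 6" for n :: nat using that by presburger
    then show ?thesis using even_order False by blast
  qed
  then have V2: "card (verts G) \<noteq> 2" by simp
  obtain x y where xy: "x \<noteq> y" "ends G e = {x, y}" "x \<in> verts G" "y \<in> verts G"
    by (rule wf_ends[OF wf e])
  have star: "\<exists>f g p q. {h \<in> edges G. u \<in> ends G h} = {e, f, g} \<and> f \<in> edges G \<and> g \<in> edges G \<and>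
      ends G f = {u, p} \<and> ends G g = {u, q} \<and> u \<noteq> p \<and> u \<noteq> q \<and> p \<noteq> v \<and> q \<noteq> v \<and> p \<noteq> q"
    if uv: "u \<noteq> v" "ends G e = {u, v}" "u \<in> verts G" for u v
  proof -
    let ?S = "{h \<in> edges G. u \<in> ends G h}"
    have "card ?S = 3" using reg uv(3) by (simp add: regular_def degree_def)
    moreover have "e \<in> ?S" using e uv by simp
    moreover have "finite ?S" using finE by simp
    ultimately have "card (?S - {e}) = 2" by (simp add: card_Diff_singleton)
    then obtain f g where fg: "?S - {e} = {f, g}" "f \<noteq> g" by (auto simp: card_2_iff)
    then have S: "?S = {e, f, g}" using \<open>e \<in> ?S\<close> by blast
    have "f \<in> ?S - {e}" "g \<in> ?S - {e}" unfolding fg(1) by simp_all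
    then have f: "f \<in> edges G" "u \<in> ends G f" "f \<noteq> e" and g: "g \<in> edges G" "u \<in> ends G g" "g \<noteq> e"
      by blast+
    have other: "\<exists>p. ends G h = {u, p} \<and> u \<noteq> p" if h: "h \<in> edges G" "u \<in> ends G h" for h
    proof -
      obtain s t where "s \<noteq> t" "ends G h = {s, t}" by (rule wf_ends[OF wf h(1)])
      then show ?thesis using h(2) by auto
    qed
    obtain p where p: "ends G f = {u, p}" "u \<noteq> p" using other f by blast
    obtain q where q: "ends G g = {u, q}" "u \<noteq> q" using other g by blast
    have "p \<noteq> v" using simple[OF f(1) e _ V2] f(3) p uv(2) by auto
    moreover have "q \<noteq> v" using simple[OF g(1) e _ V2] g(3) q uv(2) by auto
    moreover have "p \<noteq> q" using simple[OF f(1) g(1) _ V2] fg(2) p q by auto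
    ultimately show ?thesis using S f(1) g(1) p q by blast
  qed
  obtain fa fb a b where x: "{h \<in> edges G. x \<in> ends G h} = {e, fa, fb}" "fa \<in> edges G" "fb \<in> edges G"
    "ends G fa = {x, a}" "ends G fb = {x, b}" "x \<noteq> a" "x \<noteq> b" "a \<noteq> y" "b \<noteq> y" "a \<noteq> b"
    using star[OF xy(1-3)] by metis
  have yx: "y \<noteq> x" "ends G e = {y, x}" using xy(1,2) by auto
  obtain fc fd c d where y: "{h \<in> edges G. y \<in> ends G h} = {e, fc, fd}" "fc \<in> edges G" "fd \<in> edges G"
    "ends G fc = {y, c}" "ends G fd = {y, d}" "y \<noteq> c" "y \<noteq> d" "c \<noteq> x" "d \<noteq> x" "c \<noteq> d"
    using star[OF yx xy(4)] by metis
  \<comment> \<open>A common neighbour of \<open>x\<close> and \<open>y\<close> would form a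
    triangle with \<open>e\<close>.\<close>
  have tri: "p \<noteq> q" if "f \<in> edges G" "g \<in> edges G" "ends G f = {x, p}" "ends G g = {y, q}" "x \<noteq> p" "y \<noteq> q"
    "p \<noteq> y" for f g p q
    using no_triangle[OF V8 e that(1,2) xy(2) that(3)] that xy(1) by auto
  have "a \<noteq> c" "a \<noteq> d" "b \<noteq> c" "b \<noteq> d"
    using tri[OF x(2) y(2) x(4) y(4)] tri[OF x(2) y(3) x(4) y(5)] tri[OF x(3) y(2) x(5) y(4)]
      tri[OF x(3) y(3) x(5) y(5)] x y by simp_all
  then have "distinct [x, y, a, b, c, d]" using x y xy(1) by auto
  then interpret frink G e fa fb fc fd x y a b c d
    using V8 e x y xy(2) by unfold_locales simp_all
  show ?thesis by (rule ex_perfect_matching[OF IH])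
qed

text \<open>\<open>M\<close> may miss \<open>e\<close>; it only serves to build a 5-edge-connected
  graph. The matching through a copy of \<open>e\<close> in that graph projects to a perfect
  matching of \<open>G\<close>, and here all of these are good.\<close>

lemma base_step:
  assumes m5: "m 5 \<ge> 2"
    and IH: "good_below G"
    and e: "e \<in> edges G"
  shows "\<exists>M. good G M \<and> e \<in> M"
proof -
  obtain M where M: "perfect_matching G M" using ex_matching[OF IH e] by blast
  let ?H = "doubled G M"
  have eH: "(e, False) \<in> edges ?H" using e by simp
  obtain N where N: "perfect_matching ?H N" "(e, False) \<in> N"
    by (rule disjoint_pms_through_edge[OF m5 wf_doubled[OF wf] regular_doubled[OF wf reg M]
          edge_connected_doubled[OF wf perfect_matching_good[OF M]] eH])
  then have "e \<in> fst ` N" by force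
  then show ?thesis using perfect_matching_good[OF perfect_matching_doubled[OF N(1)]] by blast
qed

end

theorem good_matching_through:
  fixes G :: "('v, 'e) mgraph"
  assumes m5: "m 5 \<ge> 2" and G: "cubic3 G" and e: "e \<in> edges G"
  shows "\<exists>M. good G M \<and> e \<in> M"
  using G e
proof (induction "card (verts G)" arbitrary: G e rule: less_induct)
  case (less G)
  have IH: "good_below G"
    using less.hyps by blast
  note wf = cubic3D(1)[OF less.prems(1)]
  have touch: "ends G e \<inter> X \<noteq> {} \<or> ends G e \<inter> (verts G - X) \<noteq> {}" for X
  proof -
    obtain x y where "ends G e = {x, y}" "x \<in> verts G" by (rule wf_ends[OF wf less.prems(2)])
    then show ?thesis by auto
  qed
  have compl: "verts G - (verts G - X) = X" if "X \<subseteq> verts G" for X using that by auto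
  show ?case
  proof (cases "\<exists>X. X \<subseteq> verts G \<and> card (edge_cut G X) = 3 \<and> 2 \<le> card X \<and> 2 \<le> card (verts G - X)")
    case True
    then obtain X where X: "X \<subseteq> verts G" "card (edge_cut G X) = 3" "2 \<le> card X" "2 \<le> card (verts G - X)"
      by blast
    have nonempty: "A \<noteq> {}" if "2 \<le> card A" for A :: "'v set" using that by auto
    note ne0 = nonempty[OF X(3)] nonempty[OF X(4)]
    have ne: "X \<noteq> {}" "X \<subset> verts G" "verts G - X \<noteq> {}" "verts G - X \<subset> verts G"
      using ne0 X(1) by blast+
    from touch[of X] show ?thesis
    proof
      assume "ends G e \<inter> X \<noteq> {}"
      then show ?thesis by (rule three_cut_step[OF less.prems(1) ne(1,2) X(2-4) IH less.prems(2)])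
    next
      assume "ends G e \<inter> (verts G - X) \<noteq> {}"
      then show ?thesis
        using X by (intro three_cut_step[OF less.prems(1) ne(3,4) _ _ _ IH less.prems(2)])
          (simp_all add: edge_cut_compl compl)
    qed
  next
    case no3: False
    \<comment> \<open>Nontrivial 3-edge-cuts are treated before 4-edge-cuts, because the
      connectivity of the gadget graph relies on their absence.\<close>
    have no3': "card A \<le> 1 \<or> card (verts G - A) \<le> 1"
      if "A \<subseteq> verts G" "card (edge_cut G A) = 3" for A
      using no3 that by (metis Suc_1 not_less_eq_eq One_nat_def)
    show ?thesis
    proof (cases "\<exists>X. X \<subseteq> verts G \<and> card (edge_cut G X) = 4 \<and> 3 \<le> card X \<and> 3 \<le> card (verts G - X)")
      case True
      then obtain X where X: "X \<subseteq> verts G" "card (edge_cut G X) = 4" "3 \<le> card X" "3 \<le> card (verts G - X)"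
        by blast
      interpret X: four_cut G X
        by (unfold_locales) (use less.prems(1) X no3' in blast)+
      interpret Y: four_cut G "verts G - X" by (rule X.swap)
      from touch[of X] show ?thesis
        using X.four_cut_step[OF IH less.prems(2)] Y.four_cut_step[OF IH less.prems(2)] by blast
    next
      case no4: False
      have "card A \<le> 2 \<or> card (verts G - A) \<le> 2"
        if "A \<subseteq> verts G" "card (edge_cut G A) = 4" for A
      proof (rule ccontr)
        assume "\<not> (card A \<le> 2 \<or> card (verts G - A) \<le> 2)"
        then have "3 \<le> card A" "3 \<le> card (verts G - A)" by simp_all
        then show False using no4 that by blast
      qed
      then interpret internally_connected G
        using less.prems(1) no3' by unfold_locales
      show ?thesis by (rule base_step[OF m5 IH less.prems(2)])
    qed
  qed
qed

section \<open>Triples of perfect matchings in the 3-edge-connected case\<close>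

definition triple :: "('v, 'e) mgraph \<Rightarrow> (nat \<Rightarrow> 'e set) \<Rightarrow> bool" where
  "triple G F \<longleftrightarrow> (\<forall>k<3. perfect_matching G (F k)) \<and> (\<forall>f\<in>edges G. \<exists>k<3. f \<notin> F k)"

lemma triple_arrange:
  assumes pm: "perfect_matching G L" "perfect_matching G M" "perfect_matching G N"
    and disj: "L \<inter> M \<inter> N = {}" and jk: "j < 3" "k < 3" "j \<noteq> k"
  shows "triple G (\<lambda>l. if l = j then L else if l = k then M else N)"
proof -
  have "\<exists>l<3. l \<noteq> j \<and> l \<noteq> k" using jk by presburger
  then obtain l where l: "l < 3" "l \<noteq> j" "l \<noteq> k" by blast
  have "\<exists>k'<3. f \<notin> (if k' = j then L else if k' = k then M else N)" for f
  proof -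
    have "f \<notin> L \<or> f \<notin> M \<or> f \<notin> N" using disj by blast
    then show ?thesis using jk l by metis
  qed
  then show ?thesis using pm by (simp add: triple_def)
qed

text \<open>The matchings are indexed and \<open>K\<close> is a set of indices, not a number, since
  at a 2-edge-cut the triples of both sides must agree index by index. For empty \<open>K\<close>,
  \<open>M\<close> goes through another edge at \<open>v\<close> and both copies of \<open>e\<close>
  are avoided; for one index, \<open>M\<close> contains \<open>e\<close> and the single copy of
  \<open>e\<close> is avoided; for two, both \<open>M\<close> and the projection of
  \<open>N1\<close> contain \<open>e\<close>.\<close>

lemma triples_cubic3:
  fixes G :: "('v, 'e) mgraph"
  assumes m5: "m 5 \<ge> 2" and G: "cubic3 G" and e: "e \<in> edges G" and K: "K \<subset> {..<3}"
  shows "\<exists>F. triple G F \<and> {k. k < 3 \<and> e \<in> F k} = K"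
proof -
  note wf = cubic3D(1)[OF G] and reg = cubic3D(2)[OF G]
  obtain v where v: "v \<in> verts G" "v \<in> ends G e" using wf_ends[OF wf e] by blast
  \<comment> \<open>An edge of \<open>M\<close> has only one copy, which cannot lie in two disjoint
    matchings.\<close>
  have meet: "M \<inter> fst ` N1 \<inter> fst ` N2 = {}"
    if N: "perfect_matching (doubled G M) N1" "perfect_matching (doubled G M) N2" "N1 \<inter> N2 = {}"
    for M :: "'e set" and N1 N2
  proof (rule equals0I)
    fix f assume f: "f \<in> M \<inter> fst ` N1 \<inter> fst ` N2"
    then obtain s t where st: "(f, s) \<in> N1" "(f, t) \<in> N2" by auto
    then have "(f, s) \<in> edges (doubled G M)" "(f, t) \<in> edges (doubled G M)"
      using N(1,2) unfolding perfect_matching_def by blast+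
    then have "s = t" using f by auto
    then show False using st N(3) by blast
  qed
  have dbl: "wf_mgraph (doubled G M)" "regular 5 (doubled G M)" "edge_connected 5 (doubled G M)"
    "perfect_matching G M" if "good G M" for M
    using that wf_doubled[OF wf] regular_doubled[OF wf reg] edge_connected_doubled[OF wf]
    by (auto simp: good_def)
  have "card K < 3" using psubset_card_mono[OF _ K] by simp
  then consider "K = {}" | k where "K = {k}" | j k where "K = {j, k}" "j \<noteq> k"
    using K finite_subset[of K "{..<3}"]
    by (metis card_0_eq card_1_singletonE card_2_iff finite_lessThan less_2_cases less_Suc_eq numeral_3_eq_3
        One_nat_def numeral_2_eq_2 psubset_imp_subset)
  then show ?thesis
  proof cases
    case 1
    let ?S = "{f \<in> edges G. v \<in> ends G f}"
    have "card ?S = 3" using reg v by (simp add: regular_def degree_def)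
    moreover have "card ?S \<le> 1" if "?S \<subseteq> {e}" using card_mono[OF _ that] by simp
    ultimately obtain f where f: "f \<in> ?S" "f \<noteq> e" by fastforce
    obtain M where M: "good G M" "f \<in> M" using good_matching_through[OF m5 G] f by blast
    note D = dbl[OF M(1)]
    have eM: "e \<notin> M" using D(4) f v M(2) unfolding perfect_matching_def by blast
    have S: "{(e, False), (e, True)} \<subseteq> {f \<in> edges (doubled G M). v \<in> ends (doubled G M) f}"
      using e eM v by simp
    have vD: "v \<in> verts (doubled G M)" using v by simp
    obtain N1 N2 where N: "perfect_matching (doubled G M) N1" "perfect_matching (doubled G M) N2"
      "N1 \<inter> N2 = {}" "{(e, False), (e, True)} \<inter> N1 = {}" "{(e, False), (e, True)} \<inter> N2 = {}"
      by (rule disjoint_pms_avoiding[OF m5 D(1-3) vD S]) simp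
    have "(e, s) \<notin> N1 \<and> (e, s) \<notin> N2" for s using N(4,5) by (cases s) auto
    then have "e \<notin> fst ` N1" "e \<notin> fst ` N2" by force+
    then show ?thesis
      using triple_arrange[OF D(4) perfect_matching_doubled[OF N(1)] perfect_matching_doubled[OF N(2)]
          meet[OF N(1-3)], of 0 1] eM 1
      by (intro exI[of _ "\<lambda>l. if l = 0 then M else if l = 1 then fst ` N1 else fst ` N2"]) auto
  next
    case (2 k)
    then have "\<exists>j<3. j \<noteq> k" "k < 3" using K by (presburger, auto)
    then obtain j where jk: "k < 3" "j < 3" "k \<noteq> j" by blast
    obtain M where M: "good G M" "e \<in> M" using good_matching_through[OF m5 G e] by blast
    note D = dbl[OF M(1)]
    have S: "{(e, False)} \<subseteq> {f \<in> edges (doubled G M). v \<in> ends (doubled G M) f}" using e v by simp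
    have vD: "v \<in> verts (doubled G M)" using v by simp
    obtain N1 N2 where N: "perfect_matching (doubled G M) N1" "perfect_matching (doubled G M) N2"
      "N1 \<inter> N2 = {}" "{(e, False)} \<inter> N1 = {}" "{(e, False)} \<inter> N2 = {}"
      by (rule disjoint_pms_avoiding[OF m5 D(1-3) vD S]) simp
    have "(e, s) \<notin> N1 \<and> (e, s) \<notin> N2" for s
    proof (cases s)
      case True
      then have "(e, s) \<notin> edges (doubled G M)" using M(2) by simp
      then show ?thesis using N(1,2) unfolding perfect_matching_def by blast
    qed (use N(4,5) in auto)
    then have "e \<notin> fst ` N1" "e \<notin> fst ` N2" by force+
    then show ?thesis
      using triple_arrange[OF D(4) perfect_matching_doubled[OF N(1)] perfect_matching_doubled[OF N(2)]
          meet[OF N(1-3)] jk] M(2) 2 jk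
      by (intro exI[of _ "\<lambda>l. if l = k then M else if l = j then fst ` N1 else fst ` N2"]) auto
  next
    case (3 j k)
    then have jk: "j < 3" "k < 3" "j \<noteq> k" using K by auto
    obtain M where M: "good G M" "e \<in> M" using good_matching_through[OF m5 G e] by blast
    note D = dbl[OF M(1)]
    have eD: "(e, False) \<in> edges (doubled G M)" using e by simp
    obtain N1 N2 where N: "perfect_matching (doubled G M) N1" "perfect_matching (doubled G M) N2"
      "N1 \<inter> N2 = {}" "(e, False) \<in> N1"
      by (rule disjoint_pms_through_edge[OF m5 D(1-3) eD])
    have e1: "e \<in> fst ` N1" using N(4) by force
    then have e2: "e \<notin> fst ` N2" using meet[OF N(1-3)] M(2) by blast
    then show ?thesis
      using triple_arrange[OF D(4) perfect_matching_doubled[OF N(1)] perfect_matching_doubled[OF N(2)]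
          meet[OF N(1-3)] jk] M(2) 3 jk e1
      by (intro exI[of _ "\<lambda>l. if l = j then M else if l = k then fst ` N1 else fst ` N2"]) auto
  qed
qed

section \<open>Bridgeless cubic graphs\<close>

text \<open>Bridges are defined by counting components. Sending each component of the graph without
  \<open>f\<close> to the component of \<open>G\<close> that contains it is a surjection. If
  \<open>f\<close> is the only edge leaving \<open>X\<close>, its ends lie in different components
  after the deletion, and these have the same image; so \<open>f\<close> would be a bridge.\<close>

lemma bridgeless_no_one_cut:
  assumes wf: "wf_mgraph G" and bl: "bridgeless G" and X: "X \<subseteq> verts G"
  shows "card (edge_cut G X) \<noteq> 1"
proof
  assume "card (edge_cut G X) = 1"
  then obtain f where f: "edge_cut G X = {f}" by (rule card_1_singletonE)
  then have fE: "f \<in> edges G" using edge_cut_subset[of G X] by blast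
  let ?G' = "delete_edge G f" and ?V = "verts G"
  define R where "R = {(u, v). u \<in> ?V \<and> v \<in> ?V \<and> (u, v) \<in> (adjacency G)\<^sup>*}"
  define R' where "R' = {(u, v). u \<in> ?V \<and> v \<in> ?V \<and> (u, v) \<in> (adjacency ?G')\<^sup>*}"
  have G'_sel: "verts ?G' = ?V" "edges ?G' = edges G - {f}" "ends ?G' = ends G"
    by (simp_all add: delete_edge_def)
  obtain x y where xy: "ends G f = {x, y}" "x \<in> X" "y \<notin> X" "x \<in> ?V" "y \<in> ?V"
  proof -
    obtain u v where uv: "u \<noteq> v" "ends G f = {u, v}" "u \<in> ?V" "v \<in> ?V" by (rule wf_ends[OF wf fE])
    moreover have "f \<in> edge_cut G X" using f by simp
    ultimately show thesis
      using that[of u v] that[of v u] edge_cut_iff[OF wf fE, of X] by auto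
  qed
  have sub: "adjacency ?G' \<subseteq> adjacency G" by (auto simp: adjacency_def G'_sel)
  have R'R: "R' \<subseteq> R" using rtrancl_mono[OF sub] by (auto simp: R_def R'_def)
  have transR: "(u, w) \<in> R" if "(u, v) \<in> R" "(v, w) \<in> R" for u v w
    using that by (auto simp: R_def)
  have symG: "sym (adjacency G)" by (auto simp: sym_def adjacency_def insert_commute)
  have symR: "(v, u) \<in> R" if "(u, v) \<in> R" for u v
    using that sym_rtrancl[OF symG] by (auto simp: R_def dest: symD)
  have reflR': "(v, v) \<in> R'" if "v \<in> ?V" for v using that by (simp add: R'_def)
  have xyR: "(x, y) \<in> R"
  proof -
    have "(x, y) \<in> adjacency G" using xy(1) fE by (auto simp: adjacency_def)
    then show ?thesis using xy by (simp add: R_def r_into_rtrancl)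
  qed
  have stay: "v \<in> X" if "(u, v) \<in> (adjacency ?G')\<^sup>*" "u \<in> X" for u v
    using that
  proof (induction rule: rtrancl_induct)
    case (step v w)
    then obtain h where h: "h \<in> edges G" "h \<noteq> f" "ends G h = {v, w}"
      by (auto simp: adjacency_def G'_sel)
    have "h \<notin> edge_cut G X" using h(2) f by simp
    then show ?case using edge_cut_iff[OF wf h(1), of X] h(3) step by auto
  qed
  have xyR': "(x, y) \<notin> R'" using stay[of x y] xy by (auto simp: R'_def)
  have image: "R `` (R' `` {v}) = R `` {v}" if "v \<in> ?V" for v
  proof
    show "R `` (R' `` {v}) \<subseteq> R `` {v}" using transR R'R by blast
    show "R `` {v} \<subseteq> R `` (R' `` {v})" using reflR'[OF that] by blast
  qed
  have quot: "(\<lambda>C. R `` C) ` (?V // R') = ?V // R"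
  proof -
    have "?V // S = (\<lambda>v. S `` {v}) ` ?V" for S by (auto simp: quotient_def)
    then show ?thesis using image by (simp add: image_image)
  qed
  have finQ: "finite (?V // R')"
    unfolding quotient_def using wf_finite(1)[OF wf] by simp
  have "card (?V // R) \<noteq> card (?V // R')"
  proof
    assume "card (?V // R) = card (?V // R')"
    then have inj: "inj_on (\<lambda>C. R `` C) (?V // R')"
      using quot by (intro eq_card_imp_inj_on[OF finQ]) simp
    have "R `` {x} = R `` {y}" using xyR transR symR by blast
    then have "R `` (R' `` {x}) = R `` (R' `` {y})" using image xy by simp
    then have "R' `` {x} = R' `` {y}"
      by (rule inj_onD[OF inj _ quotientI[OF xy(4)] quotientI[OF xy(5)]])
    then show False using reflR'[OF xy(5)] xyR' by blast
  qed
  moreover have "card (?V // R) \<le> card (?V // R')" using card_image_le[OF finQ] quot by metis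
  ultimately have "card (components G) < card (components ?G')"
    unfolding components_def G'_sel(1) R_def[symmetric] R'_def[symmetric] by simp
  then have "bridge G f" using fE by (simp add: bridge_def)
  then show False using bl by (auto simp: bridgeless_def)
qed

text \<open>Bridgelessness is expressed by the absence of cuts with one edge, a condition that can
  be verified by counting in the smaller graphs, without reference to components.\<close>

definition bridgefree_cubic :: "('v, 'e) mgraph \<Rightarrow> bool" where
  "bridgefree_cubic G \<longleftrightarrow> wf_mgraph G \<and> regular 3 G \<and> (\<forall>X. X \<subseteq> verts G \<longrightarrow> card (edge_cut G X) \<noteq> 1)"

lemma bridgefree_cubicD:
  assumes "bridgefree_cubic G"
  shows "wf_mgraph G" "regular 3 G" "\<And>X. X \<subseteq> verts G \<Longrightarrow> card (edge_cut G X) \<noteq> 1"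
  using assms by (simp_all add: bridgefree_cubic_def)

section \<open>Splitting along cuts with no or two edges\<close>

definition induced :: "('v, 'e) mgraph \<Rightarrow> 'v set \<Rightarrow> ('v, 'e) mgraph" where
  "induced G X = \<lparr>verts = X, edges = {h \<in> edges G. ends G h \<subseteq> X}, ends = ends G\<rparr>"

lemma induced_sel [simp]:
  "verts (induced G X) = X" "edges (induced G X) = {h \<in> edges G. ends G h \<subseteq> X}"
  "ends (induced G X) = ends G"
  by (simp_all add: induced_def)

lemma bridgefree_induced:
  assumes G: "bridgefree_cubic G" and X: "X \<subseteq> verts G" "X \<noteq> {}" and cut: "edge_cut G X = {}"
  shows "bridgefree_cubic (induced G X)"
proof -
  note wf = bridgefree_cubicD(1)[OF G]
  have inside: "ends G h \<subseteq> X" if "h \<in> edges G" "ends G h \<inter> X \<noteq> {}" for h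
    using that cut edge_cut_iff[OF wf that(1), of X] by auto
  have wfI: "wf_mgraph (induced G X)"
    using wf X finite_subset[OF X(1)] by (auto simp: wf_mgraph_def)
  have "degree (induced G X) v = 3" if v: "v \<in> X" for v
  proof -
    have "{h \<in> edges (induced G X). v \<in> ends (induced G X) h} = {h \<in> edges G. v \<in> ends G h}"
      using inside v by auto
    then show ?thesis
      using bridgefree_cubicD(2)[OF G] v X by (auto simp: regular_def degree_def)
  qed
  moreover have "edge_cut (induced G X) W = edge_cut G W" if W: "W \<subseteq> X" for W
  proof -
    have "h \<in> edge_cut (induced G X) W \<longleftrightarrow> h \<in> edge_cut G W" for h
    proof (cases "h \<in> edges G \<and> ends G h \<subseteq> X")
      case True
      then have h: "h \<in> edges G" "h \<in> edges (induced G X)" by auto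
      show ?thesis unfolding edge_cut_iff[OF wf h(1)] edge_cut_iff[OF wfI h(2)] by simp
    next
      case False
      then show ?thesis using inside[of h] W by (auto simp: edge_cut_def)
    qed
    then show ?thesis by blast
  qed
  ultimately show ?thesis
    using wfI bridgefree_cubicD(3)[OF G] X(1) by (auto simp: bridgefree_cubic_def regular_def)
qed

text \<open>The cut edge \<open>f\<close> is reused as the new edge between the \<open>X\<close>-ends \<open>p\<close>, \<open>q\<close> of the two cut edges.\<close>

definition cut_side :: "('v, 'e) mgraph \<Rightarrow> 'v set \<Rightarrow> 'e \<Rightarrow> 'v \<Rightarrow> 'v \<Rightarrow> ('v, 'e) mgraph" where
  "cut_side G X f p q = \<lparr>verts = X, edges = insert f {h \<in> edges G. ends G h \<subseteq> X},
     ends = (ends G)(f := {p, q})\<rparr>"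

lemma cut_side_sel [simp]:
  "verts (cut_side G X f p q) = X"
  "edges (cut_side G X f p q) = insert f {h \<in> edges G. ends G h \<subseteq> X}"
  "ends (cut_side G X f p q) = (ends G)(f := {p, q})"
  by (simp_all add: cut_side_def)

locale two_cut =
  fixes G :: "('v, 'e) mgraph" and X :: "'v set" and f g :: 'e and p q p' q' :: 'v
  assumes G: "bridgefree_cubic G" and X: "X \<subseteq> verts G" and cut: "edge_cut G X = {f, g}" and fg: "f \<noteq> g"
    and ends_f: "ends G f = {p, p'}" and ends_g: "ends G g = {q, q'}"
    and side: "p \<in> X" "q \<in> X" "p' \<in> verts G - X" "q' \<in> verts G - X"
begin

lemmas wf = bridgefree_cubicD(1)[OF G]
lemmas reg = bridgefree_cubicD(2)[OF G]
lemmas no1 = bridgefree_cubicD(3)[OF G]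

lemma fgE: "f \<in> edges G" "g \<in> edges G"
  using cut edge_cut_subset[of G X] by auto

lemma inside: "h \<in> edges G \<Longrightarrow> h \<noteq> f \<Longrightarrow> h \<noteq> g \<Longrightarrow> ends G h \<inter> X \<noteq> {} \<Longrightarrow> ends G h \<subseteq> X"
  using cut edge_cut_iff[OF wf, of h X] by auto

text \<open>The roles of \<open>f\<close> and \<open>g\<close> are exchanged, so the other side
  reuses the name \<open>g\<close>, and the two smaller graphs have disjoint edge sets.\<close>

lemma swap: "two_cut G (verts G - X) g f q' p' q p"
proof -
  have "verts G - (verts G - X) = X" using X by auto
  then show ?thesis
    using G X cut fg ends_f ends_g side
    by unfold_locales (auto simp: edge_cut_compl insert_commute)
qed

lemma card_star: "v \<in> verts G \<Longrightarrow> card {h \<in> edges G. v \<in> ends G h} = 3"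
  using reg by (simp add: regular_def degree_def)

text \<open>Otherwise only the third edge at \<open>p\<close> would leave \<open>X - {p}\<close>, a
  cut with one edge.\<close>

lemma pq: "p \<noteq> q"
proof
  assume eq: "p = q"
  let ?D = "{h \<in> edges G. p \<in> ends G h}"
  have "edge_cut G (X - {p}) = ?D - {f, g}"
  proof (rule set_eqI)
    fix h
    show "h \<in> edge_cut G (X - {p}) \<longleftrightarrow> h \<in> ?D - {f, g}"
    proof (cases "h \<in> edges G \<and> h \<noteq> f \<and> h \<noteq> g")
      case True
      obtain u v where uv: "u \<noteq> v" "ends G h = {u, v}" "u \<in> verts G" "v \<in> verts G"
        using wf_ends[OF wf] True by blast
      have "h \<in> edge_cut G (X - {p}) \<longleftrightarrow> (u \<in> X - {p}) \<noteq> (v \<in> X - {p})"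
        using True uv by (auto simp: edge_cut_def)
      moreover have "u \<in> X \<longleftrightarrow> v \<in> X" using inside[of h] True uv by auto
      ultimately show ?thesis using True uv side(1) by auto
    next
      case False
      then show ?thesis
        using ends_f ends_g side eq edge_cut_subset[of G "X - {p}"] by (auto simp: edge_cut_def)
    qed
  qed
  moreover have "f \<in> ?D" "g \<in> ?D" using ends_f ends_g eq fgE by auto
  then have "card (?D - {f, g}) = 3 - 2"
    using fg card_star[of p] side X by (subst card_Diff_subset) auto
  ultimately have "card (edge_cut G (X - {p})) = 1" by simp
  moreover have "X - {p} \<subseteq> verts G" using X by blast
  ultimately show False using no1 by blast
qed

abbreviation "S \<equiv> cut_side G X f p q"

lemma wf_S: "wf_mgraph S"
proof -
  have "ends S h \<subseteq> X \<and> card (ends S h) = 2" if "h \<in> edges S" for h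
    using that wf pq side by (auto simp: wf_mgraph_def)
  moreover have "finite X" using wf_finite(1)[OF wf] X finite_subset by blast
  moreover have "finite (edges S)" using wf_finite(2)[OF wf] by simp
  ultimately show ?thesis using side(1) unfolding wf_mgraph_def by auto
qed

lemma degree_S:
  assumes v: "v \<in> X"
  shows "degree S v = 3"
proof -
  let ?D = "{h \<in> edges G. v \<in> ends G h}"
  have c: "card ?D = 3" using card_star v X by blast
  have fin: "finite ?D" using wf_finite(2)[OF wf] by simp
  have out: "p' \<notin> X" "q' \<notin> X" using side by auto
  have mem: "h \<in> edges S \<and> v \<in> ends S h \<longleftrightarrow> (h \<in> ?D \<and> h \<noteq> f \<and> h \<noteq> g) \<or> (h = f \<and> (v = p \<or> v = q))" for h
  proof (cases "h = f \<or> h = g")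
    case True
    then show ?thesis using fg ends_g out by auto
  next
    case False
    then show ?thesis using inside[of h] v by auto
  qed
  have fD: "f \<in> ?D \<longleftrightarrow> v = p" and gD: "g \<in> ?D \<longleftrightarrow> v = q" using fgE ends_f ends_g v out by auto
  consider "v = p" | "v = q" | "v \<noteq> p" "v \<noteq> q" by blast
  then show ?thesis
  proof cases
    case 1
    have "{h \<in> edges S. v \<in> ends S h} = ?D" unfolding mem using 1 fD gD pq by blast
    then show ?thesis unfolding degree_def using c by simp
  next
    case 2
    have eq: "{h \<in> edges S. v \<in> ends S h} = insert f (?D - {g})" unfolding mem using 2 fD gD pq by blast
    have "card (insert f (?D - {g})) = Suc (card (?D - {g}))"
      using fin fD 2 pq by (intro card_insert_disjoint) blast+
    also have "\<dots> = card ?D" using gD 2 by (intro card_Suc_Diff1[OF fin]) blast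
    finally show ?thesis unfolding degree_def eq using c by simp
  next
    case 3
    have "{h \<in> edges S. v \<in> ends S h} = ?D" unfolding mem using 3 fD gD by blast
    then show ?thesis unfolding degree_def using c by simp
  qed
qed

text \<open>The cut of \<open>W\<close> in \<open>S\<close> has as many edges as a cut of
  \<open>G\<close>: that of \<open>X - W\<close> if \<open>W\<close> contains both \<open>p\<close>
  and \<open>q\<close>, and that of \<open>W\<close> in the other cases.\<close>

lemma no1_S:
  assumes W: "W \<subseteq> X"
  shows "card (edge_cut S W) \<noteq> 1"
proof -
  let ?n = "card (edge_cut G W - {f, g})"
  have out: "p' \<notin> X" "q' \<notin> X" using side by auto
  have fS: "f \<in> edges S" by simp
  have rest: "edge_cut S W - {f} = edge_cut G W - {f, g}"
  proof (rule set_eqI)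
    fix h
    show "h \<in> edge_cut S W - {f} \<longleftrightarrow> h \<in> edge_cut G W - {f, g}"
    proof (cases "h \<in> edges G \<and> h \<noteq> f \<and> h \<noteq> g \<and> ends G h \<inter> X \<noteq> {}")
      case True
      then have h: "h \<in> edges G" "h \<in> edges S" using inside by auto
      show ?thesis
        using True unfolding Diff_iff edge_cut_iff[OF wf h(1)] edge_cut_iff[OF wf_S h(2)] by simp
    next
      case False
      then show ?thesis using W ends_g out by (auto simp: edge_cut_def)
    qed
  qed
  have rest': "edge_cut G (X - W) - {f, g} = edge_cut G W - {f, g}"
  proof (rule set_eqI)
    fix h
    show "h \<in> edge_cut G (X - W) - {f, g} \<longleftrightarrow> h \<in> edge_cut G W - {f, g}"
    proof (cases "h \<in> edges G \<and> h \<noteq> f \<and> h \<noteq> g")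
      case True
      then have h: "h \<in> edges G" by simp
      obtain u v where uv: "u \<noteq> v" "ends G h = {u, v}" by (rule wf_ends[OF wf h])
      have "u \<in> X \<longleftrightarrow> v \<in> X" using inside[of h] True uv by auto
      then show ?thesis
        using True uv W unfolding Diff_iff edge_cut_iff[OF wf h] by auto
    next
      case False
      then show ?thesis by (auto simp: edge_cut_def)
    qed
  qed
  have cnt: "card (edge_cut G Z) = card (edge_cut G Z - {f, g}) + (of_bool (p \<in> Z) + of_bool (q \<in> Z))"
    if "Z \<subseteq> X" for Z
  proof -
    have "f \<in> edge_cut G Z \<longleftrightarrow> p \<in> Z" "g \<in> edge_cut G Z \<longleftrightarrow> q \<in> Z"
      unfolding edge_cut_iff[OF wf fgE(1)] edge_cut_iff[OF wf fgE(2)] ends_f ends_g using that out by auto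
    moreover have "card (edge_cut G Z) = card (edge_cut G Z - {f, g}) + (\<Sum>h\<in>{f, g}. of_bool (h \<in> edge_cut G Z))"
      by (rule card_cut_split_off[OF wf]) simp
    ultimately show ?thesis using fg by simp
  qed
  have "card (edge_cut S W) = ?n + of_bool ((p \<in> W) \<noteq> (q \<in> W))"
  proof -
    have "f \<in> edge_cut S W \<longleftrightarrow> (p \<in> W) \<noteq> (q \<in> W)"
      unfolding edge_cut_iff[OF wf_S fS] by auto
    moreover have "card (edge_cut S W) = card (edge_cut S W - {f}) + (\<Sum>h\<in>{f}. of_bool (h \<in> edge_cut S W))"
      by (rule card_cut_split_off[OF wf_S]) simp
    ultimately show ?thesis unfolding rest by simp
  qed
  moreover have "card (edge_cut G W) = ?n + (of_bool (p \<in> W) + of_bool (q \<in> W))" by (rule cnt[OF W])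
  moreover have "card (edge_cut G (X - W)) = ?n + (of_bool (p \<notin> W) + of_bool (q \<notin> W))"
    using cnt[of "X - W"] side unfolding rest' by simp
  moreover have "card (edge_cut G W) \<noteq> 1" "card (edge_cut G (X - W)) \<noteq> 1"
    using no1[of W] no1[of "X - W"] W X by blast+
  ultimately show ?thesis by (cases "p \<in> W"; cases "q \<in> W") simp_all
qed

lemma bridgefree_S: "bridgefree_cubic S"
  using wf_S degree_S no1_S by (simp add: bridgefree_cubic_def regular_def)

text \<open>In \<open>S\<close> the edge \<open>f\<close> covers \<open>p\<close> and
  \<open>q\<close>; in \<open>G\<close> it covers only \<open>p\<close> within \<open>X\<close>, and
  \<open>g\<close>, present in \<open>N\<close> exactly when \<open>f\<close> is in
  \<open>M\<close>, takes over \<open>q\<close>.\<close>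

lemma covered_once:
  assumes M: "perfect_matching S M" and N: "N \<subseteq> insert g {h \<in> edges G. ends G h \<subseteq> verts G - X}"
    and eq: "f \<in> M \<longleftrightarrow> g \<in> N" and v: "v \<in> X"
  shows "\<exists>!h. h \<in> M \<union> N \<and> v \<in> ends G h"
proof -
  have ME: "M \<subseteq> insert f {h \<in> edges G. ends G h \<subseteq> X}" and cov: "\<exists>!h. h \<in> M \<and> v \<in> ends S h"
    using M v by (simp_all add: perfect_matching_def)
  have out: "p' \<notin> X" "q' \<notin> X" using side by auto
  have gM: "g \<notin> M" using ME fg ends_g out by auto
  have Nv: "h = g \<and> v = q" if "h \<in> N" "v \<in> ends G h" for h
    using that N v ends_g out by auto
  have fS: "ends S f = {p, q}" by simp
  have old: "ends S h = ends G h" if "h \<noteq> f" for h using that by simp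
  show ?thesis
  proof (cases "f \<in> M \<and> v = q")
    case True
    show ?thesis
    proof (rule ex1I[of _ g])
      show "g \<in> M \<union> N \<and> v \<in> ends G g" using True eq ends_g by simp
    next
      fix h assume h: "h \<in> M \<union> N \<and> v \<in> ends G h"
      show "h = g"
      proof (cases "h \<in> N")
        case False
        then have hM: "h \<in> M" using h by simp
        have "h \<noteq> f" using h True ends_f pq side by auto
        then have "v \<in> ends S h" using h old by simp
        moreover have "v \<in> ends S f" using True fS by simp
        ultimately have "h = f" using cov hM True by blast
        then show ?thesis using \<open>h \<noteq> f\<close> by simp
      qed (use Nv h in blast)
    qed
  next
    case False
    have "(h \<in> M \<union> N \<and> v \<in> ends G h) = (h \<in> M \<and> v \<in> ends S h)" for h
    proof (cases "h = f")
      case True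
      have "f \<notin> N \<or> v \<notin> ends G f" using Nv[of f] fg by blast
      then show ?thesis using True False ends_f fS v out by auto
    next
      case hf: False
      have "v \<notin> ends G h" if "h \<in> N"
      proof
        assume "v \<in> ends G h"
        then have "h = g" "v = q" using Nv that by blast+
        then show False using False eq that by blast
      qed
      then show ?thesis using old[OF hf] by auto
    qed
    then show ?thesis using cov by simp
  qed
qed

end


lemma triple_union:
  assumes F1: "triple G1 F1" and F2: "triple G2 F2"
    and pm: "\<And>k. k < 3 \<Longrightarrow> perfect_matching G (F1 k \<union> F2 k)"
    and E: "edges G \<subseteq> edges G1 \<union> edges G2" and disj: "edges G1 \<inter> edges G2 = {}"
  shows "triple G (\<lambda>k. F1 k \<union> F2 k)"
proof -
  have sub: "F1 k \<subseteq> edges G1" "F2 k \<subseteq> edges G2" if "k < 3" for k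
    using F1 F2 that by (simp_all add: triple_def perfect_matching_def)
  have "\<exists>k<3. h \<notin> F1 k \<union> F2 k" if h: "h \<in> edges G" for h
  proof (cases "h \<in> edges G1")
    case True
    then obtain k where k: "k < 3" "h \<notin> F1 k" using F1 unfolding triple_def by blast
    moreover have "h \<notin> F2 k" using sub(2)[OF k(1)] disj True by blast
    ultimately show ?thesis by blast
  next
    case False
    then have "h \<in> edges G2" using h E by blast
    then obtain k where k: "k < 3" "h \<notin> F2 k" using F2 unfolding triple_def by blast
    moreover have "h \<notin> F1 k" using sub(1)[OF k(1)] False by blast
    ultimately show ?thesis by blast
  qed
  then show ?thesis using pm by (simp add: triple_def)
qed

abbreviation triples_below :: "('v, 'e) mgraph \<Rightarrow> bool" where
  "triples_below G \<equiv> \<forall>H :: ('v, 'e) mgraph. bridgefree_cubic H \<and> card (verts H) < card (verts G) \<longrightarrow>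
    (\<forall>e\<in>edges H. \<forall>K. K \<subset> {..<3} \<longrightarrow> (\<exists>F. triple H F \<and> {k. k < 3 \<and> e \<in> F k} = K))"

lemma empty_cut_step:
  fixes G :: "('v, 'e) mgraph"
  assumes G: "bridgefree_cubic G" and X: "X \<subseteq> verts G" "X \<noteq> {}" "X \<noteq> verts G" and cut: "edge_cut G X = {}"
    and IH: "triples_below G"
    and e: "e \<in> edges G" "ends G e \<subseteq> X" and K: "K \<subset> {..<3}"
  shows "\<exists>F. triple G F \<and> {k. k < 3 \<and> e \<in> F k} = K"
proof -
  let ?Y = "verts G - X"
  let ?A = "induced G X" and ?B = "induced G ?Y"
  note wf = bridgefree_cubicD(1)[OF G]
  note finV = wf_finite(1)[OF wf]
  have Y: "?Y \<subseteq> verts G" "?Y \<noteq> {}" using X by auto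
  have cutY: "edge_cut G ?Y = {}" using cut edge_cut_compl[OF X(1)] by simp
  have bf: "bridgefree_cubic ?A" "bridgefree_cubic ?B"
    by (rule bridgefree_induced[OF G X(1,2) cut], rule bridgefree_induced[OF G Y cutY])
  have smaller: "card (verts ?A) < card (verts G)" "card (verts ?B) < card (verts G)"
    using X finV by (auto intro!: psubset_card_mono)
  have eA: "e \<in> edges ?A" using e by simp
  obtain F1 where F1: "triple ?A F1" "{k. k < 3 \<and> e \<in> F1 k} = K"
    using IH[rule_format, OF conjI[OF bf(1) smaller(1)] eA K] by (elim exE conjE)
  \<comment> \<open>The induction hypothesis speaks about a given edge, so some edge of the other
    part is chosen; any triple there will do.\<close>
  obtain w where w: "w \<in> ?Y" using Y by blast
  have "degree ?B w = 3" using bridgefree_cubicD(2)[OF bf(2)] w by (simp add: regular_def)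
  then have "{h \<in> edges ?B. w \<in> ends ?B h} \<noteq> {}" unfolding degree_def by (metis card.empty zero_neq_numeral)
  then obtain h where h: "h \<in> edges ?B" by blast
  obtain F2 where F2: "triple ?B F2"
    using IH[rule_format, OF conjI[OF bf(2) smaller(2)] h K] by (elim exE conjE)
  have sub: "F1 k \<subseteq> edges ?A" "F2 k \<subseteq> edges ?B" if "k < 3" for k
    using F1 F2 that by (simp_all add: triple_def perfect_matching_def)
  have split: "ends G h \<subseteq> X \<or> ends G h \<subseteq> ?Y" if h: "h \<in> edges G" for h
  proof -
    have "ends G h \<subseteq> verts G" using wf h by (simp add: wf_mgraph_def)
    then show ?thesis using cut edge_cut_iff[OF wf h, of X] by auto
  qed
  have nonempty: "ends G h \<noteq> {}" if "h \<in> edges G" for h using wf that by (auto simp: wf_mgraph_def)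
  have disj: "edges ?A \<inter> edges ?B = {}" using nonempty by auto
  have "perfect_matching G (F1 k \<union> F2 k)" if k: "k < 3" for k
    unfolding perfect_matching_def
  proof (intro conjI ballI)
    show "F1 k \<union> F2 k \<subseteq> edges G" using sub[OF k] by auto
    fix v assume v: "v \<in> verts G"
    have ex: "v \<in> X \<Longrightarrow> \<exists>!h. h \<in> F1 k \<and> v \<in> ends G h" "v \<in> ?Y \<Longrightarrow> \<exists>!h. h \<in> F2 k \<and> v \<in> ends G h"
      using F1(1) F2 k by (simp_all add: triple_def perfect_matching_def)
    show "\<exists>!h. h \<in> F1 k \<union> F2 k \<and> v \<in> ends G h"
    proof (cases "v \<in> X")
      case True
      then have "(h \<in> F1 k \<union> F2 k \<and> v \<in> ends G h) = (h \<in> F1 k \<and> v \<in> ends G h)" for h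
        using sub(2)[OF k] by auto
      then show ?thesis using ex(1)[OF True] by simp
    next
      case False
      then have "(h \<in> F1 k \<union> F2 k \<and> v \<in> ends G h) = (h \<in> F2 k \<and> v \<in> ends G h)" for h
        using sub(1)[OF k] by auto
      then show ?thesis using ex(2) v False by simp
    qed
  qed
  then have "triple G (\<lambda>k. F1 k \<union> F2 k)"
    by (rule triple_union[OF F1(1) F2 _ _ disj]) (use split in auto)
  moreover have "e \<notin> F2 k" if "k < 3" for k using sub(2)[OF that] eA disj by blast
  then have "{k. k < 3 \<and> e \<in> F1 k \<union> F2 k} = K" using F1(2) by auto
  ultimately show ?thesis by blast
qed

context two_cut
begin

text \<open>On the side of \<open>X\<close> the triple is chosen according to \<open>e\<close>; the
  set of indices that use \<open>f\<close> is then imposed on \<open>g\<close> on the other side. It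
  is a proper subset because no edge lies in all three matchings of a triple.\<close>

lemma two_cut_step:
  assumes IH: "triples_below G"
    and e: "e \<in> edges G" "ends G e \<subseteq> X \<or> e = f \<or> e = g" and K: "K \<subset> {..<3}"
  shows "\<exists>F. triple G F \<and> {k. k < 3 \<and> e \<in> F k} = K"
proof -
  let ?Y = "verts G - X"
  interpret Y: two_cut G ?Y g f q' p' q p by (rule swap)
  let ?B = "cut_side G ?Y g q' p'"
  note finV = wf_finite(1)[OF wf]
  have smaller: "card (verts S) < card (verts G)" "card (verts ?B) < card (verts G)"
    using side X finV by (auto intro!: psubset_card_mono)
  \<comment> \<open>\<open>g\<close> is not an edge of the smaller graph; in the glued triple it
    lies in the same matchings as \<open>f\<close>.\<close>
  define e' where "e' = (if e = g then f else e)"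
  have e': "e' \<in> edges S" using e by (auto simp: e'_def)
  obtain F1 where F1: "triple S F1" "{k. k < 3 \<and> e' \<in> F1 k} = K"
    using IH[rule_format, OF conjI[OF bridgefree_S smaller(1)] e' K] by (elim exE conjE)
  define K' where "K' = {k. k < 3 \<and> f \<in> F1 k}"
  have fS: "f \<in> edges S" by simp
  then obtain k0 where "k0 < 3" "f \<notin> F1 k0" using F1(1) unfolding triple_def by blast
  then have K': "K' \<subset> {..<3}" unfolding K'_def by blast
  have gB: "g \<in> edges ?B" by simp
  obtain F2 where F2: "triple ?B F2" "{k. k < 3 \<and> g \<in> F2 k} = K'"
    using IH[rule_format, OF conjI[OF Y.bridgefree_S smaller(2)] gB K'] by (elim exE conjE)
  have match: "f \<in> F1 k \<longleftrightarrow> g \<in> F2 k" if "k < 3" for k using F2(2) that unfolding K'_def by blast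
  have pm: "perfect_matching S (F1 k)" "perfect_matching ?B (F2 k)" if "k < 3" for k
    using F1(1) F2(1) that by (simp_all add: triple_def)
  have sub: "F1 k \<subseteq> insert f {h \<in> edges G. ends G h \<subseteq> X}" "F2 k \<subseteq> insert g {h \<in> edges G. ends G h \<subseteq> ?Y}"
    if "k < 3" for k
    using pm[OF that] by (simp_all add: perfect_matching_def)
  have nonempty: "ends G h \<noteq> {}" if "h \<in> edges G" for h using wf that by (auto simp: wf_mgraph_def)
  have "\<not> ends G f \<subseteq> X" "\<not> ends G f \<subseteq> ?Y" "\<not> ends G g \<subseteq> X" "\<not> ends G g \<subseteq> ?Y"
    using ends_f ends_g side by auto
  then have disj: "edges S \<inter> edges ?B = {}" using nonempty fg by auto
  have cover: "edges G \<subseteq> edges S \<union> edges ?B"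
  proof
    fix h assume h: "h \<in> edges G"
    have "ends G h \<subseteq> verts G" using wf h by (simp add: wf_mgraph_def)
    then show "h \<in> edges S \<union> edges ?B"
      using inside[OF h] h by (cases "h = f"; cases "h = g") auto
  qed
  have XX: "verts G - ?Y = X" using X by auto
  have "perfect_matching G (F1 k \<union> F2 k)" if k: "k < 3" for k
    unfolding perfect_matching_def
  proof (intro conjI ballI)
    show "F1 k \<union> F2 k \<subseteq> edges G" using sub[OF k] fgE by auto
    fix v assume v: "v \<in> verts G"
    show "\<exists>!h. h \<in> F1 k \<union> F2 k \<and> v \<in> ends G h"
    proof (cases "v \<in> X")
      case True
      then show ?thesis by (rule covered_once[OF pm(1)[OF k] sub(2)[OF k] match[OF k]])
    next
      case False
      then have "v \<in> ?Y" using v by blast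
      then have "\<exists>!h. h \<in> F2 k \<union> F1 k \<and> v \<in> ends G h"
        by (rule Y.covered_once[unfolded XX, OF pm(2)[OF k] sub(1)[OF k] match[OF k, symmetric]])
      then show ?thesis by (simp only: Un_commute)
    qed
  qed
  then have "triple G (\<lambda>k. F1 k \<union> F2 k)" by (rule triple_union[OF F1(1) F2(1) _ cover disj])
  moreover have "{k. k < 3 \<and> e \<in> F1 k \<union> F2 k} = K"
  proof -
    have "e \<in> F1 k \<union> F2 k \<longleftrightarrow> e' \<in> F1 k" if k: "k < 3" for k
    proof (cases "e = g")
      case True
      have "g \<notin> edges S" using gB disj by blast
      then have "g \<notin> F1 k" using sub(1)[OF k] by auto
      then show ?thesis using True match[OF k] by (simp add: e'_def)
    next
      case False
      then have "e \<in> edges S" using e' by (simp add: e'_def)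
      then have "e \<notin> edges ?B" using disj by blast
      then have "e \<notin> F2 k" using sub(2)[OF k] by auto
      then show ?thesis using False by (simp add: e'_def)
    qed
    then show ?thesis using F1(2) by blast
  qed
  ultimately show ?thesis by blast
qed

end

lemma triples_bridgefree:
  fixes G :: "('v, 'e) mgraph"
  assumes m5: "m 5 \<ge> 2" and G: "bridgefree_cubic G" and e: "e \<in> edges G" and K: "K \<subset> {..<3}"
  shows "\<exists>F. triple G F \<and> {k. k < 3 \<and> e \<in> F k} = K"
  using G e K
proof (induction "card (verts G)" arbitrary: G e K rule: less_induct)
  case (less G)
  note G = less.prems(1)
  note wf = bridgefree_cubicD(1)[OF G]
  have IH: "triples_below G"
    using less.hyps by blast
  have endsV: "ends G e \<subseteq> verts G" using wf less.prems(2) by (simp add: wf_mgraph_def)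
  show ?case
  proof (cases "edge_connected 3 G")
    case True
    then have "cubic3 G" using G by (simp add: cubic3_def bridgefree_cubic_def)
    then show ?thesis by (rule triples_cubic3[OF m5 _ less.prems(2,3)])
  next
    case False
    then obtain X where X: "X \<noteq> {}" "X \<subset> verts G" "card (edge_cut G X) < 3"
      unfolding edge_connected_def by (auto simp: not_le)
    have XV: "X \<subseteq> verts G" using X by blast
    have "card (edge_cut G X) \<noteq> 1" by (rule bridgefree_cubicD(3)[OF G XV])
    then consider "card (edge_cut G X) = 0" | "card (edge_cut G X) = 2" using X(3) by linarith
    then show ?thesis
    proof cases
      case 1
      then have cut: "edge_cut G X = {}" using finite_edge_cut[OF wf] by simp
      then have cutY: "edge_cut G (verts G - X) = {}" using edge_cut_compl[OF XV] by simp
      have "ends G e \<subseteq> X \<or> ends G e \<subseteq> verts G - X"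
        using cut edge_cut_iff[OF wf less.prems(2), of X] endsV by auto
      then show ?thesis
      proof
        assume "ends G e \<subseteq> X"
        then show ?thesis
          using X by (intro empty_cut_step[OF G XV _ _ cut IH less.prems(2) _ less.prems(3)]) auto
      next
        assume "ends G e \<subseteq> verts G - X"
        then show ?thesis
          using X by (intro empty_cut_step[OF G _ _ _ cutY IH less.prems(2) _ less.prems(3)]) auto
      qed
    next
      case 2
      then obtain f g where fg: "edge_cut G X = {f, g}" "f \<noteq> g" by (auto simp: card_2_iff)
      have split: "\<exists>p p'. ends G h = {p, p'} \<and> p \<in> X \<and> p' \<in> verts G - X" if h: "h \<in> edge_cut G X" for h
      proof -
        have hE: "h \<in> edges G" using h edge_cut_subset[of G X] by blast
        obtain u v where uv: "ends G h = {u, v}" "u \<in> verts G" "v \<in> verts G" by (rule wf_ends[OF wf hE])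
        have "u \<in> X \<and> v \<notin> X \<or> v \<in> X \<and> u \<notin> X"
          using h uv edge_cut_iff[OF wf hE, of X] by auto
        then show ?thesis
        proof
          assume "v \<in> X \<and> u \<notin> X"
          then show ?thesis using uv by (intro exI[of _ v] exI[of _ u]) auto
        qed (use uv in blast)
      qed
      obtain p p' where p: "ends G f = {p, p'}" "p \<in> X" "p' \<in> verts G - X" using split[of f] fg by auto
      obtain q q' where q: "ends G g = {q, q'}" "q \<in> X" "q' \<in> verts G - X" using split[of g] fg by auto
      interpret X: two_cut G X f g p q p' q'
        by unfold_locales (fact G XV fg p q)+
      interpret Y: two_cut G "verts G - X" g f q' p' q p by (rule X.swap)
      have "e \<in> {f, g} \<or> ends G e \<subseteq> X \<or> ends G e \<subseteq> verts G - X"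
        using fg(1) edge_cut_iff[OF wf less.prems(2), of X] endsV by auto
      then show ?thesis
        using X.two_cut_step[OF IH less.prems(2) _ less.prems(3)]
          Y.two_cut_step[OF IH less.prems(2) _ less.prems(3)] by blast
    qed
  qed
qed

theorem theorem5p7:
  fixes G :: "('v, 'e) mgraph" and e :: 'e and i :: nat
  assumes "m 5 \<ge> 2"
    and "wf_mgraph G" and "cubic G" and "bridgeless G"
    and "e \<in> edges G" and "i \<in> {0, 1, 2}"
  shows "\<exists>T. FR_triple G T \<and> \<nu> T e = i"
proof -
  have "bridgefree_cubic G"
    using assms(2,3) bridgeless_no_one_cut[OF assms(2,4)] by (simp add: bridgefree_cubic_def cubic_def)
  \<comment> \<open>An index set with \<open>i\<close> elements; it is proper because
    \<open>i \<le> 2\<close>.\<close>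
  moreover have "{..<i} \<subset> {..<3}" using assms(6) by auto
  ultimately obtain F where F: "triple G F" "{k. k < 3 \<and> e \<in> F k} = {..<i}"
    using triples_bridgefree[OF assms(1) _ assms(5)] by blast
  define T where "T = {#F 0, F 1, F 2#}"
  have \<nu>: "\<nu> T f = card {k. k < 3 \<and> f \<in> F k}" for f
  proof -
    have "{k. k < 3 \<and> f \<in> F k} = {k \<in> {0, 1, 2}. f \<in> F k}" by auto
    also have "card \<dots> = (\<Sum>k\<in>{0, 1, 2}. of_bool (f \<in> F k))" by (rule card_filter_sum) simp
    also have "\<dots> = \<nu> T f" by (simp add: \<nu>_def T_def)
    finally show ?thesis by simp
  qed
  have "card {k. k < 3 \<and> f \<in> F k} \<le> 2" if "f \<in> edges G" for f
  proof -
    obtain k where "k < 3" "f \<notin> F k" using F(1) \<open>f \<in> edges G\<close> unfolding triple_def by blast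
    then have "{k. k < 3 \<and> f \<in> F k} \<subset> {..<3}" by auto
    then have "card {k. k < 3 \<and> f \<in> F k} < card {..<3::nat}" by (rule psubset_card_mono[OF finite_lessThan])
    then show ?thesis by simp
  qed
  moreover have "\<forall>M\<in>#T. perfect_matching G M" using F(1) by (auto simp: T_def triple_def)
  ultimately have "FR_triple G T" by (simp add: FR_triple_def \<nu>) (simp add: T_def)
  then show ?thesis using \<nu>[of e] F(2) by auto
qed

end
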